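(* Let $X$ be a Peano continuum and let $x_0\in X$. If the fundamental group $\pi_1(X,x_0)$ is countable, then $\pi_1(X,x_0)$ is finitely presented.
   Context: A Peano continuum is a (nonempty) connected, locally connected, compact metric space. Such a space is path connected, so the isomorphism type of the fundamental group does not depend on the base point. *)

theory Defs
  imports "HOL-Analysis.Analysis" "HOL-Algebra.Coset"
begin

section \<open>Peano continua\<close>

text \<open>A metric space is a subset of a type of class \<open>metric_space\<close>, with the induced metric.\<close>

definition peano_continuum :: "'a::metric_space set \<Rightarrow> bool" where
  "peano_continuum X \<longleftrightarrow> X \<noteq> {} \<and> compact X \<and> connected X \<and> locally connected X"


section \<open>The fundamental group\<close>

text \<open>
  Paths are functions on all of \<open>real\<close>, of which only the restriction to the unit interval
  matters: paths that agree there are related by \<^const>\<open>homotopic_paths\<close>, so a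
  homotopy class does not depend on the values elsewhere.
\<close>

definition loops_at :: "'a::topological_space set \<Rightarrow> 'a \<Rightarrow> (real \<Rightarrow> 'a) set" where
  "loops_at X x = {p. path p \<and> path_image p \<subseteq> X \<and> pathstart p = x \<and> pathfinish p = x}"

definition path_class :: "'a::topological_space set \<Rightarrow> (real \<Rightarrow> 'a) \<Rightarrow> (real \<Rightarrow> 'a) set" where
  "path_class X p = {q. homotopic_paths X p q}"

definition fundamental_group ::
    "'a::topological_space set \<Rightarrow> 'a \<Rightarrow> (real \<Rightarrow> 'a) set monoid" where
  "fundamental_group X x =
     \<lparr>carrier = path_class X ` loops_at X x,
      mult = (\<lambda>A B. \<Union>p\<in>A. \<Union>q\<in>B. path_class X (p +++ q)),
      one = path_class X (\<lambda>_. x)\<rparr>"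

lemma mem_path_class [simp]: "q \<in> path_class X p \<longleftrightarrow> homotopic_paths X p q"
  by (simp add: path_class_def)

lemma path_class_eq:
  assumes "homotopic_paths X p q"
  shows "path_class X p = path_class X q"
  using assms by (auto simp: path_class_def intro: homotopic_paths_trans homotopic_paths_sym)

lemma path_class_eq_iff:
  assumes "p \<in> loops_at X x"
  shows "path_class X p = path_class X q \<longleftrightarrow> homotopic_paths X p q"
proof
  assume "path_class X p = path_class X q"
  moreover have "p \<in> path_class X p"
    using assms by (simp add: loops_at_def)
  ultimately show "homotopic_paths X p q"
    by (simp add: homotopic_paths_sym)
qed (rule path_class_eq)

lemma loops_at_join:
  "p \<in> loops_at X x \<Longrightarrow> q \<in> loops_at X x \<Longrightarrow> p +++ q \<in> loops_at X x"
  by (auto simp: loops_at_def path_image_join)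

lemma loops_at_reversepath:
  "p \<in> loops_at X x \<Longrightarrow> reversepath p \<in> loops_at X x"
  by (auto simp: loops_at_def)

lemma loops_at_const: "x \<in> X \<Longrightarrow> (\<lambda>_. x) \<in> loops_at X x"
  by (auto simp: loops_at_def path_def path_image_def pathstart_def pathfinish_def)

lemma mult_fundamental_group:
  assumes "p \<in> loops_at X x" "q \<in> loops_at X x"
  shows "path_class X p \<otimes>\<^bsub>fundamental_group X x\<^esub> path_class X q = path_class X (p +++ q)"
proof -
  have "path_class X (p' +++ q') = path_class X (p +++ q)"
    if "homotopic_paths X p p'" "homotopic_paths X q q'" for p' q'
  proof -
    have "homotopic_paths X (p +++ q) (p' +++ q')"
      using that assms by (intro homotopic_paths_join) (simp_all add: loops_at_def)
    then show ?thesis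
      by (rule path_class_eq[symmetric])
  qed
  moreover have "p \<in> path_class X p" "q \<in> path_class X q"
    using assms by (simp_all add: loops_at_def)
  ultimately have "(\<Union>p'\<in>path_class X p. \<Union>q'\<in>path_class X q. path_class X (p' +++ q')) =
      path_class X (p +++ q)"
    unfolding mem_path_class[symmetric] by blast
  then show ?thesis
    by (simp add: fundamental_group_def)
qed

text \<open>
  The corresponding library facts \<open>homotopic_paths_lid\<close> and
  \<open>homotopic_paths_linv\<close> are restricted to normed vector spaces, since they express the
  constant path by \<open>linepath\<close>.
\<close>

lemma homotopic_paths_const_left:
  assumes "p \<in> loops_at X x"
  shows "homotopic_paths X ((\<lambda>_. x) +++ p) p"
proof -
  have cont: "continuous_on {0..1} (\<lambda>t::real. max 0 (2 * t - 1))"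
    by (intro continuous_intros)
  have "homotopic_paths X p ((\<lambda>_. x) +++ p)"
  proof (rule homotopic_paths_reparametrize[OF _ _ cont])
    fix t :: real
    have "p 0 = x"
      using assms by (simp add: loops_at_def pathstart_def)
    then show "((\<lambda>_. x) +++ p) t = p (max 0 (2 * t - 1))"
      by (cases "t \<le> 1/2") (simp_all add: joinpaths_def max_absorb1 max_absorb2)
  qed (use assms in \<open>auto simp: loops_at_def\<close>)
  then show ?thesis
    by (rule homotopic_paths_sym)
qed

lemma homotopic_paths_join_reversepath:
  assumes "p \<in> loops_at X x"
  shows "homotopic_paths X (p +++ reversepath p) (\<lambda>_. x)"
proof -
  let ?f = "\<lambda>y::real \<times> real. (1 - fst y) * min (2 * snd y) (2 - 2 * snd y)"
  have f01: "?f y \<in> {0..1}" if "y \<in> {0..1} \<times> {0..1}" for y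
  proof -
    have "0 \<le> min (2 * snd y) (2 - 2 * snd y)" "min (2 * snd y) (2 - 2 * snd y) \<le> 1"
      using that by (auto simp: min_def)
    then show ?thesis
      using that by (auto intro: mult_le_one mult_nonneg_nonneg simp del: min.bounded_iff)
  qed
  have p: "continuous_on {0..1} p" "p ` {0..1} \<subseteq> X" "p 0 = x" "p 1 = x"
    using assms by (auto simp: loops_at_def path_def path_image_def pathstart_def pathfinish_def)
  have "continuous_on ({0..1} \<times> {0..1}) (\<lambda>y. p (?f y))"
    by (rule continuous_on_compose2[OF p(1)]) (use f01 in \<open>auto intro!: continuous_intros\<close>)
  moreover have "(\<lambda>y. p (?f y)) \<in> {0..1} \<times> {0..1} \<rightarrow> X"
    using f01 p(2) by blast
  moreover have "p (?f (0, t)) = (p +++ reversepath p) t" for t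
    by (auto simp: joinpaths_def reversepath_def min_def algebra_simps)
  ultimately show ?thesis
    unfolding homotopic_paths
    by (intro exI[of _ "\<lambda>y. p (?f y)"])
      (auto simp: p pathstart_def pathfinish_def joinpaths_def reversepath_def)
qed

lemma group_fundamental_group:
  assumes "x \<in> X"
  shows "group (fundamental_group X x)"
proof (rule groupI)
  let ?G = "fundamental_group X x"
  have car: "carrier ?G = path_class X ` loops_at X x"
    and one: "\<one>\<^bsub>?G\<^esub> = path_class X (\<lambda>_. x)"
    by (simp_all add: fundamental_group_def)
  show "\<one>\<^bsub>?G\<^esub> \<in> carrier ?G"
    using assms loops_at_const by (auto simp: car one)
  fix a
  assume "a \<in> carrier ?G"
  then obtain p where p: "p \<in> loops_at X x" "a = path_class X p"
    by (auto simp: car)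
  show "\<one>\<^bsub>?G\<^esub> \<otimes>\<^bsub>?G\<^esub> a = a"
    using p assms
    by (simp add: one mult_fundamental_group loops_at_const path_class_eq homotopic_paths_const_left)
  have "homotopic_paths X (reversepath p +++ p) (\<lambda>_. x)"
    using homotopic_paths_join_reversepath[OF loops_at_reversepath[OF p(1)]] by simp
  then show "\<exists>b\<in>carrier ?G. b \<otimes>\<^bsub>?G\<^esub> a = \<one>\<^bsub>?G\<^esub>"
    using p loops_at_reversepath[OF p(1)]
    by (intro bexI[of _ "path_class X (reversepath p)"])
      (auto simp: car one mult_fundamental_group path_class_eq)
  fix b
  assume "b \<in> carrier ?G"
  then obtain q where q: "q \<in> loops_at X x" "b = path_class X q"
    by (auto simp: car)
  show "a \<otimes>\<^bsub>?G\<^esub> b \<in> carrier ?G"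
    using p q by (auto simp: car mult_fundamental_group loops_at_join)
  fix c
  assume "c \<in> carrier ?G"
  then obtain r where r: "r \<in> loops_at X x" "c = path_class X r"
    by (auto simp: car)
  have "homotopic_paths X (p +++ (q +++ r)) ((p +++ q) +++ r)"
    using p q r by (intro homotopic_paths_assoc) (auto simp: loops_at_def)
  then show "a \<otimes>\<^bsub>?G\<^esub> b \<otimes>\<^bsub>?G\<^esub> c = a \<otimes>\<^bsub>?G\<^esub> (b \<otimes>\<^bsub>?G\<^esub> c)"
    using p q r by (simp add: mult_fundamental_group loops_at_join path_class_eq)
qed


section \<open>Free groups\<close>

text \<open>
  The letter \<open>(a, True)\<close> stands for the generator \<open>a\<close>, and \<open>(a, False)\<close> for its inverse.
  The elements of the free group are the reduced words, and the product is concatenation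
  followed by free reduction.
\<close>

type_synonym 'a letter = "'a \<times> bool"

definition inv_letter :: "'a letter \<Rightarrow> 'a letter" where
  "inv_letter l = (fst l, \<not> snd l)"

fun reduced_word :: "'a letter list \<Rightarrow> bool" where
  "reduced_word (k # l # w) \<longleftrightarrow> l \<noteq> inv_letter k \<and> reduced_word (l # w)"
| "reduced_word _ \<longleftrightarrow> True"

fun push_letter :: "'a letter \<Rightarrow> 'a letter list \<Rightarrow> 'a letter list" where
  "push_letter k (l # w) = (if l = inv_letter k then w else k # l # w)"
| "push_letter k [] = [k]"

definition free_group :: "'a set \<Rightarrow> 'a letter list monoid" where
  "free_group A =
     \<lparr>carrier = {w. reduced_word w \<and> fst ` set w \<subseteq> A},
      mult = (\<lambda>u v. foldr push_letter u v),
      one = []\<rparr>"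

lemma inv_letter_inv_letter [simp]: "inv_letter (inv_letter l) = l"
  by (simp add: inv_letter_def)

lemma fst_inv_letter [simp]: "fst (inv_letter l) = fst l"
  by (simp add: inv_letter_def)

lemma inv_letter_neq [simp]: "inv_letter l \<noteq> l" "l \<noteq> inv_letter l"
  by (simp_all add: inv_letter_def prod_eq_iff)

lemma reduced_tl: "reduced_word (l # w) \<Longrightarrow> reduced_word w"
  by (cases w) auto

lemma reduced_push_letter: "reduced_word w \<Longrightarrow> reduced_word (push_letter k w)"
  by (cases w) (auto dest: reduced_tl)

lemma push_letter_reduced: "reduced_word (k # w) \<Longrightarrow> push_letter k w = k # w"
  by (cases w) auto

lemma set_push_letter: "set (push_letter k w) \<subseteq> insert k (set w)"
  by (cases w) auto

lemma push_letter_inv_letter: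
  assumes "reduced_word w"
  shows "push_letter k (push_letter (inv_letter k) w) = w"
  using assms by (cases w) (auto simp: push_letter_reduced)

lemma reduced_foldr_push: "reduced_word v \<Longrightarrow> reduced_word (foldr push_letter u v)"
  by (induction u) (auto simp: reduced_push_letter)

lemma foldr_push_Nil: "reduced_word w \<Longrightarrow> foldr push_letter w [] = w"
proof (induction w)
  case (Cons l w)
  then show ?case
    using push_letter_reduced[of l w] reduced_tl[of l w] by simp
qed simp

lemma set_foldr_push: "set (foldr push_letter u v) \<subseteq> set u \<union> set v"
proof (induction u)
  case (Cons l u)
  then show ?case
    using set_push_letter[of l "foldr push_letter u v"] by auto
qed simp

lemma foldr_push_push:
  assumes "reduced_word w"
  shows "foldr push_letter (push_letter k v) w = push_letter k (foldr push_letter v w)"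
proof (cases v)
  case (Cons l v')
  show ?thesis
  proof (cases "l = inv_letter k")
    case True
    then show ?thesis
      using Cons assms by (simp add: push_letter_inv_letter reduced_foldr_push)
  qed (use Cons in simp)
qed simp

lemma foldr_push_assoc:
  assumes "reduced_word w"
  shows "foldr push_letter (foldr push_letter u v) w = foldr push_letter u (foldr push_letter v w)"
  by (induction u) (simp_all add: foldr_push_push[OF assms])

lemma foldr_push_inverse:
  assumes "reduced_word v"
  shows "foldr push_letter (rev (map inv_letter w)) (foldr push_letter w v) = v"
  using assms
proof (induction w)
  case (Cons l w)
  then show ?case
    using push_letter_inv_letter[of "foldr push_letter w v" "inv_letter l"]
    by (simp add: reduced_foldr_push)
qed simp

lemma group_free_group: "group (free_group A)"
proof (rule groupI)
  fix u v w
  assume u: "u \<in> carrier (free_group A)"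
  let ?u = "foldr push_letter (rev (map inv_letter u)) []"
  show "\<exists>v\<in>carrier (free_group A). v \<otimes>\<^bsub>free_group A\<^esub> u = \<one>\<^bsub>free_group A\<^esub>"
  proof (intro bexI[of _ ?u])
    have "foldr push_letter ?u u = foldr push_letter (rev (map inv_letter u)) u"
      using u by (simp add: free_group_def foldr_push_assoc)
    also have "\<dots> = []"
      using foldr_push_inverse[of "[]" u] u by (simp add: free_group_def foldr_push_Nil)
    finally show "?u \<otimes>\<^bsub>free_group A\<^esub> u = \<one>\<^bsub>free_group A\<^esub>"
      by (simp add: free_group_def)
    show "?u \<in> carrier (free_group A)"
      using u set_foldr_push[of "rev (map inv_letter u)" "[]"]
      by (fastforce simp: free_group_def reduced_foldr_push)
  qed
  assume v: "v \<in> carrier (free_group A)"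
  show "u \<otimes>\<^bsub>free_group A\<^esub> v \<in> carrier (free_group A)"
    using u v set_foldr_push[of u v] by (fastforce simp: free_group_def reduced_foldr_push)
qed (simp_all add: free_group_def foldr_push_assoc)


section \<open>Finitely presented groups\<close>

definition normal_closure :: "('a, 'b) monoid_scheme \<Rightarrow> 'a set \<Rightarrow> 'a set" where
  "normal_closure G R = \<Inter>{N. N \<lhd> G \<and> R \<subseteq> N}"

definition presented_group :: "'a set \<Rightarrow> 'a letter list set \<Rightarrow> 'a letter list set monoid" where
  "presented_group A R = free_group A Mod normal_closure (free_group A) R"

text \<open>Generators are taken among the natural numbers, into which every finite set embeds.\<close>

definition finitely_presented :: "('a, 'b) monoid_scheme \<Rightarrow> bool" where
  "finitely_presented G \<longleftrightarrow>
     (\<exists>(A :: nat set) R. finite A \<and> finite R \<and> R \<subseteq> carrier (free_group A) \<and>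
        G \<cong> presented_group A R)"

lemma normal_normal_closure:
  assumes "group G" "R \<subseteq> carrier G"
  shows "normal_closure G R \<lhd> G"
proof -
  interpret group G by fact
  let ?\<N> = "{N. N \<lhd> G \<and> R \<subseteq> N}"
  have "carrier G \<lhd> G"
    by (simp add: normal_inv_iff subgroup_self)
  then have ne: "?\<N> \<noteq> {}"
    using assms(2) by blast
  have "subgroup (\<Inter>?\<N>) G"
    by (rule subgroups_Inter[OF _ ne]) (auto simp: normal_imp_subgroup)
  then show ?thesis
    unfolding normal_closure_def by (auto simp: normal_inv_iff)
qed

lemma group_presented_group:
  assumes "R \<subseteq> carrier (free_group A)"
  shows "group (presented_group A R)"
  unfolding presented_group_def
  using assms group_free_group normal.factorgroup_is_group normal_normal_closure by blast

end

theory Submission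
  imports Defs
begin

text \<open>
  If small essential loops \<open>f\<^sub>0, f\<^sub>1, \<dots>\<close> accumulated at a point, then every \<open>\<epsilon> \<in> {0,1}\<^sup>\<nat>\<close> would give a loop
  by concatenating those \<open>f\<^sub>n\<close> with \<open>\<epsilon> n = 1\<close>. Changing one coordinate of \<open>\<epsilon>\<close> changes the homotopy class, so
  no class contains both \<open>\<epsilon>\<close> and a one-coordinate modification of it. But every class is analytic, hence has
  the Baire property, and if there are only countably many classes then one of them is comeager in some
  cylinder, a contradiction. So a countable fundamental group forces all sufficiently small loops to be null
  homotopic.

  A compact, locally path connected space then has a finite cover by path connected open sets whose stars
  contain only null homotopic loops. The pairs of intersecting members generate the fundamental group, subject
  to the relations \<open>(i,j)(j,k) = (i,k)\<close> for triples with a common point, together with one relator for each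
  chosen path from the base point into a member. No further relations are needed: reading off the members met
  by a loop defines a homotopy invariant with values in the presented group.
\<close>

section \<open>Paths in arbitrary spaces\<close>

text \<open>An infinite concatenation converges only if its loops share a base point, so the
  category argument treats one point at a time: the fundamental group is moved to every point of
  \<open>X\<close>, and a Lebesgue number makes the resulting radii uniform. Changing one coordinate
  changes the class because the factors before it can be split off and cancelled on the left, and
  the infinite tail after it cancelled on the right. Van Kampen's theorem is bypassed. Group
  elements attached to pairs of members of the cover, multiplicative whenever three members share a
  point, give every path with labelled ends a value that depends only on its homotopy class, by
  subdivision of a square. The same bookkeeping is run with two targets. In the fundamental group
  the value of a path recovers its class, hence the edges generate. In the presented group the
  values define a homomorphism in the opposite direction, which need only be compared with the
  quotient map on generators; no word problem is analysed.\<close>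

lemma homotopic_paths_compose_path:
  fixes p :: "real \<Rightarrow> 'a::topological_space"
  assumes p: "path p" "path_image p \<subseteq> X"
    and f: "path f" "path_image f \<subseteq> {0..1}" and g: "path g" "path_image g \<subseteq> {0..1}"
    and "pathstart f = pathstart g" "pathfinish f = pathfinish g"
  shows "homotopic_paths X (p \<circ> f) (p \<circ> g)"
proof (rule homotopic_paths_continuous_image)
  show "homotopic_paths {0..1} f g"
  proof (rule homotopic_paths_linear)
    fix t :: real
    assume "t \<in> {0..1}"
    then have "f t \<in> {0..1}" "g t \<in> {0..1}"
      using f g unfolding path_image_def by blast+
    then show "closed_segment (f t) (g t) \<subseteq> {0..1}"
      by (intro closed_segment_subset) auto
  qed (use assms in auto)
  show "continuous_on {0..1} p"
    using p by (simp add: path_def)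
  show "p \<in> {0..1} \<rightarrow> X"
    using p unfolding path_image_def by blast
qed

abbreviation path_from_to :: "'a::topological_space set \<Rightarrow> 'a \<Rightarrow> 'a \<Rightarrow> (real \<Rightarrow> 'a) \<Rightarrow> bool" where
  "path_from_to X x y p \<equiv> path p \<and> path_image p \<subseteq> X \<and> pathstart p = x \<and> pathfinish p = y"

lemma path_const: "path (\<lambda>_. x)" "pathstart (\<lambda>_. x) = x" "pathfinish (\<lambda>_. x) = x"
  "path_image (\<lambda>_. x) = {x}"
  by (auto simp: path_def pathstart_def pathfinish_def path_image_def)

lemma path_from_to_join:
  "path_from_to X x y p \<Longrightarrow> path_from_to X y z q \<Longrightarrow> path_from_to X x z (p +++ q)"
  by (simp add: subset_path_image_join)

lemma path_from_to_reverse: "path_from_to X x y p \<Longrightarrow> path_from_to X y x (reversepath p)"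
  by simp

text \<open>Units, inverses and subdivision all come from the convexity of the parameter interval:
  both sides are \<open>p\<close> composed with piecewise linear maps that have the same ends. Line
  segments are thus formed only among parameters, never in \<open>X\<close>.\<close>

lemma homotopic_paths_join_const:
  assumes "path p" "path_image p \<subseteq> X" "pathfinish p = y"
  shows "homotopic_paths X (p +++ (\<lambda>_. y)) p"
proof -
  have "homotopic_paths X (p \<circ> (linepath 0 1 +++ linepath 1 1)) (p \<circ> linepath 0 1)"
    by (intro homotopic_paths_compose_path assms) (simp_all add: subset_path_image_join closed_segment_eq_real_ivl)
  moreover have "p \<circ> (linepath 0 1 +++ linepath 1 1) = p +++ (\<lambda>_. y)" "p \<circ> linepath 0 1 = p"
    using assms by (auto simp: fun_eq_iff joinpaths_def linepath_def pathfinish_def)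
  ultimately show ?thesis by simp
qed

lemma homotopic_paths_const_join:
  assumes "path p" "path_image p \<subseteq> X" "pathstart p = x"
  shows "homotopic_paths X ((\<lambda>_. x) +++ p) p"
proof -
  have "homotopic_paths X (p \<circ> (linepath 0 0 +++ linepath 0 1)) (p \<circ> linepath 0 1)"
    by (intro homotopic_paths_compose_path assms) (simp_all add: subset_path_image_join closed_segment_eq_real_ivl)
  moreover have "p \<circ> (linepath 0 0 +++ linepath 0 1) = (\<lambda>_. x) +++ p" "p \<circ> linepath 0 1 = p"
    using assms by (auto simp: fun_eq_iff joinpaths_def linepath_def pathstart_def)
  ultimately show ?thesis by simp
qed

lemma homotopic_paths_right_inverse:
  assumes "path p" "path_image p \<subseteq> X" "pathstart p = x"
  shows "homotopic_paths X (p +++ reversepath p) (\<lambda>_. x)"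
proof -
  have "homotopic_paths X (p \<circ> (linepath 0 1 +++ linepath 1 0)) (p \<circ> linepath 0 0)"
    by (intro homotopic_paths_compose_path assms) (simp_all add: subset_path_image_join closed_segment_eq_real_ivl)
  moreover have "p \<circ> (linepath 0 1 +++ linepath 1 0) = p +++ reversepath p" "p \<circ> linepath 0 0 = (\<lambda>_. x)"
    using assms by (auto simp: fun_eq_iff joinpaths_def linepath_def pathstart_def reversepath_def)
  ultimately show ?thesis by simp
qed

lemma homotopic_paths_left_inverse:
  assumes "path p" "path_image p \<subseteq> X" "pathfinish p = x"
  shows "homotopic_paths X (reversepath p +++ p) (\<lambda>_. x)"
  using homotopic_paths_right_inverse[of "reversepath p" X x] assms by simp

text \<open>This turns null homotopy of small loops into uniqueness of small paths between given
  ends, the form in which the cover uses it.\<close>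

lemma homotopic_paths_if_loop_null:
  assumes p: "path_from_to X x y p" and q: "path_from_to X x y q"
    and null: "homotopic_paths X (p +++ reversepath q) (\<lambda>_. x)"
  shows "homotopic_paths X p q"
proof -
  have "homotopic_paths X p (p +++ (\<lambda>_. y))"
    using homotopic_paths_join_const p homotopic_paths_sym by blast
  also have "homotopic_paths X \<dots> (p +++ (reversepath q +++ q))"
    using p q by (intro homotopic_paths_join homotopic_paths_sym[OF homotopic_paths_left_inverse])
      (auto simp: path_const)
  also have "homotopic_paths X \<dots> ((p +++ reversepath q) +++ q)"
    using p q by (intro homotopic_paths_assoc) auto
  also have "homotopic_paths X \<dots> ((\<lambda>_. x) +++ q)"
    using p q null by (intro homotopic_paths_join) auto
  also have "homotopic_paths X \<dots> q"
    using homotopic_paths_const_join q by blast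
  finally show ?thesis .
qed

text \<open>The restriction of \<open>p\<close> to \<open>[a, b]\<close>; the library's \<open>subpath\<close> is restricted to normed
  vector spaces.\<close>

definition path_segment :: "(real \<Rightarrow> 'a::topological_space) \<Rightarrow> real \<Rightarrow> real \<Rightarrow> real \<Rightarrow> 'a" where
  "path_segment p a b = p \<circ> linepath a b"

lemma path_segment_0_1 [simp]: "path_segment p 0 1 = p"
  by (simp add: path_segment_def fun_eq_iff linepath_def)

lemma path_segment_refl: "path_segment p a a = (\<lambda>_. p a)"
  by (simp add: path_segment_def fun_eq_iff linepath_def algebra_simps)

lemma path_image_path_segment: "a \<le> b \<Longrightarrow> path_image (path_segment p a b) = p ` {a..b}"
  by (simp add: path_segment_def path_image_compose closed_segment_eq_real_ivl)

lemma path_path_segment: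
  assumes "path p" "0 \<le> a" "a \<le> b" "b \<le> 1"
  shows "path (path_segment p a b)"
  unfolding path_segment_def
proof (rule path_continuous_image)
  show "continuous_on (path_image (linepath a b)) p"
    using assms unfolding path_def by (auto intro: continuous_on_subset simp: closed_segment_eq_real_ivl)
qed simp

lemma path_segment_ends [simp]:
  "pathstart (path_segment p a b) = p a" "pathfinish (path_segment p a b) = p b"
  by (simp_all add: path_segment_def pathstart_compose pathfinish_compose)

lemma path_from_to_path_segment:
  assumes "path p" "path_image p \<subseteq> X" "0 \<le> a" "a \<le> b" "b \<le> 1"
  shows "path_from_to X (p a) (p b) (path_segment p a b)"
  using assms path_image_path_segment[of a b p] path_path_segment[of p a b]
  by (auto simp: path_image_def)

lemma homotopic_paths_path_segments:
  assumes p: "path p" "path_image p \<subseteq> X" and "0 \<le> a" "a \<le> b" "b \<le> c" "c \<le> 1"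
  shows "homotopic_paths X (path_segment p a b +++ path_segment p b c) (path_segment p a c)"
proof -
  have "homotopic_paths X (p \<circ> (linepath a b +++ linepath b c)) (p \<circ> linepath a c)"
    using assms
    by (intro homotopic_paths_compose_path p) (auto simp: subset_path_image_join closed_segment_eq_real_ivl)
  then show ?thesis
    by (simp add: path_segment_def path_compose_join)
qed

section \<open>Local path connectedness of Peano continua\<close>

text \<open>\<open>r k\<close> bounds the whole tail after index \<open>k\<close>, so it is a Cauchy
  modulus and, in the limit, a rate of convergence. No continuity is assumed: the lemma serves step
  functions, finite concatenations and homotopies alike.\<close>

lemma uniformly_convergent_in_compact:
  fixes p :: "nat \<Rightarrow> 'b \<Rightarrow> 'a::metric_space"
  assumes X: "compact X" and pX: "\<And>k t. t \<in> S \<Longrightarrow> p k t \<in> X"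
    and r: "\<And>k j t. t \<in> S \<Longrightarrow> dist (p k t) (p (k + j) t) \<le> r k" "r \<longlonglongrightarrow> 0"
  shows "\<exists>f. \<forall>t\<in>S. f t \<in> X \<and> (\<lambda>k. p k t) \<longlonglongrightarrow> f t \<and> (\<forall>k. dist (p k t) (f t) \<le> r k)"
proof -
  have "\<exists>l. l \<in> X \<and> (\<lambda>k. p k t) \<longlonglongrightarrow> l \<and> (\<forall>k. dist (p k t) l \<le> r k)" if t: "t \<in> S" for t
  proof -
    have "Cauchy (\<lambda>k. p k t)"
    proof (rule metric_CauchyI)
      fix e :: real
      assume "e > 0"
      then have "\<forall>\<^sub>F k in sequentially. r k < e / 2"
        using r(2) by (intro order_tendstoD) auto
      then obtain K where K: "r K < e / 2"
        by (auto simp: eventually_sequentially)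
      have "dist (p m t) (p n t) < e" if "m \<ge> K" "n \<ge> K" for m n
      proof -
        have "dist (p K t) (p m t) \<le> r K" "dist (p K t) (p n t) \<le> r K"
          using r(1)[OF t, of K "m - K"] r(1)[OF t, of K "n - K"] that by auto
        then show ?thesis
          using K dist_triangle2[of "p m t" "p n t" "p K t"] by (simp add: dist_commute)
      qed
      then show "\<exists>M. \<forall>m\<ge>M. \<forall>n\<ge>M. dist (p m t) (p n t) < e"
        by blast
    qed
    then obtain l where l: "l \<in> X" "(\<lambda>k. p k t) \<longlonglongrightarrow> l"
      using completeE[OF compact_imp_complete[OF X], of "\<lambda>k. p k t"] pX[OF t] by blast
    have "dist (p k t) l \<le> r k" for k
    proof (rule tendsto_upperbound)
      show "(\<lambda>j. dist (p k t) (p (j + k) t)) \<longlonglongrightarrow> dist (p k t) l"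
        using l(2) by (intro tendsto_intros LIMSEQ_ignore_initial_segment)
      show "\<forall>\<^sub>F j in sequentially. dist (p k t) (p (j + k) t) \<le> r k"
        using r(1)[OF t, of k] by (simp add: add.commute[of _ k])
    qed simp
    with l show ?thesis
      by blast
  qed
  then show ?thesis
    by metis
qed

text \<open>Being joined by a chain of short steps is an equivalence relation with open classes. The
  chain is continued constantly after its end so that chains of different lengths can be run in
  parallel.\<close>

lemma connected_imp_chain:
  fixes C :: "'a::metric_space set"
  assumes "connected C" "x \<in> C" "y \<in> C" "\<delta> > 0"
  shows "\<exists>n c. c 0 = x \<and> (\<forall>i\<ge>n. c i = y) \<and> (\<forall>i. c i \<in> C \<and> dist (c i) (c (Suc i)) < \<delta>)"
proof -
  let ?R = "\<lambda>u v. u \<in> C \<and> v \<in> C \<and> dist u v < \<delta>"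
  have "?R\<^sup>*\<^sup>* x y"
  proof (rule connected_equivalence_relation[OF assms(1-3)])
    show "?R\<^sup>*\<^sup>* v u" if "?R\<^sup>*\<^sup>* u v" for u v
      using that by (rule sympD[OF symp_rtranclp, rotated]) (auto intro!: sympI simp: dist_commute)
    fix a
    assume "a \<in> C"
    then show "\<exists>T. openin (top_of_set C) T \<and> a \<in> T \<and> (\<forall>v\<in>T. ?R\<^sup>*\<^sup>* a v)"
      using assms(4) by (intro exI[of _ "C \<inter> ball a \<delta>"]) auto
  qed auto
  then obtain n f where f: "f 0 = x" "f n = y" "\<And>i. i < n \<Longrightarrow> ?R (f i) (f (Suc i))"
    unfolding rtranclp_power relpowp_fun_conv by blast
  define c where "c = (\<lambda>i. if i < n then f i else y)"
  have "c i \<in> C" for i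
    using f(3)[of i] assms(3) by (auto simp: c_def)
  moreover have "dist (c i) (c (Suc i)) < \<delta>" for i
  proof (cases "i < n")
    case True
    then have "c (Suc i) = f (Suc i)"
      using f(2) by (cases "Suc i = n") (auto simp: c_def)
    then show ?thesis
      using True f(3)[of i] by (simp add: c_def)
  qed (use assms(4) in \<open>auto simp: c_def\<close>)
  ultimately show ?thesis
    using f(1,2) by (intro exI[of _ n] exI[of _ c]) (auto simp: c_def)
qed

text \<open>\<delta> is a Lebesgue number of a cover whose members have connected traces on
  \<open>X\<close> inside balls of radius \<open>e / 2\<close>.\<close>

lemma uniformly_locally_connected:
  fixes X :: "'a::metric_space set"
  assumes "compact X" "locally connected X" "e > 0"
  shows "\<exists>\<delta>>0. \<forall>x\<in>X. \<forall>y\<in>X. dist x y < \<delta> \<longrightarrow>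
    (\<exists>C. connected C \<and> C \<subseteq> X \<and> x \<in> C \<and> y \<in> C \<and> (\<forall>u\<in>C. \<forall>v\<in>C. dist u v < e))"
proof -
  have "\<exists>O'. open O' \<and> z \<in> O' \<and> connected (X \<inter> O') \<and> X \<inter> O' \<subseteq> ball z (e / 2)" if "z \<in> X" for z
  proof -
    have "openin (top_of_set X) (X \<inter> ball z (e / 2))" "z \<in> X \<inter> ball z (e / 2)"
      using that assms(3) by auto
    then obtain U where U: "openin (top_of_set X) U" "connected U" "z \<in> U" "U \<subseteq> X \<inter> ball z (e / 2)"
      using assms(2) unfolding locally_connected by blast
    then obtain O' where "open O'" "U = X \<inter> O'"
      by (auto simp: openin_open)
    with U show ?thesis
      by auto
  qed
  then obtain O' where O': "\<And>z. z \<in> X \<Longrightarrow> open (O' z) \<and> z \<in> O' z \<and> connected (X \<inter> O' z)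
      \<and> X \<inter> O' z \<subseteq> ball z (e / 2)"
    by metis
  obtain \<delta> where \<delta>: "\<delta> > 0" "\<And>x. x \<in> X \<Longrightarrow> \<exists>G\<in>O' ` X. ball x \<delta> \<subseteq> G"
  proof (rule Heine_Borel_lemma[OF assms(1), of "O' ` X"])
    show "X \<subseteq> \<Union> (O' ` X)" "\<And>G. G \<in> O' ` X \<Longrightarrow> open G"
      using O' by blast+
  qed blast
  have "\<exists>C. connected C \<and> C \<subseteq> X \<and> x \<in> C \<and> y \<in> C \<and> (\<forall>u\<in>C. \<forall>v\<in>C. dist u v < e)"
    if xy: "x \<in> X" "y \<in> X" "dist x y < \<delta>" for x y
  proof -
    obtain z where z: "z \<in> X" "ball x \<delta> \<subseteq> O' z"
      using \<delta>(2)[OF xy(1)] by blast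
    have "dist u v < e" if "u \<in> X \<inter> O' z" "v \<in> X \<inter> O' z" for u v
    proof -
      have "dist z u < e / 2" "dist z v < e / 2"
        using that O'[OF z(1)] by auto
      then show ?thesis
        using dist_triangle[of u v z] by (simp add: dist_commute)
    qed
    moreover have "x \<in> ball x \<delta>" "y \<in> ball x \<delta>"
      using xy \<delta>(1) by auto
    ultimately show ?thesis
      using z xy O'[OF z(1)] by (intro exI[of _ "X \<inter> O' z"]) auto
  qed
  with \<delta>(1) show ?thesis
    by blast
qed

text \<open>A discontinuous stand-in for a path, with jumps below \<delta>. The index reaches
  \<open>M\<close> exactly at parameter 1, and constancy from \<open>M\<close> on gives the right
  end there.\<close>

definition step_path :: "'a::metric_space set \<Rightarrow> real \<Rightarrow> 'a \<Rightarrow> 'a \<Rightarrow> (real \<Rightarrow> 'a) \<Rightarrow> bool" where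
  "step_path X \<delta> x y p \<longleftrightarrow> (\<exists>M c. M > 0 \<and> c 0 = x \<and> (\<forall>i\<ge>M. c i = y) \<and>
     (\<forall>i. c i \<in> X \<and> dist (c i) (c (Suc i)) < \<delta>) \<and> (\<forall>t\<in>{0..1}. p t = c (nat \<lfloor>t * real M\<rfloor>)))"

text \<open>Every jump is filled by a finer chain inside a connected set of diameter at most
  \<open>e\<close> containing both its ends, so the new values on that step stay close to the old
  one.\<close>

lemma step_path_refine:
  fixes X :: "'a::metric_space set"
  assumes p: "step_path X \<delta> x y p" and e: "e > 0" "\<delta>' > 0"
    and conn: "\<And>u v. u \<in> X \<Longrightarrow> v \<in> X \<Longrightarrow> dist u v < \<delta> \<Longrightarrow>
      \<exists>C. connected C \<and> C \<subseteq> X \<and> u \<in> C \<and> v \<in> C \<and> (\<forall>u\<in>C. \<forall>v\<in>C. dist u v < e)"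
  shows "\<exists>p'. step_path X \<delta>' x y p' \<and> (\<forall>t\<in>{0..1}. dist (p t) (p' t) < e)"
proof -
  obtain M c where c: "M > 0" "c 0 = x" "\<And>i. i \<ge> M \<Longrightarrow> c i = y"
    "\<And>i. c i \<in> X" "\<And>i. dist (c i) (c (Suc i)) < \<delta>" "\<And>t. t \<in> {0..1} \<Longrightarrow> p t = c (nat \<lfloor>t * real M\<rfloor>)"
    using p unfolding step_path_def by blast
  have "\<forall>i. \<exists>C. connected C \<and> C \<subseteq> X \<and> c i \<in> C \<and> c (Suc i) \<in> C \<and> (\<forall>u\<in>C. \<forall>v\<in>C. dist u v < e)"
    using conn c(4,5) by blast
  from choice[OF this] obtain C where
    C: "\<And>i. connected (C i)" "\<And>i. C i \<subseteq> X" "\<And>i. c i \<in> C i" "\<And>i. c (Suc i) \<in> C i"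
    "\<And>i u v. u \<in> C i \<Longrightarrow> v \<in> C i \<Longrightarrow> dist u v < e"
    by blast
  have "\<forall>i. \<exists>n d. d 0 = c i \<and> (\<forall>k\<ge>n. d k = c (Suc i)) \<and> (\<forall>k. d k \<in> C i \<and> dist (d k) (d (Suc k)) < \<delta>')"
    using connected_imp_chain[OF C(1,3,4) e(2)] by blast
  from choice[OF this] obtain n where
    "\<forall>i. \<exists>d. d 0 = c i \<and> (\<forall>k\<ge>n i. d k = c (Suc i)) \<and> (\<forall>k. d k \<in> C i \<and> dist (d k) (d (Suc k)) < \<delta>')"
    by blast
  from choice[OF this] obtain d where d: "\<And>i. d i 0 = c i" "\<And>i k. k \<ge> n i \<Longrightarrow> d i k = c (Suc i)"
    "\<And>i k. d i k \<in> C i" "\<And>i k. dist (d i k) (d i (Suc k)) < \<delta>'"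
    by blast
  \<comment> \<open>All inserted chains are padded to one length \<open>N\<close>, so that the
    refined step function again has steps of equal width and index \<open>k\<close> splits into
    block \<open>k div N\<close> and position \<open>k mod N\<close>. \<open>Suc\<close> keeps
    \<open>N\<close> positive.\<close>
  define N where "N = Suc (Max (n ` {..M}))"
  have N: "n i \<le> N" if "i < M" for i
  proof -
    have "n i \<le> Max (n ` {..M})"
      using that by (intro Max_ge) auto
    then show ?thesis
      by (simp add: N_def)
  qed
  have "N > 0"
    by (simp add: N_def)
  define c' where "c' k = (if k div N < M then d (k div N) (k mod N) else y)" for k
  have c'_start: "c' (i * N) = c i" for i
    using \<open>N > 0\<close> by (simp add: c'_def d(1) c(3))
  have c'_step: "dist (c' k) (c' (Suc k)) < \<delta>'" for k
  proof (cases "k div N < M")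
    case True
    show ?thesis
    proof (cases "Suc (k mod N) = N")
      case True
      \<comment> \<open>Crossing a block boundary: the entry \<open>N\<close> of a chain is not
        stored, but it coincides with the first entry of the next block.\<close>
      have "Suc k = k div N * N + Suc (k mod N)"
        by (metis add_Suc_right div_mult_mod_eq)
      also have "\<dots> = Suc (k div N) * N"
        using True by simp
      finally have "c' (Suc k) = c (Suc (k div N))"
        using c'_start by metis
      also have "\<dots> = d (k div N) N"
        using d(2)[of "k div N" N] N \<open>k div N < M\<close> by simp
      also have "\<dots> = d (k div N) (Suc (k mod N))"
        using True by simp
      finally show ?thesis
        using d(4) \<open>k div N < M\<close> by (simp add: c'_def)
    next
      case False
      then have "Suc k div N = k div N" "Suc k mod N = Suc (k mod N)"
        by (auto simp: div_Suc mod_Suc)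
      then show ?thesis
        using d(4) True by (simp add: c'_def)
    qed
  next
    case False
    then have "\<not> Suc k div N < M"
      by (metis div_le_mono le_SucI le_refl leD leI le_trans)
    with False e show ?thesis
      by (simp add: c'_def)
  qed
  define p' where "p' t = c' (nat \<lfloor>t * real (M * N)\<rfloor>)" for t
  have "step_path X \<delta>' x y p'"
    unfolding step_path_def
  proof (intro exI[of _ "M * N"] exI[of _ c'] conjI allI impI ballI)
    show "0 < M * N"
      using \<open>N > 0\<close> c(1) by simp
    show "c' 0 = x"
      using c'_start[of 0] c(2) by simp
    show "c' i = y" if "M * N \<le> i" for i
      using that \<open>N > 0\<close> div_le_mono[OF that, of N] by (simp add: c'_def)
    show "c' i \<in> X" for i
      using d(3) C(2) c(3,4)[of M] by (auto simp: c'_def)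
  qed (simp_all add: c'_step p'_def)
  moreover have "dist (p t) (p' t) < e" if t: "t \<in> {0..1}" for t
  proof -
    define q where "q = nat \<lfloor>t * real M\<rfloor>"
    \<comment> \<open>The coarse index is the block number of the fine index, so both functions are
      compared within a single block.\<close>
    have "\<lfloor>t * real M\<rfloor> = \<lfloor>t * real (M * N) / real_of_int (int N)\<rfloor>"
      using \<open>N > 0\<close> by simp
    also have "\<dots> = \<lfloor>t * real (M * N)\<rfloor> div int N"
      by (rule floor_divide_real_eq_div) simp
    finally have q: "nat \<lfloor>t * real (M * N)\<rfloor> div N = q"
      using t unfolding q_def by (simp add: nat_div_distrib)
    have p_t: "p t = c q"
      using c(6)[OF t] by (simp add: q_def)
    show ?thesis
    proof (cases "q < M")
      case True
      then have "p' t \<in> C q"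
        using q d(3) by (simp add: p'_def c'_def)
      then show ?thesis
        using C(3,5) p_t by auto
    next
      case False
      then show ?thesis
        using q p_t c(3) e by (simp add: p'_def c'_def)
    qed
  qed
  ultimately show ?thesis
    by blast
qed

text \<open>A substitute for continuity: parameters closer than one step width lie in the same or in
  adjacent steps. It yields continuity of the limit once the jumps tend to 0.\<close>

lemma step_path_nearby:
  assumes "step_path X \<delta> x y p"
  obtains h where "h > 0"
    "\<And>s t. s \<in> {0..1} \<Longrightarrow> t \<in> {0..1} \<Longrightarrow> \<bar>s - t\<bar> < h \<Longrightarrow> dist (p s) (p t) < \<delta>"
proof -
  obtain M c where c: "M > 0" "\<And>i. dist (c i) (c (Suc i)) < \<delta>"
    "\<And>t. t \<in> {0..1} \<Longrightarrow> p t = c (nat \<lfloor>t * real M\<rfloor>)"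
    using assms unfolding step_path_def by blast
  have "\<delta> > 0"
    using c(2)[of 0] zero_le_dist le_less_trans by blast
  have le: "dist (p s) (p t) < \<delta>" if "s \<in> {0..1}" "t \<in> {0..1}" "s \<le> t" "t - s < 1 / real M" for s t
  proof -
    have "t * real M - s * real M < 1" "s * real M \<le> t * real M"
      using that c(1) by (auto simp: field_simps)
    then have "\<lfloor>t * real M\<rfloor> = \<lfloor>s * real M\<rfloor> \<or> \<lfloor>t * real M\<rfloor> = \<lfloor>s * real M\<rfloor> + 1"
      by linarith
    moreover have "\<lfloor>s * real M\<rfloor> \<ge> 0"
      using that by simp
    ultimately have "nat \<lfloor>t * real M\<rfloor> = nat \<lfloor>s * real M\<rfloor> \<or> nat \<lfloor>t * real M\<rfloor> = Suc (nat \<lfloor>s * real M\<rfloor>)"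
      by linarith
    then show ?thesis
      using c(2,3) that \<open>\<delta> > 0\<close> by auto
  qed
  show ?thesis
  proof (rule that[of "1 / real M"])
    fix s t :: real
    assume "s \<in> {0..1}" "t \<in> {0..1}" "\<bar>s - t\<bar> < 1 / real M"
    then show "dist (p s) (p t) < \<delta>"
      using le[of s t] le[of t s] by (cases "s \<le> t") (auto simp: dist_commute)
  qed (use c(1) in simp)
qed

lemma step_path_ends:
  assumes "step_path X \<delta> x y p"
  shows "p 0 = x" "p 1 = y" "t \<in> {0..1} \<Longrightarrow> p t \<in> X"
  using assms unfolding step_path_def by auto

text \<open>The path is a uniform limit of step functions, refined over and over by inserting chains that lie in
  small connected sets.\<close>

lemma small_path_between_nearby:
  fixes X :: "'a::metric_space set"
  assumes "compact X" "locally connected X" "e > 0"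
  obtains \<delta> where "\<delta> > 0"
    "\<forall>x\<in>X. \<forall>y\<in>X. dist x y < \<delta> \<longrightarrow> (\<exists>p. path_from_to (X \<inter> ball x e) x y p)"
proof -
  \<comment> \<open>The corrections from stage \<open>k\<close> on sum to \<open>2 * r k\<close>.
    With \<open>r 0 = e / 4\<close> the limit moves by at most \<open>e / 2\<close> from the first
    step function, which is itself within \<open>e / 4\<close> of \<open>x\<close>.\<close>
  define r where "r k = e / 4 / 2 ^ k" for k :: nat
  have r_pos: "r k > 0" for k
    using assms(3) by (simp add: r_def)
  have "\<forall>k. \<exists>\<delta>>0. \<forall>x\<in>X. \<forall>y\<in>X. dist x y < \<delta> \<longrightarrow>
    (\<exists>C. connected C \<and> C \<subseteq> X \<and> x \<in> C \<and> y \<in> C \<and> (\<forall>u\<in>C. \<forall>v\<in>C. dist u v < r k))"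
    using uniformly_locally_connected[OF assms(1,2)] r_pos by blast
  then obtain \<delta>\<^sub>0 where \<delta>\<^sub>0: "\<And>k. \<delta>\<^sub>0 k > 0" "\<And>k x y. x \<in> X \<Longrightarrow> y \<in> X \<Longrightarrow> dist x y < \<delta>\<^sub>0 k \<Longrightarrow>
    \<exists>C. connected C \<and> C \<subseteq> X \<and> x \<in> C \<and> y \<in> C \<and> (\<forall>u\<in>C. \<forall>v\<in>C. dist u v < r k)"
    by metis
  define \<delta> where "\<delta> k = min (\<delta>\<^sub>0 k) (r k)" for k
  have \<delta>: "\<delta> k > 0" "\<delta> k \<le> r k" "\<delta> k \<le> \<delta>\<^sub>0 k" for k
    using \<delta>\<^sub>0(1) r_pos by (auto simp: \<delta>_def)
  have "\<exists>p. path_from_to (X \<inter> ball x e) x y p" if xy: "x \<in> X" "y \<in> X" "dist x y < \<delta> 0" for x y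
  proof -
    let ?c = "\<lambda>i::nat. if i = 0 then x else y"
    \<comment> \<open>The premise \<open>0 = 0\<close> is the instance at \<open>k = 0\<close> of a
      condition on the first function only: dependent choice does not fix the initial term, so its
      distance from \<open>x\<close> is carried in the invariant.\<close>
    have "\<exists>p. step_path X (\<delta> 0) x y p \<and> (0 = (0::nat) \<longrightarrow> (\<forall>t\<in>{0..1}. dist x (p t) \<le> \<delta> 0))"
      unfolding step_path_def using xy \<delta>(1)[of 0]
      by (intro exI[of _ "\<lambda>t. ?c (nat \<lfloor>t * real 1\<rfloor>)"] conjI exI[of _ 1] exI[of _ ?c]) auto
    then have "\<exists>p. \<forall>k. (step_path X (\<delta> k) x y (p k) \<and> (k = 0 \<longrightarrow> (\<forall>t\<in>{0..1}. dist x (p k t) \<le> \<delta> 0))) \<and>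
      (\<forall>t\<in>{0..1}. dist (p k t) (p (Suc k) t) < r k)"
    proof (intro dependent_nat_choice)
      fix p k
      assume p: "step_path X (\<delta> k) x y p \<and> (k = 0 \<longrightarrow> (\<forall>t\<in>{0..1}. dist x (p t) \<le> \<delta> 0))"
      have "\<exists>p'. step_path X (\<delta> (Suc k)) x y p' \<and> (\<forall>t\<in>{0..1}. dist (p t) (p' t) < r k)"
      proof (rule step_path_refine[OF conjunct1[OF p] r_pos \<delta>(1)])
        fix u v
        assume "u \<in> X" "v \<in> X" "dist u v < \<delta> k"
        then show "\<exists>C. connected C \<and> C \<subseteq> X \<and> u \<in> C \<and> v \<in> C \<and> (\<forall>u\<in>C. \<forall>v\<in>C. dist u v < r k)"
          using \<delta>\<^sub>0(2) \<delta>(3)[of k] by (meson less_le_trans)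
      qed
      then show "\<exists>p'. (step_path X (\<delta> (Suc k)) x y p' \<and> (Suc k = 0 \<longrightarrow> (\<forall>t\<in>{0..1}. dist x (p' t) \<le> \<delta> 0))) \<and>
          (\<forall>t\<in>{0..1}. dist (p t) (p' t) < r k)"
        by blast
    qed
    then obtain p where p: "\<And>k. step_path X (\<delta> k) x y (p k)"
      "\<And>k t. t \<in> {0..1} \<Longrightarrow> dist (p k t) (p (Suc k) t) < r k" "\<And>t. t \<in> {0..1} \<Longrightarrow> dist x (p 0 t) \<le> \<delta> 0"
      by blast
    have Cauchy: "dist (p k t) (p (k + j) t) \<le> 2 * r k" if t: "t \<in> {0..1}" for k j t
    proof -
      \<comment> \<open>Subtracting the remaining tail of the geometric series makes the induction
        close.\<close>
      have "dist (p k t) (p (k + j) t) \<le> 2 * r k - 2 * r (k + j)"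
      proof (induction j)
        case (Suc j)
        have "r (k + j) = 2 * r (k + Suc j)"
          by (simp add: r_def)
        then show ?case
          using Suc p(2)[OF t, of "k + j"] dist_triangle[of "p k t" "p (k + Suc j) t" "p (k + j) t"] by simp
      qed simp
      then show ?thesis
        using r_pos[of "k + j"] by linarith
    qed
    have lim: "(\<lambda>k. 2 * r k) \<longlonglongrightarrow> 0"
      unfolding r_def by real_asymp
    obtain f where f: "\<And>t. t \<in> {0..1} \<Longrightarrow> f t \<in> X" "\<And>t. t \<in> {0..1} \<Longrightarrow> (\<lambda>k. p k t) \<longlonglongrightarrow> f t"
      "\<And>t k. t \<in> {0..1} \<Longrightarrow> dist (p k t) (f t) \<le> 2 * r k"
      using uniformly_convergent_in_compact[OF assms(1), of "{0..1}" p, OF _ Cauchy lim]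
        step_path_ends(3)[OF p(1)] by blast
    have "continuous_on {0..1} f"
      unfolding continuous_on_iff
    proof (intro ballI allI impI)
      fix s \<eta> :: real
      assume s: "s \<in> {0..1}" and "\<eta> > 0"
      have "\<forall>\<^sub>F k in sequentially. 2 * r k < \<eta> / 3"
        using \<open>\<eta> > 0\<close> by (intro order_tendstoD(2)[OF lim]) auto
      then obtain k where k: "2 * r k < \<eta> / 3"
        by (auto simp: eventually_sequentially)
      obtain h where h: "h > 0" "\<And>s t. s \<in> {0..1} \<Longrightarrow> t \<in> {0..1} \<Longrightarrow> \<bar>s - t\<bar> < h \<Longrightarrow> dist (p k s) (p k t) < \<delta> k"
        using step_path_nearby[OF p(1)] by metis
      have "dist (f t) (f s) < \<eta>" if t: "t \<in> {0..1}" "dist t s < h" for t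
      proof -
        have "dist (p k t) (p k s) < \<delta> k"
          using h(2)[OF t(1) s] t(2) by (simp add: dist_real_def)
        then show ?thesis
          using f(3)[OF t(1), of k] f(3)[OF s, of k] k \<delta>(2)[of k] r_pos[of k]
            dist_triangle[of "f t" "f s" "p k t"] dist_triangle[of "p k t" "f s" "p k s"]
          by (simp add: dist_commute)
      qed
      with h(1) show "\<exists>d>0. \<forall>t\<in>{0..1}. dist t s < d \<longrightarrow> dist (f t) (f s) < \<eta>"
        by blast
    qed
    moreover have "f t \<in> ball x e" if t: "t \<in> {0..1}" for t
    proof -
      have "dist x (p 0 t) \<le> \<delta> 0"
        using p(3)[OF t] .
      then show ?thesis
        using f(3)[OF t, of 0] \<delta>(2)[of 0] dist_triangle[of x "f t" "p 0 t"] assms(3) by (simp add: r_def)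
    qed
    moreover have "f 0 = x" "f 1 = y"
      using f(2)[of 0] f(2)[of 1] step_path_ends(1,2)[OF p(1)] by (auto dest: LIMSEQ_unique[OF tendsto_const])
    ultimately show ?thesis
      using f(1) by (intro exI[of _ f]) (auto simp: path_def path_image_def pathstart_def pathfinish_def)
  qed
  then have "\<forall>x\<in>X. \<forall>y\<in>X. dist x y < \<delta> 0 \<longrightarrow> (\<exists>p. path_from_to (X \<inter> ball x e) x y p)"
    by simp
  with \<delta>(1) show thesis
    by (rule that)
qed

text \<open>The weak local form at every point implies the strong one, so it suffices to join points
  near \<open>x\<close> to \<open>x\<close> inside the given neighbourhood.\<close>

lemma compact_locally_connected_imp_locally_path_connected:
  fixes X :: "'a::metric_space set"
  assumes "compact X" "locally connected X"
  shows "locally path_connected X"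
  unfolding locally_path_connected_im_kleinen
proof (intro allI impI, elim conjE)
  fix V x
  assume V: "openin (top_of_set X) V" "x \<in> V"
  then obtain e where e: "e > 0" "ball x e \<inter> X \<subseteq> V" "x \<in> X"
    unfolding openin_contains_ball by blast
  obtain \<delta> where \<delta>: "\<delta> > 0"
    "\<forall>x\<in>X. \<forall>y\<in>X. dist x y < \<delta> \<longrightarrow> (\<exists>p. path_from_to (X \<inter> ball x e) x y p)"
    by (rule small_path_between_nearby[OF assms e(1)])
  show "\<exists>U. openin (top_of_set X) U \<and> x \<in> U \<and> U \<subseteq> V \<and> (\<forall>y. y \<in> U \<longrightarrow>
      (\<exists>p. path_from_to V x y p))"
  proof (intro exI[of _ "X \<inter> ball x (min \<delta> e)"] conjI allI impI)
    fix y
    assume y: "y \<in> X \<inter> ball x (min \<delta> e)"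
    then have "y \<in> X" "dist x y < \<delta>"
      by auto
    then have "\<exists>p. path_from_to (X \<inter> ball x e) x y p"
      using \<delta>(2) e(3) by simp
    then obtain p where "path_from_to (X \<inter> ball x e) x y p" ..
    then show "\<exists>p. path_from_to V x y p"
      using e(2) by (intro exI[of _ p]) auto
  qed (use e \<delta>(1) in auto)
qed

section \<open>Category in the Cantor space\<close>

definition cylinder :: "bool list \<Rightarrow> (nat \<Rightarrow> bool) set" where
  "cylinder s = {\<epsilon>. \<forall>i<length s. \<epsilon> i = s ! i}"

text \<open>Category is phrased through finite words, which index the basic open sets; shrinking an
  open set means extending its word.\<close>

definition nowhere_dense :: "(nat \<Rightarrow> bool) set \<Rightarrow> bool" where
  "nowhere_dense A \<longleftrightarrow> (\<forall>s. \<exists>t. A \<inter> cylinder (s @ t) = {})"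

definition meager :: "(nat \<Rightarrow> bool) set \<Rightarrow> bool" where
  "meager A \<longleftrightarrow> (\<exists>N :: nat \<Rightarrow> _. (\<forall>k. nowhere_dense (N k)) \<and> A \<subseteq> (\<Union>k. N k))"

lemma cylinder_Nil [simp]: "cylinder [] = UNIV"
  by (simp add: cylinder_def)

lemma cylinder_append_subset: "cylinder (s @ t) \<subseteq> cylinder s"
proof
  fix \<epsilon>
  assume "\<epsilon> \<in> cylinder (s @ t)"
  then have "\<epsilon> i = (s @ t) ! i" if "i < length (s @ t)" for i
    using that by (simp add: cylinder_def)
  then show "\<epsilon> \<in> cylinder s"
    by (simp add: cylinder_def nth_append)
qed

lemma map_upt_in_cylinder: "\<epsilon> \<in> cylinder s \<Longrightarrow> map \<epsilon> [0..<length s] = s"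
  by (auto simp: cylinder_def intro: nth_equalityI)

lemma cylinder_extend:
  assumes "\<epsilon> \<in> cylinder s"
  shows "\<epsilon> \<in> cylinder (s @ map \<epsilon> [length s..<length s + m])"
  using assms by (auto simp: cylinder_def nth_append)

lemma cylinders_comparable:
  assumes "\<epsilon> \<in> cylinder s" "\<epsilon> \<in> cylinder t"
  shows "(\<exists>v. s = t @ v) \<or> (\<exists>v. t = s @ v)"
proof -
  have s: "s = map \<epsilon> [0..<length s]" and t: "t = map \<epsilon> [0..<length t]"
    using assms map_upt_in_cylinder by metis+
  have *: "map \<epsilon> [0..<n] = map \<epsilon> [0..<m] @ map \<epsilon> [m..<n]" if "m \<le> n" for m n
    using that by (metis map_append upt_add_eq_append le_add_diff_inverse zero_le)
  show ?thesis
    using *[of "length s" "length t"] *[of "length t" "length s"] s t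
    by (metis nat_le_linear)
qed

lemma nowhere_dense_empty: "nowhere_dense {}"
  by (simp add: nowhere_dense_def)

lemma meager_subset: "meager B \<Longrightarrow> A \<subseteq> B \<Longrightarrow> meager A"
  unfolding meager_def by (meson subset_trans)

lemma nowhere_dense_imp_meager: "nowhere_dense A \<Longrightarrow> meager A"
  unfolding meager_def by (intro exI[of _ "\<lambda>_. A"]) auto

lemma meager_UN:
  assumes "countable I" "\<And>i. i \<in> I \<Longrightarrow> meager (A i)"
  shows "meager (\<Union>i\<in>I. A i)"
proof (cases "I = {}")
  case True
  then show ?thesis
    by (simp add: nowhere_dense_imp_meager nowhere_dense_empty)
next
  case False
  have "\<forall>i\<in>I. \<exists>N :: nat \<Rightarrow> _. (\<forall>k. nowhere_dense (N k)) \<and> A i \<subseteq> (\<Union>k. N k)"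
    using assms(2) by (simp add: meager_def)
  then obtain N :: "_ \<Rightarrow> nat \<Rightarrow> _" where N: "\<And>i k. i \<in> I \<Longrightarrow> nowhere_dense (N i k)" "\<And>i. i \<in> I \<Longrightarrow> A i \<subseteq> (\<Union>k. N i k)"
    by metis
  show ?thesis
    unfolding meager_def
  proof (intro exI[of _ "\<lambda>j. N (from_nat_into I (fst (prod_decode j))) (snd (prod_decode j))"] conjI allI subsetI)
    fix \<epsilon>
    assume "\<epsilon> \<in> (\<Union>i\<in>I. A i)"
    then obtain i where i: "i \<in> I" "\<epsilon> \<in> A i"
      by blast
    then obtain k where "\<epsilon> \<in> N i k"
      using N(2) by blast
    moreover obtain m where "from_nat_into I m = i"
      using from_nat_into_surj[OF assms(1) i(1)] by blast
    ultimately have "\<epsilon> \<in> N (from_nat_into I (fst (prod_decode (prod_encode (m, k))))) (snd (prod_decode (prod_encode (m, k))))"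
      by simp
    then show "\<epsilon> \<in> (\<Union>j. N (from_nat_into I (fst (prod_decode j))) (snd (prod_decode j)))"
      by blast
  qed (simp add: N(1) from_nat_into[OF False])
qed

lemma meager_Un: "meager A \<Longrightarrow> meager B \<Longrightarrow> meager (A \<union> B)"
  using meager_UN[of "UNIV :: bool set" "\<lambda>b. if b then A else B"] by (simp add: UNIV_bool Un_commute)

text \<open>The Baire category theorem for the Cantor space: nested cylinders avoid the nowhere
  dense sets one after another.\<close>

lemma not_meager_cylinder: "\<not> meager (cylinder s)"
proof
  assume "meager (cylinder s)"
  then obtain N :: "nat \<Rightarrow> _" where N: "\<And>k. nowhere_dense (N k)" "cylinder s \<subseteq> (\<Union>k. N k)"
    unfolding meager_def by blast
  have "\<exists>u. \<forall>k. (length (u k) \<ge> k \<and> (k = 0 \<longrightarrow> u k = s)) \<and> (\<exists>v. u (Suc k) = u k @ v) \<and> N k \<inter> cylinder (u (Suc k)) = {}"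
  proof (rule dependent_nat_choice)
    fix u :: "bool list" and k :: nat
    assume u: "k \<le> length u \<and> (k = 0 \<longrightarrow> u = s)"
    obtain t where "N k \<inter> cylinder (u @ t) = {}"
      using N(1)[of k] unfolding nowhere_dense_def by blast
    \<comment> \<open>The extra letter forces the words to grow, so that they determine a whole
      sequence.\<close>
    then have "N k \<inter> cylinder (u @ t @ [True]) = {}"
      using cylinder_append_subset[of "u @ t" "[True]"] by auto
    with u show "\<exists>u'. (Suc k \<le> length u' \<and> (Suc k = 0 \<longrightarrow> u' = s)) \<and> (\<exists>v. u' = u @ v) \<and> N k \<inter> cylinder u' = {}"
      by (intro exI[of _ "u @ t @ [True]"]) auto
  qed simp
  then obtain u where u: "\<And>k. length (u k) \<ge> k" "u 0 = s" "\<And>k. \<exists>v. u (Suc k) = u k @ v"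
    "\<And>k. N k \<inter> cylinder (u (Suc k)) = {}"
    by blast
  have ext: "\<exists>v. u (k + j) = u k @ v" for k j
  proof (induction j)
    case (Suc j)
    then show ?case
      using u(3)[of "k + j"] by auto
  qed simp
  have nth: "u m ! i = u k ! i" if "i < length (u k)" "i < length (u m)" for i k m
    using ext[of k "m - k"] ext[of m "k - m"] that
    by (cases "k \<le> m") (auto simp: nth_append)
  \<comment> \<open>Position \<open>i\<close> is read from word \<open>i + 1\<close>, the first one
    known to be long enough.\<close>
  define \<epsilon> where "\<epsilon> i = u (Suc i) ! i" for i
  have "i < length (u (Suc i))" for i
    using u(1)[of "Suc i"] by simp
  then have "\<epsilon> \<in> cylinder (u k)" for k
    using nth unfolding cylinder_def \<epsilon>_def by blast
  then show False
    using N(2) u(2,4) by blast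
qed

text \<open>Otherwise every extension of \<open>s\<close> could be extended further to a cylinder in
  which \<open>A\<close> is meager. The union of these cylinders is dense in that of
  \<open>s\<close>, its complement there is nowhere dense, and there are only countably many words,
  so \<open>A\<close> would be meager in the cylinder of \<open>s\<close>.\<close>

lemma not_meager_imp_everywhere_not_meager:
  assumes "\<not> meager (A \<inter> cylinder s)"
  shows "\<exists>t. \<forall>u. \<not> meager (A \<inter> cylinder (s @ t @ u))"
proof (rule ccontr)
  assume "\<not> ?thesis"
  then obtain u where u: "\<And>t. meager (A \<inter> cylinder (s @ t @ u t))"
    by metis
  let ?D = "\<Union>t. cylinder (s @ t @ u t)"
  have "nowhere_dense (cylinder s - ?D)"
    unfolding nowhere_dense_def
  proof
    fix s'
    show "\<exists>t. (cylinder s - ?D) \<inter> cylinder (s' @ t) = {}"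
    proof (cases "cylinder s \<inter> cylinder s' = {}")
      case True
      then show ?thesis
        by (intro exI[of _ "[]"]) auto
    next
      case False
      then consider v where "s = s' @ v" | v where "s' = s @ v"
        using cylinders_comparable by blast
      then show ?thesis
      proof cases
        case 1
        have "cylinder (s @ [] @ u []) \<subseteq> ?D"
          by (rule UN_upper) simp
        with 1 have "cylinder (s' @ v @ u []) \<subseteq> ?D"
          by simp
        then show ?thesis
          by (intro exI[of _ "v @ u []"]) auto
      next
        case 2
        then have "cylinder (s' @ u v) \<subseteq> ?D"
          by auto
        then show ?thesis
          by (intro exI[of _ "u v"]) auto
      qed
    qed
  qed
  then have "meager ((cylinder s - ?D) \<union> (\<Union>t. A \<inter> cylinder (s @ t @ u t)))"
    using u by (intro meager_Un meager_UN) (auto intro: nowhere_dense_imp_meager)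
  then have "meager (A \<inter> cylinder s)"
    by (rule meager_subset) auto
  with assms show False ..
qed

lemma nowhere_dense_flip:
  assumes "nowhere_dense A"
  shows "nowhere_dense {\<epsilon>. \<epsilon>(n := \<not> \<epsilon> n) \<in> A}"
  unfolding nowhere_dense_def
proof
  fix s
  \<comment> \<open>Padding beyond position \<open>n\<close> lets the flip act on the finite word
    itself.\<close>
  define s1 where "s1 = s @ replicate (Suc n) True"
  define s2 where "s2 = s1[n := \<not> s1 ! n]"
  have len: "n < length s1" "length s2 = length s1"
    by (simp_all add: s1_def s2_def)
  obtain t where t: "A \<inter> cylinder (s2 @ t) = {}"
    using assms unfolding nowhere_dense_def by blast
  have "\<epsilon>(n := \<not> \<epsilon> n) \<in> cylinder (s2 @ t)" if "\<epsilon> \<in> cylinder (s1 @ t)" for \<epsilon>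
    using that len by (auto simp: cylinder_def nth_append s2_def nth_list_update)
  with t have "{\<epsilon>. \<epsilon>(n := \<not> \<epsilon> n) \<in> A} \<inter> cylinder (s1 @ t) = {}"
    by blast
  then show "\<exists>t. {\<epsilon>. \<epsilon>(n := \<not> \<epsilon> n) \<in> A} \<inter> cylinder (s @ t) = {}"
    by (intro exI[of _ "replicate (Suc n) True @ t"]) (simp only: s1_def append_assoc)
qed

lemma meager_flip:
  assumes "meager A"
  shows "meager {\<epsilon>. \<epsilon>(n := \<not> \<epsilon> n) \<in> A}"
proof -
  obtain N :: "nat \<Rightarrow> _" where N: "\<And>k. nowhere_dense (N k)" "A \<subseteq> (\<Union>k. N k)"
    using assms unfolding meager_def by blast
  then have "meager (\<Union>k. {\<epsilon>. \<epsilon>(n := \<not> \<epsilon> n) \<in> N k})"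
    by (intro meager_UN nowhere_dense_imp_meager nowhere_dense_flip) auto
  then show ?thesis
    by (rule meager_subset) (use N(2) in blast)
qed

text \<open>The hypotheses say that the sets \<open>A i []\<close> are analytic, being the results of Souslin operations;
  hence each has the Baire property. As countably many of them cover the Cantor space, one is comeager in
  some cylinder, and so is its image under flipping a coordinate beyond that cylinder.\<close>

lemma Souslin_cover_contains_flip:
  fixes A :: "nat \<Rightarrow> nat list \<Rightarrow> (nat \<Rightarrow> bool) set"
  assumes cover: "\<And>\<epsilon>. \<exists>i. \<epsilon> \<in> A i []"
    and refine: "\<And>i d \<epsilon>. \<epsilon> \<in> A i d \<Longrightarrow> \<exists>e. \<epsilon> \<in> A i (d @ [e])"
    and closed: "\<And>i \<delta> \<epsilon>. (\<And>k m. \<exists>\<epsilon>'\<in>A i (map \<delta> [0..<k]). \<forall>j<m. \<epsilon>' j = \<epsilon> j) \<Longrightarrow> \<epsilon> \<in> A i []"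
  shows "\<exists>i n \<epsilon>. \<epsilon> \<in> A i [] \<and> \<epsilon>(n := \<not> \<epsilon> n) \<in> A i []"
proof -
  have "\<not> meager (\<Union>i. A i [])"
  proof -
    have "(\<Union>i. A i []) = cylinder []"
      using cover by auto
    then show ?thesis
      using not_meager_cylinder[of "[]"] by simp
  qed
  then obtain i where i: "\<not> meager (A i [] \<inter> cylinder [])"
    using meager_UN[of UNIV "\<lambda>i. A i []"] by auto
  \<comment> \<open>A heavy pair: the piece of the scheme at node \<open>d\<close> is nonmeager in
    every subcylinder of \<open>s\<close>. This replaces the Baire property of the piece.\<close>
  define heavy where "heavy d s \<longleftrightarrow> (\<forall>u. \<not> meager (A i d \<inter> cylinder (s @ u)))" for d s
  obtain s\<^sub>0 where s\<^sub>0: "heavy [] s\<^sub>0"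
    using not_meager_imp_everywhere_not_meager[OF i] by (auto simp: heavy_def)
  have heavy_step: "\<exists>e t. heavy (d @ [e]) (s @ t)" if "heavy d s" for d s
  proof -
    have "\<not> meager (A i d \<inter> cylinder (s @ []))"
      using that unfolding heavy_def by blast
    moreover have "A i d \<inter> cylinder (s @ []) \<subseteq> (\<Union>e. A i (d @ [e]) \<inter> cylinder s)"
      using refine by auto
    ultimately have "\<not> meager (\<Union>e. A i (d @ [e]) \<inter> cylinder s)"
      using meager_subset by blast
    then obtain e where "\<not> meager (A i (d @ [e]) \<inter> cylinder s)"
      using meager_UN[of UNIV "\<lambda>e. A i (d @ [e]) \<inter> cylinder s"] by auto
    then show ?thesis
      using not_meager_imp_everywhere_not_meager[of "A i (d @ [e])" s] by (auto simp: heavy_def)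
  qed
  \<comment> \<open>The points of \<open>s\<close> at which the branch \<open>d\<close> has no heavy
    continuation. Nodes and words are finite lists over countable alphabets, so the union
    \<open>B\<close> of these nowhere dense sets over all heavy pairs is meager.\<close>
  define stuck where "stuck d s = cylinder s - \<Union>{cylinder (s @ t) |e t. heavy (d @ [e]) (s @ t)}" for d s
  have nowhere_dense_stuck: "nowhere_dense (stuck d s)" if h: "heavy d s" for d s
    unfolding nowhere_dense_def
  proof
    fix s'
    have *: "\<exists>t. stuck d s \<inter> cylinder (s @ v @ t) = {}" for v
    proof -
      have "heavy d (s @ v)"
        using h by (simp add: heavy_def)
      then obtain e t where "heavy (d @ [e]) (s @ (v @ t))"
        using heavy_step by fastforce
      then have "cylinder (s @ v @ t) \<subseteq> \<Union>{cylinder (s @ t) |e t. heavy (d @ [e]) (s @ t)}"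
        by blast
      then show ?thesis
        unfolding stuck_def by blast
    qed
    show "\<exists>t. stuck d s \<inter> cylinder (s' @ t) = {}"
    proof (cases "cylinder s \<inter> cylinder s' = {}")
      case True
      then show ?thesis
        by (intro exI[of _ "[]"]) (auto simp: stuck_def)
    next
      case False
      then consider v where "s = s' @ v" | v where "s' = s @ v"
        using cylinders_comparable by blast
      then show ?thesis
      proof cases
        case 1
        then show ?thesis
          using *[of "[]"] by (metis append_Nil append_assoc)
      next
        case 2
        then show ?thesis
          using *[of v] by simp
      qed
    qed
  qed
  define B where "B = (\<Union>(d, s)\<in>{(d, s). heavy d s}. stuck d s)"
  have "meager B"
    unfolding B_def
    by (intro meager_UN) (auto intro: nowhere_dense_imp_meager nowhere_dense_stuck)
  \<comment> \<open>Off \<open>B\<close> a heavy branch can be continued forever along \<epsilon>.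
    Heaviness places points of each piece on the branch arbitrarily close to \<epsilon>, which is
    the hypothesis of \<open>closed\<close>.\<close>
  have generic: "\<epsilon> \<in> A i []" if \<epsilon>: "\<epsilon> \<in> cylinder s\<^sub>0" "\<epsilon> \<notin> B" for \<epsilon>
  proof -
    have "\<exists>f. \<forall>k. (heavy (fst (f k)) (snd (f k)) \<and> \<epsilon> \<in> cylinder (snd (f k)) \<and> length (fst (f k)) = k) \<and>
      (\<exists>e. fst (f (Suc k)) = fst (f k) @ [e])"
    proof (rule dependent_nat_choice)
      show "\<exists>x. heavy (fst x) (snd x) \<and> \<epsilon> \<in> cylinder (snd x) \<and> length (fst x) = 0"
        using s\<^sub>0 \<epsilon>(1) by (intro exI[of _ "([], s\<^sub>0)"]) simp
      fix x :: "nat list \<times> bool list" and k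
      assume x: "heavy (fst x) (snd x) \<and> \<epsilon> \<in> cylinder (snd x) \<and> length (fst x) = k"
      have "\<epsilon> \<notin> stuck (fst x) (snd x)"
        using x \<epsilon>(2) unfolding B_def by force
      then obtain e t where "heavy (fst x @ [e]) (snd x @ t)" "\<epsilon> \<in> cylinder (snd x @ t)"
        using x unfolding stuck_def by blast
      then show "\<exists>y. (heavy (fst y) (snd y) \<and> \<epsilon> \<in> cylinder (snd y) \<and> length (fst y) = Suc k) \<and>
          (\<exists>e. fst y = fst x @ [e])"
        using x by (intro exI[of _ "(fst x @ [e], snd x @ t)"]) auto
    qed
    then obtain f where f: "\<And>k. heavy (fst (f k)) (snd (f k))" "\<And>k. \<epsilon> \<in> cylinder (snd (f k))"
      "\<And>k. length (fst (f k)) = k" "\<And>k. \<exists>e. fst (f (Suc k)) = fst (f k) @ [e]"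
      by blast
    define \<delta> where "\<delta> k = fst (f (Suc k)) ! k" for k
    have \<delta>: "map \<delta> [0..<k] = fst (f k)" for k
    proof (induction k)
      case 0
      then show ?case
        using f(3)[of 0] by simp
    next
      case (Suc k)
      obtain e where e: "fst (f (Suc k)) = fst (f k) @ [e]"
        using f(4) by blast
      then have "\<delta> k = e"
        using f(3)[of k] by (simp add: \<delta>_def nth_append)
      then show ?case
        using Suc e by simp
    qed
    show ?thesis
    proof (rule closed[of i \<delta>])
      fix k m
      let ?u = "map \<epsilon> [length (snd (f k))..<length (snd (f k)) + m]"
      have "\<not> meager (A i (fst (f k)) \<inter> cylinder (snd (f k) @ ?u))"
        using f(1) unfolding heavy_def by blast
      then have "A i (fst (f k)) \<inter> cylinder (snd (f k) @ ?u) \<noteq> {}"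
        using nowhere_dense_empty nowhere_dense_imp_meager by metis
      then obtain \<epsilon>' where \<epsilon>': "\<epsilon>' \<in> A i (fst (f k))" "\<epsilon>' \<in> cylinder (snd (f k) @ ?u)"
        by blast
      have "\<epsilon> \<in> cylinder (snd (f k) @ ?u)"
        by (rule cylinder_extend[OF f(2)])
      with \<epsilon>'(2) have "\<epsilon>' j = \<epsilon> j" if "j < m" for j
        using that by (simp add: cylinder_def)
      with \<epsilon>'(1) show "\<exists>\<epsilon>'\<in>A i (map \<delta> [0..<k]). \<forall>j<m. \<epsilon>' j = \<epsilon> j"
        using \<delta> by auto
    qed
  qed
  \<comment> \<open>The first coordinate left free by \<open>s\<^sub>0\<close>: flipping it
    preserves the cylinder, and it preserves meagerness, so some point and its flip both avoid
    \<open>B\<close>.\<close>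
  let ?n = "length s\<^sub>0"
  have "\<not> cylinder s\<^sub>0 \<subseteq> B \<union> {\<epsilon>. \<epsilon>(?n := \<not> \<epsilon> ?n) \<in> B}"
    using not_meager_cylinder meager_subset meager_Un[OF \<open>meager B\<close> meager_flip[OF \<open>meager B\<close>]] by blast
  then obtain \<epsilon> where \<epsilon>: "\<epsilon> \<in> cylinder s\<^sub>0" "\<epsilon> \<notin> B" "\<epsilon>(?n := \<not> \<epsilon> ?n) \<notin> B"
    by blast
  moreover have "\<epsilon>(?n := \<not> \<epsilon> ?n) \<in> cylinder s\<^sub>0"
    using \<epsilon>(1) by (simp add: cylinder_def)
  ultimately show ?thesis
    using generic by blast
qed

section \<open>Infinite concatenations of loops\<close>

lemma homotopic_paths_cancel_left:
  assumes b: "path_from_to X x y b" and r: "path_from_to X y z r"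
  shows "homotopic_paths X (reversepath b +++ (b +++ r)) r"
proof -
  have "homotopic_paths X (reversepath b +++ (b +++ r)) ((reversepath b +++ b) +++ r)"
    using assms by (intro homotopic_paths_assoc) auto
  also have "homotopic_paths X \<dots> ((\<lambda>_. y) +++ r)"
    using assms by (intro homotopic_paths_join homotopic_paths_left_inverse) auto
  also have "homotopic_paths X \<dots> r"
    using r by (intro homotopic_paths_const_join) auto
  finally show ?thesis .
qed

lemma homotopic_paths_cancel_right:
  assumes b: "path_from_to X x y b" and r: "path_from_to X z y r"
  shows "homotopic_paths X ((r +++ reversepath b) +++ b) r"
proof -
  have "homotopic_paths X ((r +++ reversepath b) +++ b) (r +++ (reversepath b +++ b))"
    using assms by (intro homotopic_paths_sym[OF homotopic_paths_assoc]) auto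
  also have "homotopic_paths X \<dots> (r +++ (\<lambda>_. y))"
    using assms by (intro homotopic_paths_join homotopic_paths_left_inverse) auto
  also have "homotopic_paths X \<dots> r"
    using r by (intro homotopic_paths_join_const) auto
  finally show ?thesis .
qed

text \<open>An arbitrary representative \<open>q\<close> is allowed because the change of base point
  acts on a loop picked from its class by choice.\<close>

lemma homotopic_paths_conjugate_back:
  assumes b: "path_from_to X x y b" and p: "p \<in> loops_at X y"
    and q: "homotopic_paths X ((b +++ p) +++ reversepath b) q"
  shows "homotopic_paths X (reversepath b +++ (q +++ b)) p"
proof -
  have p': "path_from_to X y y p"
    using p by (simp add: loops_at_def)
  have q': "path_from_to X x x q"
    using homotopic_paths_imp_path[OF q] homotopic_paths_imp_subset[OF q]
      homotopic_paths_imp_pathstart[OF q] homotopic_paths_imp_pathfinish[OF q] b p' by auto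
  have "homotopic_paths X (reversepath b +++ (q +++ b)) (reversepath b +++ (((b +++ p) +++ reversepath b) +++ b))"
    using b p' q' by (intro homotopic_paths_join homotopic_paths_sym[OF q]) auto
  also have "homotopic_paths X \<dots> (reversepath b +++ (b +++ p))"
    using path_from_to_join[OF b p'] b p' by (intro homotopic_paths_join homotopic_paths_cancel_right) auto
  also have "homotopic_paths X \<dots> p"
    using b p' by (rule homotopic_paths_cancel_left)
  finally show ?thesis .
qed

text \<open>For countability it is enough that conjugation by \<open>b\<close> hits every class;
  that it is a homomorphism is never established.\<close>

lemma countable_fundamental_group_base_change:
  assumes b: "path_from_to X x y b" and c: "countable (carrier (fundamental_group X x))"
  shows "countable (carrier (fundamental_group X y))"
proof -
  let ?h = "\<lambda>C. path_class X (reversepath b +++ ((SOME q. q \<in> C) +++ b))"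
  have "carrier (fundamental_group X y) \<subseteq> ?h ` carrier (fundamental_group X x)"
  proof
    fix D
    assume "D \<in> carrier (fundamental_group X y)"
    then obtain p where p: "p \<in> loops_at X y" "D = path_class X p"
      by (auto simp: fundamental_group_def)
    let ?q = "(b +++ p) +++ reversepath b"
    have q: "?q \<in> loops_at X x"
      using b p by (auto simp: loops_at_def subset_path_image_join)
    then have "?q \<in> path_class X ?q"
      by (simp add: loops_at_def)
    then have "(SOME q. q \<in> path_class X ?q) \<in> path_class X ?q"
      by (rule someI[of "\<lambda>q. q \<in> path_class X ?q"])
    then have "?h (path_class X ?q) = D"
      unfolding p(2) by (intro path_class_eq homotopic_paths_conjugate_back[OF b p(1)]) simp
    moreover have "path_class X ?q \<in> carrier (fundamental_group X x)"
      using q by (simp add: fundamental_group_def)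
    ultimately show "D \<in> ?h ` carrier (fundamental_group X x)"
      by blast
  qed
  then show ?thesis
    using c countable_image countable_subset by blast
qed

lemma homotopic_loops_join_cancel:
  assumes "p \<in> loops_at X x" "q \<in> loops_at X x" "r \<in> loops_at X x" "x \<in> X"
  shows "homotopic_paths X (p +++ q) (p +++ r) \<Longrightarrow> homotopic_paths X q r"
    and "homotopic_paths X (q +++ p) (r +++ p) \<Longrightarrow> homotopic_paths X q r"
proof -
  let ?G = "fundamental_group X x"
  interpret group ?G
    using assms(4) by (rule group_fundamental_group)
  have car: "path_class X p \<in> carrier ?G" "path_class X q \<in> carrier ?G" "path_class X r \<in> carrier ?G"
    using assms by (auto simp: fundamental_group_def)
  show "homotopic_paths X q r" if "homotopic_paths X (p +++ q) (p +++ r)"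
    using path_class_eq[OF that] car path_class_eq_iff[OF assms(2)] assms(1-3)
    by (simp add: mult_fundamental_group[symmetric])
  show "homotopic_paths X q r" if "homotopic_paths X (q +++ p) (r +++ p)"
    using path_class_eq[OF that] car path_class_eq_iff[OF assms(2)] assms(1-3)
    by (simp add: mult_fundamental_group[symmetric])
qed

section \<open>Infinite products of shrinking loops\<close>

fun iter_join :: "'a::topological_space \<Rightarrow> nat \<Rightarrow> (nat \<Rightarrow> real \<Rightarrow> 'a) \<Rightarrow> real \<Rightarrow> 'a" where
  "iter_join x 0 g = (\<lambda>_. x)"
| "iter_join x (Suc n) g = g 0 +++ iter_join x n (\<lambda>k. g (Suc k))"

text \<open>Products are nested to the right, so factor \<open>n\<close> occupies the parameters
  between \<open>1 - 1/2^n\<close> and \<open>1 - 1/2^(n+1)\<close>, and the finite products are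
  eventually constant at each parameter below 1.\<close>

definition inf_join :: "'a::t2_space \<Rightarrow> (nat \<Rightarrow> real \<Rightarrow> 'a) \<Rightarrow> real \<Rightarrow> 'a" where
  "inf_join x g t = lim (\<lambda>n. iter_join x n g t)"

text \<open>The radii decrease so that \<open>r n\<close> bounds all loops from index
  \<open>n\<close> on; they are a separate argument so that all subsequences share them.\<close>

definition shrinking_loops :: "'a::metric_space set \<Rightarrow> 'a \<Rightarrow> (nat \<Rightarrow> real) \<Rightarrow> (nat \<Rightarrow> real \<Rightarrow> 'a) \<Rightarrow> bool" where
  "shrinking_loops X x r g \<longleftrightarrow> decseq r \<and> r \<longlonglongrightarrow> 0 \<and>
     (\<forall>k. g k \<in> loops_at X x \<and> path_image (g k) \<subseteq> cball x (r k))"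

lemma shrinking_loops_Suc:
  "shrinking_loops X x r g \<Longrightarrow> shrinking_loops X x (\<lambda>k. r (Suc k)) (\<lambda>k. g (Suc k))"
  by (auto simp: shrinking_loops_def decseq_def intro: LIMSEQ_Suc)

lemma iter_join_loops_at:
  "(\<And>k. g k \<in> loops_at X x) \<Longrightarrow> x \<in> X \<Longrightarrow> iter_join x n g \<in> loops_at X x"
  by (induction n arbitrary: g) (auto intro: loops_at_join loops_at_const)

lemma loops_at_mem: "p \<in> loops_at X x \<Longrightarrow> t \<in> {0..1} \<Longrightarrow> p t \<in> X"
  unfolding loops_at_def path_image_def by blast

lemma iter_join_cong: "(\<And>k. k < n \<Longrightarrow> g k = g' k) \<Longrightarrow> iter_join x n g = iter_join x n g'"
proof (induction n arbitrary: g g')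
  case (Suc n)
  have "iter_join x n (\<lambda>k. g (Suc k)) = iter_join x n (\<lambda>k. g' (Suc k))"
    by (rule Suc.IH) (use Suc.prems in blast)
  moreover have "g 0 = g' 0"
    by (rule Suc.prems) simp
  ultimately show ?case
    by simp
qed simp

text \<open>The two products differ only on the last subinterval, where the shorter one rests at
  \<open>x\<close> while the longer one runs through loops within distance \<open>r\<close> of
  \<open>x\<close>.\<close>

lemma iter_join_dist_le:
  assumes "\<And>k. g k \<in> loops_at X x" "\<And>k. k \<ge> n \<Longrightarrow> path_image (g k) \<subseteq> cball x r" "r \<ge> 0" "t \<in> {0..1}"
  shows "dist (iter_join x n g t) (iter_join x (n + j) g t) \<le> r"
  using assms
proof (induction n arbitrary: g t)
  case 0
  have "iter_join x j g \<in> loops_at (cball x r) x"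
    using 0 by (intro iter_join_loops_at) (auto simp: loops_at_def)
  from loops_at_mem[OF this 0(4)] show ?case
    by simp
next
  case (Suc n)
  have IH: "dist (iter_join x n (\<lambda>k. g (Suc k)) s) (iter_join x (n + j) (\<lambda>k. g (Suc k)) s) \<le> r" if "s \<in> {0..1}" for s
    by (rule Suc.IH) (use Suc.prems that in auto)
  show ?case
    using IH[of "2 * t - 1"] Suc.prems(3,4) by (auto simp: joinpaths_def)
qed

lemma inf_join_limit:
  assumes X: "compact X" "x \<in> X" and g: "shrinking_loops X x r g" and t: "t \<in> {0..1}"
  shows "inf_join x g t \<in> X" "(\<lambda>n. iter_join x n g t) \<longlonglongrightarrow> inf_join x g t"
    "dist (iter_join x n g t) (inf_join x g t) \<le> r n"
proof -
  have r: "r \<longlonglongrightarrow> 0" "decseq r" and loops: "\<And>k. g k \<in> loops_at X x" and small: "\<And>k. path_image (g k) \<subseteq> cball x (r k)"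
    using g by (auto simp: shrinking_loops_def)
  have r0: "r n \<ge> 0" for n
    using decseq_ge[OF r(2,1)] .
  have "path_image (g k) \<subseteq> cball x (r n)" if "k \<ge> n" for k n
    using small[of k] decseqD[OF r(2) that] by auto
  then have "dist (iter_join x n g s) (iter_join x (n + j) g s) \<le> r n" if "s \<in> {0..1}" for n j s
    using loops r0 that by (intro iter_join_dist_le)
  moreover have "iter_join x n g s \<in> X" if "s \<in> {0..1}" for n s
    using loops_at_mem[OF iter_join_loops_at[of g, OF loops X(2)] that] .
  ultimately have "\<exists>f. \<forall>t\<in>{0..1}. f t \<in> X \<and> (\<lambda>k. iter_join x k g t) \<longlonglongrightarrow> f t \<and>
      (\<forall>k. dist (iter_join x k g t) (f t) \<le> r k)"
    using r(1) by (intro uniformly_convergent_in_compact[OF X(1)])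
  then obtain f where f: "\<forall>t\<in>{0..1}. f t \<in> X \<and> (\<lambda>k. iter_join x k g t) \<longlonglongrightarrow> f t \<and>
      (\<forall>k. dist (iter_join x k g t) (f t) \<le> r k)" ..
  then have "inf_join x g t = f t"
    unfolding inf_join_def using t by (intro limI) blast
  with f t show "inf_join x g t \<in> X" "(\<lambda>n. iter_join x n g t) \<longlonglongrightarrow> inf_join x g t"
    "dist (iter_join x n g t) (inf_join x g t) \<le> r n"
    by auto
qed

lemma inf_join_loops_at:
  assumes X: "compact X" "x \<in> X" and g: "shrinking_loops X x r g"
  shows "inf_join x g \<in> loops_at X x"
proof -
  note lim = inf_join_limit[OF X g]
  have r: "r \<longlonglongrightarrow> 0" and loops: "iter_join x n g \<in> loops_at X x" for n
    using g X(2) by (auto simp: shrinking_loops_def intro: iter_join_loops_at)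
  have "continuous_on {0..1} (inf_join x g)"
  proof (rule uniform_limit_theorem)
    show "\<forall>\<^sub>F n in sequentially. continuous_on {0..1} (iter_join x n g)"
      using loops by (auto simp: loops_at_def path_def)
    show "uniform_limit {0..1} (\<lambda>n. iter_join x n g) (inf_join x g) sequentially"
    proof (rule uniform_limitI)
      fix e :: real
      assume "e > 0"
      then have "\<forall>\<^sub>F n in sequentially. r n < e"
        using r by (intro order_tendstoD)
      then show "\<forall>\<^sub>F n in sequentially. \<forall>t\<in>{0..1}. dist (iter_join x n g t) (inf_join x g t) < e"
        by eventually_elim (use lim(3) le_less_trans in blast)
    qed
  qed simp
  moreover have "iter_join x n g 0 = x" "iter_join x n g 1 = x" for n
    using loops[of n] by (auto simp: loops_at_def pathstart_def pathfinish_def)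
  then have "inf_join x g 0 = x" "inf_join x g 1 = x"
    using lim(2)[of 0] lim(2)[of 1] by (auto dest: LIMSEQ_unique[OF tendsto_const])
  ultimately show ?thesis
    using lim(1) by (auto simp: loops_at_def path_def path_image_def pathstart_def pathfinish_def)
qed

text \<open>Splitting off a factor is an equality of functions on the unit interval, inherited from
  the finite products; no homotopy is involved.\<close>

lemma inf_join_unfold:
  assumes X: "compact X" "x \<in> X" and g: "shrinking_loops X x r g" and t: "t \<in> {0..1}"
  shows "inf_join x g t = (g 0 +++ inf_join x (\<lambda>k. g (Suc k))) t"
proof (rule LIMSEQ_unique)
  show "(\<lambda>n. iter_join x (Suc n) g t) \<longlonglongrightarrow> inf_join x g t"
    using inf_join_limit(2)[OF X g t] by (rule LIMSEQ_Suc)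
  show "(\<lambda>n. iter_join x (Suc n) g t) \<longlonglongrightarrow> (g 0 +++ inf_join x (\<lambda>k. g (Suc k))) t"
    using inf_join_limit(2)[OF X shrinking_loops_Suc[OF g], of "2 * t - 1"] t
    by (auto simp: joinpaths_def)
qed

text \<open>Continuity of the infinite product in its sequence of factors: both loops are within
  \<open>r n\<close> of the same finite product.\<close>

lemma inf_join_dist_le:
  assumes X: "compact X" "x \<in> X" and g: "shrinking_loops X x r g" "shrinking_loops X x r g'"
    and eq: "\<And>k. k < n \<Longrightarrow> g k = g' k" and t: "t \<in> {0..1}"
  shows "dist (inf_join x g t) (inf_join x g' t) \<le> 2 * r n"
  using inf_join_limit(3)[OF X g(1) t, of n] inf_join_limit(3)[OF X g(2) t, of n] iter_join_cong[OF eq]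
    dist_triangle[of "inf_join x g t" "inf_join x g' t" "iter_join x n g t"]
  by (simp add: dist_commute)

lemma homotopic_paths_inf_join_unfold:
  assumes X: "compact X" "x \<in> X" and g: "shrinking_loops X x r g"
  shows "homotopic_paths X (inf_join x g) (g 0 +++ inf_join x (\<lambda>k. g (Suc k)))"
  using inf_join_loops_at[OF X g] inf_join_unfold[OF X g]
  by (intro homotopic_paths_eq) (auto simp: loops_at_def)

text \<open>Equal first factors are cancelled on the left until the differing one comes first; then
  the common infinite tail is cancelled on the right.\<close>

lemma inf_join_homotopic_imp:
  assumes X: "compact X" "x \<in> X" and "shrinking_loops X x r g" "shrinking_loops X x r g'"
    and "\<And>k. k \<noteq> n \<Longrightarrow> g k = g' k" "homotopic_paths X (inf_join x g) (inf_join x g')"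
  shows "homotopic_paths X (g n) (g' n)"
  using assms(3-)
proof (induction n arbitrary: g g' r)
  case (0 g g' r)
  have loops: "g 0 \<in> loops_at X x" "g' 0 \<in> loops_at X x" "inf_join x (\<lambda>k. g (Suc k)) \<in> loops_at X x"
    using 0(1,2) inf_join_loops_at[OF X shrinking_loops_Suc[OF 0(1)]] by (auto simp: shrinking_loops_def)
  have "(\<lambda>k. g (Suc k)) = (\<lambda>k. g' (Suc k))"
    using 0(3) by auto
  then have "homotopic_paths X (g 0 +++ inf_join x (\<lambda>k. g (Suc k))) (g' 0 +++ inf_join x (\<lambda>k. g (Suc k)))"
    using homotopic_paths_inf_join_unfold[OF X 0(1)] homotopic_paths_inf_join_unfold[OF X 0(2)] 0(4)
    by (metis homotopic_paths_sym homotopic_paths_trans)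
  then show ?case
    by (rule homotopic_loops_join_cancel(2)[OF loops(3,1,2) X(2)])
next
  case (Suc n g g' r)
  have loops: "g 0 \<in> loops_at X x" "inf_join x (\<lambda>k. g (Suc k)) \<in> loops_at X x"
    "inf_join x (\<lambda>k. g' (Suc k)) \<in> loops_at X x"
    using Suc.prems(1) inf_join_loops_at[OF X shrinking_loops_Suc[OF Suc.prems(1)]]
      inf_join_loops_at[OF X shrinking_loops_Suc[OF Suc.prems(2)]] by (auto simp: shrinking_loops_def)
  have "g 0 = g' 0"
    using Suc.prems(3)[of 0] by simp
  then have "homotopic_paths X (g 0 +++ inf_join x (\<lambda>k. g (Suc k))) (g 0 +++ inf_join x (\<lambda>k. g' (Suc k)))"
    using homotopic_paths_inf_join_unfold[OF X Suc.prems(1)] homotopic_paths_inf_join_unfold[OF X Suc.prems(2)]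
      Suc.prems(4)
    by (metis homotopic_paths_sym homotopic_paths_trans)
  then have "homotopic_paths X (inf_join x (\<lambda>k. g (Suc k))) (inf_join x (\<lambda>k. g' (Suc k)))"
    by (rule homotopic_loops_join_cancel(1)[OF loops X(2)])
  then show ?case
    by (rule Suc.IH[OF shrinking_loops_Suc[OF Suc.prems(1)] shrinking_loops_Suc[OF Suc.prems(2)], rotated])
      (use Suc.prems(3) in auto)
qed

text \<open>Separability of the mapping space: by uniform continuity a map is determined up to
  \<open>e / 2\<close> by a mesh and a function from a finite net of \<open>K\<close> to a finite
  net of \<open>Y\<close>, and there are countably many such codes.\<close>

lemma countable_small_cover_of_continuous_maps:
  fixes K :: "'b::metric_space set" and Y :: "'a::metric_space set"
  assumes "compact K" "compact Y" "e > 0"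
  shows "\<exists>D :: nat \<Rightarrow> ('b \<Rightarrow> 'a) set. (\<forall>H. continuous_on K H \<longrightarrow> H \<in> K \<rightarrow> Y \<longrightarrow> (\<exists>i. H \<in> D i)) \<and>
    (\<forall>i. \<forall>H\<in>D i. \<forall>H'\<in>D i. \<forall>z\<in>K. dist (H z) (H' z) < e)"
proof -
  have "\<exists>S. finite S \<and> K \<subseteq> (\<Union>s\<in>S. ball s (1 / Suc n))" for n
    using assms(1) unfolding compact_eq_totally_bounded by simp
  then obtain S where S: "\<And>n. finite (S n)" "\<And>n. K \<subseteq> (\<Union>s\<in>S n. ball s (1 / Suc n))"
    by metis
  have "e / 4 > 0"
    using assms(3) by simp
  then obtain T where T: "finite T" "Y \<subseteq> (\<Union>s\<in>T. ball s (e / 4))"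
    using assms(2) unfolding compact_eq_totally_bounded by blast
  \<comment> \<open>The value \<open>undefined\<close> is available for net points whose ball misses
    \<open>K\<close>, where nothing is to be approximated.\<close>
  define I where "I = (SIGMA n:UNIV. PiE (S n) (\<lambda>_. insert undefined T))"
  define D' where "D' n \<phi> = {H. \<forall>s\<in>S n. \<forall>z\<in>K \<inter> ball s (1 / Suc n). dist (H z) (\<phi> s) < e / 2}" for n and \<phi> :: "'b \<Rightarrow> 'a"
  have "countable I"
    unfolding I_def using S(1) T(1) by (intro countable_SIGMA countable_PiE) (auto intro: countable_finite)
  have "\<exists>i. H \<in> D' (fst (from_nat_into I i)) (snd (from_nat_into I i))"
    if H: "continuous_on K H" "H \<in> K \<rightarrow> Y" for H
  proof -
    obtain d where d: "d > 0" "\<And>z z'. z \<in> K \<Longrightarrow> z' \<in> K \<Longrightarrow> dist z' z < d \<Longrightarrow> dist (H z') (H z) < e / 4"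
      using compact_uniformly_continuous[OF H(1) assms(1)] \<open>e / 4 > 0\<close> unfolding uniformly_continuous_on_def by metis
    obtain n where n: "1 / Suc n < d / 2"
      using d(1) reals_Archimedean[of "d / 2"] by (auto simp: inverse_eq_divide)
    define w where "w s = (SOME z. z \<in> K \<inter> ball s (1 / Suc n))" for s
    have w: "w s \<in> K \<inter> ball s (1 / Suc n)" if "z \<in> K \<inter> ball s (1 / Suc n)" for s z
      unfolding w_def using that by (rule someI)
    have "\<forall>z\<in>K. \<exists>y\<in>T. dist (H z) y < e / 4"
      using H(2) T(2) by (fastforce simp: dist_commute)
    then obtain h where h: "\<And>z. z \<in> K \<Longrightarrow> h z \<in> T \<and> dist (H z) (h z) < e / 4"
      by metis
    define \<phi> where "\<phi> = restrict (\<lambda>s. if w s \<in> K then h (w s) else undefined) (S n)"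
    have "(n, \<phi>) \<in> I"
      using h by (auto simp: I_def \<phi>_def)
    then obtain i where i: "from_nat_into I i = (n, \<phi>)"
      using from_nat_into_surj[OF \<open>countable I\<close>] by blast
    have "dist (H z) (\<phi> s) < e / 2" if s: "s \<in> S n" and z: "z \<in> K \<inter> ball s (1 / Suc n)" for s z
    proof -
      have ws: "w s \<in> K" "dist s (w s) < 1 / Suc n"
        using w[OF z] by auto
      then have "dist z (w s) < d"
        using z n dist_triangle[of z "w s" s] by (auto simp: dist_commute)
      then have "dist (H z) (H (w s)) < e / 4"
        using d(2) ws z by auto
      then show ?thesis
        using h[OF ws(1)] ws s dist_triangle[of "H z" "h (w s)" "H (w s)"] by (simp add: \<phi>_def)
    qed
    then have "H \<in> D' n \<phi>"
      unfolding D'_def by blast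
    with i show ?thesis
      by (metis fst_conv snd_conv)
  qed
  moreover have "dist (H z) (H' z) < e" if "H \<in> D' n \<phi>" "H' \<in> D' n \<phi>" "z \<in> K" for n \<phi> H H' z
  proof -
    obtain s where "s \<in> S n" "z \<in> K \<inter> ball s (1 / Suc n)"
      using S(2)[of n] \<open>z \<in> K\<close> by blast
    then have "dist (H z) (\<phi> s) < e / 2" "dist (H' z) (\<phi> s) < e / 2"
      using that unfolding D'_def by blast+
    then show ?thesis
      using dist_triangle[of "H z" "H' z" "\<phi> s"] by (simp add: dist_commute)
  qed
  ultimately show ?thesis
    by (intro exI[of _ "\<lambda>i. D' (fst (from_nat_into I i)) (snd (from_nat_into I i))"]) blast
qed

section \<open>Countable fundamental groups and small loops\<close>

lemma shrinking_loops_select: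
  assumes "shrinking_loops X x r f" "x \<in> X"
  shows "shrinking_loops X x r (\<lambda>k. if \<epsilon> k then f k else (\<lambda>_. x))"
proof -
  have "r k \<ge> 0" for k
    using assms(1) decseq_ge by (auto simp: shrinking_loops_def)
  then show ?thesis
    using assms by (auto simp: shrinking_loops_def loops_at_const path_const)
qed

text \<open>Every subsequence of \<open>f\<close> yields an infinite concatenation. For fixed \<open>q\<close>, the subsequences whose
  concatenation is homotopic to \<open>q\<close> form an analytic set: a homotopy is the uniform limit of approximations
  taken from countable lists.\<close>

lemma shrinking_loops_null_member:
  fixes X :: "'a::metric_space set"
  assumes X: "compact X" "x \<in> X" and cnt: "countable (carrier (fundamental_group X x))"
    and f: "shrinking_loops X x r f"
  shows "\<exists>n. homotopic_paths X (f n) (\<lambda>_. x)"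
proof -
  let ?K = "{0..1::real} \<times> {0..1::real}"
  define g where "g \<epsilon> = (\<lambda>k. if \<epsilon> k then f k else (\<lambda>_. x))" for \<epsilon> :: "nat \<Rightarrow> bool"
  define P where "P \<epsilon> = inf_join x (g \<epsilon>)" for \<epsilon>
  have g: "shrinking_loops X x r (g \<epsilon>)" for \<epsilon>
    unfolding g_def using f X(2) by (rule shrinking_loops_select)
  have P: "P \<epsilon> \<in> loops_at X x" for \<epsilon>
    unfolding P_def by (rule inf_join_loops_at[OF X g])
  have "compact ?K"
    by (intro compact_Times compact_Icc)
  have "\<forall>k::nat. \<exists>D :: nat \<Rightarrow> (real \<times> real \<Rightarrow> 'a) set.
      (\<forall>H. continuous_on ?K H \<longrightarrow> H \<in> ?K \<rightarrow> X \<longrightarrow> (\<exists>i. H \<in> D i)) \<and>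
      (\<forall>i. \<forall>H\<in>D i. \<forall>H'\<in>D i. \<forall>z\<in>?K. dist (H z) (H' z) < 1 / Suc k)"
    by (intro allI countable_small_cover_of_continuous_maps \<open>compact ?K\<close> X(1)) simp
  from choice[OF this] obtain D :: "nat \<Rightarrow> nat \<Rightarrow> (real \<times> real \<Rightarrow> 'a) set" where
    D: "\<And>k H. continuous_on ?K H \<Longrightarrow> H \<in> ?K \<rightarrow> X \<Longrightarrow> \<exists>i. H \<in> D k i"
      "\<And>k i H H' z. H \<in> D k i \<Longrightarrow> H' \<in> D k i \<Longrightarrow> z \<in> ?K \<Longrightarrow> dist (H z) (H' z) < 1 / Suc k"
    by blast
  have "\<forall>i. \<exists>q. from_nat_into (carrier (fundamental_group X x)) i = path_class X q \<and> q \<in> loops_at X x"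
  proof
    fix i
    have "carrier (fundamental_group X x) \<noteq> {}"
      using P by (auto simp: fundamental_group_def)
    from from_nat_into[OF this, of i]
    show "\<exists>q. from_nat_into (carrier (fundamental_group X x)) i = path_class X q \<and> q \<in> loops_at X x"
      by (auto simp: fundamental_group_def)
  qed
  from choice[OF this] obtain q where
    q: "\<And>i. from_nat_into (carrier (fundamental_group X x)) i = path_class X (q i)" "\<And>i. q i \<in> loops_at X x"
    by blast
  define hom where "hom i \<epsilon> H \<longleftrightarrow> continuous_on ?K H \<and> H \<in> ?K \<rightarrow> X \<and>
     (\<forall>t\<in>{0..1}. H (0, t) = q i t \<and> H (1, t) = P \<epsilon> t \<and> H (t, 0) = x \<and> H (t, 1) = x)" for i \<epsilon> H
  have hom_iff: "homotopic_paths X (q i) (P \<epsilon>) \<longleftrightarrow> (\<exists>H. hom i \<epsilon> H)" for i \<epsilon>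
    using q(2)[of i] unfolding homotopic_paths hom_def loops_at_def pathstart_def pathfinish_def by auto
  \<comment> \<open>The Souslin scheme: a node \<open>d\<close> demands a homotopy from
    \<open>q i\<close> to \<open>P \<epsilon>\<close> whose approximations to accuracy
    \<open>1 / Suc j\<close> are the prescribed ones for all \<open>j < length d\<close>.\<close>
  define A where "A i d = {\<epsilon>. \<exists>H. hom i \<epsilon> H \<and> (\<forall>j<length d. H \<in> D j (d ! j))}" for i d
  have A_Nil: "\<epsilon> \<in> A i [] \<longleftrightarrow> homotopic_paths X (q i) (P \<epsilon>)" for \<epsilon> i
    by (simp add: A_def hom_iff)
  have "\<exists>i n \<epsilon>. \<epsilon> \<in> A i [] \<and> \<epsilon>(n := \<not> \<epsilon> n) \<in> A i []"
  proof (rule Souslin_cover_contains_flip)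
    fix \<epsilon>
    have "path_class X (P \<epsilon>) \<in> carrier (fundamental_group X x)"
      using P by (auto simp: fundamental_group_def)
    then obtain i where "path_class X (q i) = path_class X (P \<epsilon>)"
      using from_nat_into_surj[OF cnt] q(1) by metis
    then show "\<exists>i. \<epsilon> \<in> A i []"
      using path_class_eq_iff[OF q(2)] A_Nil by blast
  next
    fix i d \<epsilon>
    assume "\<epsilon> \<in> A i d"
    then obtain H where H: "hom i \<epsilon> H" "\<forall>j<length d. H \<in> D j (d ! j)"
      by (auto simp: A_def)
    then have "continuous_on ?K H" "H \<in> ?K \<rightarrow> X"
      by (simp_all add: hom_def)
    then obtain e where "H \<in> D (length d) e"
      using D(1)[of H "length d"] by blast
    then have "\<forall>j<length (d @ [e]). H \<in> D j ((d @ [e]) ! j)"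
      using H(2) by (auto simp: nth_append less_Suc_eq)
    then show "\<exists>e. \<epsilon> \<in> A i (d @ [e])"
      using H(1) unfolding A_def by blast
  next
    fix i \<delta> \<epsilon>
    assume approx: "\<And>k m. \<exists>\<epsilon>'\<in>A i (map \<delta> [0..<k]). \<forall>j<m. \<epsilon>' j = \<epsilon> j"
    \<comment> \<open>Using \<open>k + 1\<close> entries of the branch, \<open>H k\<close> and all
      later homotopies lie in the common set \<open>D k (\<delta> k)\<close>, hence differ by less
      than \<open>1 / Suc k\<close>, although their final loops vary with
      \<open>\<epsilon>' k\<close>.\<close>
    have "\<forall>k. \<exists>\<epsilon>' H. (\<forall>j<k. \<epsilon>' j = \<epsilon> j) \<and> hom i \<epsilon>' H \<and> (\<forall>j<Suc k. H \<in> D j (\<delta> j))"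
    proof
      fix k
      obtain \<epsilon>' where "\<epsilon>' \<in> A i (map \<delta> [0..<Suc k])" "\<forall>j<k. \<epsilon>' j = \<epsilon> j"
        using approx by blast
      moreover from this obtain H where "hom i \<epsilon>' H" "\<forall>j<length (map \<delta> [0..<Suc k]). H \<in> D j (map \<delta> [0..<Suc k] ! j)"
        unfolding A_def by blast
      then have "hom i \<epsilon>' H" "\<forall>j<Suc k. H \<in> D j (\<delta> j)"
        by (auto simp del: upt_Suc)
      ultimately show "\<exists>\<epsilon>' H. (\<forall>j<k. \<epsilon>' j = \<epsilon> j) \<and> hom i \<epsilon>' H \<and> (\<forall>j<Suc k. H \<in> D j (\<delta> j))"
        by blast
    qed
    from choice[OF this] obtain \<epsilon>' where
      "\<forall>k. \<exists>H. (\<forall>j<k. \<epsilon>' k j = \<epsilon> j) \<and> hom i (\<epsilon>' k) H \<and> (\<forall>j<Suc k. H \<in> D j (\<delta> j))"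
      by blast
    from choice[OF this] obtain H where
      \<epsilon>': "\<And>k j. j < k \<Longrightarrow> \<epsilon>' k j = \<epsilon> j" and H: "\<And>k. hom i (\<epsilon>' k) (H k)" "\<And>k j. j < Suc k \<Longrightarrow> H k \<in> D j (\<delta> j)"
      by blast
    have cont: "continuous_on ?K (H k)" and HX: "z \<in> ?K \<Longrightarrow> H k z \<in> X"
      and ends: "t \<in> {0..1} \<Longrightarrow> H k (0, t) = q i t" "t \<in> {0..1} \<Longrightarrow> H k (1, t) = P (\<epsilon>' k) t"
        "t \<in> {0..1} \<Longrightarrow> H k (t, 0) = x" "t \<in> {0..1} \<Longrightarrow> H k (t, 1) = x" for k z t
      using H(1)[of k] unfolding hom_def by blast+
    have "\<exists>L. \<forall>z\<in>?K. L z \<in> X \<and> (\<lambda>k. H k z) \<longlonglongrightarrow> L z \<and> (\<forall>k. dist (H k z) (L z) \<le> 1 / Suc k)"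
    proof (rule uniformly_convergent_in_compact[OF X(1) HX])
      fix k j z
      assume "z \<in> ?K"
      then show "dist (H k z) (H (k + j) z) \<le> 1 / Suc k"
        using D(2)[OF H(2)[of k k] H(2)[of k "k + j"]] by (intro less_imp_le) simp
    qed (use LIMSEQ_inverse_real_of_nat in \<open>simp_all add: inverse_eq_divide\<close>)
    then obtain L where
      *: "\<forall>z\<in>?K. L z \<in> X \<and> (\<lambda>k. H k z) \<longlonglongrightarrow> L z \<and> (\<forall>k. dist (H k z) (L z) \<le> 1 / Suc k)" ..
    have L: "L z \<in> X" "(\<lambda>k. H k z) \<longlonglongrightarrow> L z" "dist (H k z) (L z) \<le> 1 / Suc k" if "z \<in> ?K" for z k
      using bspec[OF * that] by blast+
    have "continuous_on ?K L"
    proof (rule uniform_limit_theorem)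
      show "\<forall>\<^sub>F k in sequentially. continuous_on ?K (H k)"
        using cont by simp
      show "uniform_limit ?K H L sequentially"
      proof (rule uniform_limitI)
        fix e :: real
        assume "e > 0"
        have "(\<lambda>k. 1 / real (Suc k)) \<longlonglongrightarrow> 0"
          using LIMSEQ_inverse_real_of_nat by (simp add: inverse_eq_divide)
        then have "\<forall>\<^sub>F k in sequentially. 1 / real (Suc k) < e"
          using \<open>e > 0\<close> by (intro order_tendstoD)
        then show "\<forall>\<^sub>F k in sequentially. \<forall>z\<in>?K. dist (H k z) (L z) < e"
          by eventually_elim (use L(3) le_less_trans in blast)
      qed
    qed simp
    \<comment> \<open>The sequences \<open>\<epsilon>' k\<close> converge to \<epsilon>, so
      continuity of the infinite product identifies the far side of the limit homotopy.\<close>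
    moreover have "L (1, t) = P \<epsilon> t" if t: "t \<in> {0..1}" for t
    proof (rule LIMSEQ_unique)
      show "(\<lambda>k. P (\<epsilon>' k) t) \<longlonglongrightarrow> L (1, t)"
        using L(2)[of "(1, t)"] ends(2)[OF t] t by simp
      have d: "dist (P (\<epsilon>' k) t) (P \<epsilon> t) \<le> 2 * r k" for k
        unfolding P_def by (rule inf_join_dist_le[OF X g g _ t]) (simp add: g_def \<epsilon>')
      have "(\<lambda>k. 2 * r k) \<longlonglongrightarrow> 0"
        using f by (auto simp: shrinking_loops_def intro: tendsto_mult_right_zero)
      then have "(\<lambda>k. dist (P (\<epsilon>' k) t) (P \<epsilon> t)) \<longlonglongrightarrow> 0"
        by (rule tendsto_sandwich[rotated 2, OF tendsto_const]) (simp_all add: always_eventually d)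
      then show "(\<lambda>k. P (\<epsilon>' k) t) \<longlonglongrightarrow> P \<epsilon> t"
        by (rule tendsto_dist_iff[THEN iffD2])
    qed
    moreover have "L (0, t) = q i t" "L (t, 0) = x" "L (t, 1) = x" if t: "t \<in> {0..1}" for t
      using L(2)[of "(0, t)"] L(2)[of "(t, 0)"] L(2)[of "(t, 1)"] ends(1,3,4)[OF t] t
      by (auto dest: LIMSEQ_unique[OF tendsto_const])
    ultimately have "hom i \<epsilon> L"
      using L(1) unfolding hom_def by blast
    then show "\<epsilon> \<in> A i []"
      by (auto simp: A_def)
  qed
  then obtain i n \<epsilon> where "homotopic_paths X (q i) (P \<epsilon>)" "homotopic_paths X (q i) (P (\<epsilon>(n := \<not> \<epsilon> n)))"
    unfolding A_Nil by blast
  then have "homotopic_paths X (P \<epsilon>) (P (\<epsilon>(n := \<not> \<epsilon> n)))"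
    using homotopic_paths_sym homotopic_paths_trans by blast
  \<comment> \<open>The sequences differ at \<open>n\<close> alone, where one contains
    \<open>f n\<close> and the other the constant loop.\<close>
  then have "homotopic_paths X (g \<epsilon> n) (g (\<epsilon>(n := \<not> \<epsilon> n)) n)"
    unfolding P_def by (intro inf_join_homotopic_imp[OF X g g]) (auto simp: g_def)
  then have "homotopic_paths X (f n) (\<lambda>_. x)"
    by (cases "\<epsilon> n") (auto simp: g_def intro: homotopic_paths_sym)
  then show ?thesis ..
qed

lemma countable_imp_small_loops_null_at:
  fixes X :: "'a::metric_space set"
  assumes X: "compact X" "x \<in> X" and cnt: "countable (carrier (fundamental_group X x))"
  shows "\<exists>r>0. \<forall>p\<in>loops_at (X \<inter> ball x r) x. homotopic_paths X p (\<lambda>_. x)"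
proof (rule ccontr)
  assume contr: "\<not> ?thesis"
  have "\<forall>k::nat. \<exists>p. p \<in> loops_at (X \<inter> ball x (1 / Suc k)) x \<and> \<not> homotopic_paths X p (\<lambda>_. x)"
  proof
    fix k :: nat
    have "1 / real (Suc k) > 0"
      by simp
    with contr show "\<exists>p. p \<in> loops_at (X \<inter> ball x (1 / Suc k)) x \<and> \<not> homotopic_paths X p (\<lambda>_. x)"
      by blast
  qed
  from choice[OF this] obtain f where f: "\<And>k. f k \<in> loops_at (X \<inter> ball x (1 / Suc k)) x"
    "\<And>k. \<not> homotopic_paths X (f k) (\<lambda>_. x)"
    by blast
  have "shrinking_loops X x (\<lambda>k. 1 / Suc k) f"
    unfolding shrinking_loops_def
  proof (intro conjI allI)
    show "decseq (\<lambda>k. 1 / real (Suc k))"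
      by (auto simp: decseq_def frac_le)
    show "(\<lambda>k. 1 / real (Suc k)) \<longlonglongrightarrow> 0"
      using LIMSEQ_inverse_real_of_nat by (simp add: inverse_eq_divide)
    show "f k \<in> loops_at X x" for k
      using f(1)[of k] by (auto simp: loops_at_def)
    have "path_image (f k) \<subseteq> ball x (1 / Suc k)" for k
      using f(1)[of k] unfolding loops_at_def by blast
    then show "path_image (f k) \<subseteq> cball x (1 / Suc k)" for k
      using ball_subset_cball by blast
  qed
  then show False
    using shrinking_loops_null_member[OF X cnt] f(2) by blast
qed

lemma countable_imp_small_loops_null:
  fixes X :: "'a::metric_space set"
  assumes X: "compact X" "connected X" "locally connected X" "x\<^sub>0 \<in> X"
    and cnt: "countable (carrier (fundamental_group X x\<^sub>0))"
  obtains \<delta> where "\<delta> > 0" "\<forall>y\<in>X. \<forall>z. \<forall>p\<in>loops_at (X \<inter> ball y \<delta>) z. homotopic_paths X p (\<lambda>_. z)"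
proof -
  have "path_connected X"
    using X(2) path_component_eq_connected_component[OF compact_locally_connected_imp_locally_path_connected[OF X(1,3)]]
    unfolding path_connected_component connected_iff_connected_component by simp
  have "\<exists>s>0. \<forall>z. \<forall>p\<in>loops_at (X \<inter> ball x s) z. homotopic_paths X p (\<lambda>_. z)" if x: "x \<in> X" for x
  proof -
    obtain b where b: "path_from_to X x\<^sub>0 x b"
      using \<open>path_connected X\<close> X(4) x unfolding path_connected_def by blast
    then have "countable (carrier (fundamental_group X x))"
      using cnt by (rule countable_fundamental_group_base_change)
    then obtain r where r: "r > 0" "\<forall>p\<in>loops_at (X \<inter> ball x r) x. homotopic_paths X p (\<lambda>_. x)"
      using countable_imp_small_loops_null_at[OF X(1) x] by blast
    obtain s where s: "s > 0" "\<forall>x\<in>X. \<forall>y\<in>X. dist x y < s \<longrightarrow> (\<exists>p. path_from_to (X \<inter> ball x r) x y p)"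
      by (rule small_path_between_nearby[OF X(1,3) r(1)])
    \<comment> \<open>\<open>s\<close> provides a path from \<open>x\<close> to \<open>z\<close>
      within the ball of radius \<open>r\<close>; conjugation by it turns \<open>p\<close> into a
      loop at \<open>x\<close> in that ball, which is null.\<close>
    have "homotopic_paths X p (\<lambda>_. z)" if p: "p \<in> loops_at (X \<inter> ball x (min r s)) z" for z p
    proof -
      have "z \<in> X \<inter> ball x (min r s)"
        using p pathstart_in_path_image[of p] by (auto simp: loops_at_def)
      then have "z \<in> X" "dist x z < s"
        by auto
      then have "\<exists>a. path_from_to (X \<inter> ball x r) x z a"
        using s(2) x by simp
      then obtain a where a: "path_from_to (X \<inter> ball x r) x z a" ..
      then have a': "path_from_to X x z a"
        by auto
      have p': "path_from_to (X \<inter> ball x r) z z p" "p \<in> loops_at X z"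
        using p by (auto simp: loops_at_def)
      have "path_from_to (X \<inter> ball x r) x x ((a +++ p) +++ reversepath a)"
        using path_from_to_join[OF path_from_to_join[OF a p'(1)] path_from_to_reverse[OF a]] .
      then have "homotopic_paths X ((a +++ p) +++ reversepath a) (\<lambda>_. x)"
        using r(2) by (auto simp: loops_at_def)
      then have "homotopic_paths X (reversepath a +++ ((\<lambda>_. x) +++ a)) p"
        by (rule homotopic_paths_conjugate_back[OF a' p'(2)])
      then have "homotopic_paths X p (reversepath a +++ ((\<lambda>_. x) +++ a))"
        by (rule homotopic_paths_sym)
      also have "homotopic_paths X \<dots> (reversepath a +++ a)"
        using a' by (intro homotopic_paths_join homotopic_paths_const_join) (auto simp: path_const)
      also have "homotopic_paths X \<dots> (\<lambda>_. z)"
        using a' by (intro homotopic_paths_left_inverse) auto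
      finally show ?thesis .
    qed
    then show ?thesis
      using r(1) s(1) by (intro exI[of _ "min r s"]) auto
  qed
  then have "\<forall>x\<in>X. \<exists>s>0. \<forall>z. \<forall>p\<in>loops_at (X \<inter> ball x s) z. homotopic_paths X p (\<lambda>_. z)"
    by blast
  from bchoice[OF this] obtain s where
    s: "\<forall>x\<in>X. s x > 0 \<and> (\<forall>z. \<forall>p\<in>loops_at (X \<inter> ball x (s x)) z. homotopic_paths X p (\<lambda>_. z))" ..
  obtain \<delta> where \<delta>: "\<delta> > 0" "\<forall>y\<in>X. \<exists>G\<in>(\<lambda>x. ball x (s x)) ` X. ball y \<delta> \<subseteq> G"
  proof (rule Heine_Borel_lemma[OF X(1), of "(\<lambda>x. ball x (s x)) ` X"])
    show "X \<subseteq> \<Union> ((\<lambda>x. ball x (s x)) ` X)"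
      using s by auto
  qed auto
  show thesis
  proof (rule that[OF \<delta>(1)], intro ballI allI)
    fix y z p
    assume "y \<in> X" and p: "p \<in> loops_at (X \<inter> ball y \<delta>) z"
    then obtain x where "x \<in> X" "ball y \<delta> \<subseteq> ball x (s x)"
      using \<delta>(2) by blast
    with p have "p \<in> loops_at (X \<inter> ball x (s x)) z"
      unfolding loops_at_def by blast
    then show "homotopic_paths X p (\<lambda>_. z)"
      using s \<open>x \<in> X\<close> by blast
  qed
qed

section \<open>Cocycles on an open cover\<close>

fun edge_word :: "('p, 'c) monoid_scheme \<Rightarrow> (nat \<Rightarrow> nat \<Rightarrow> 'p) \<Rightarrow> (nat \<Rightarrow> nat) \<Rightarrow> nat \<Rightarrow> 'p" where
  "edge_word P e \<iota> 0 = \<one>\<^bsub>P\<^esub>"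
| "edge_word P e \<iota> (Suc m) = edge_word P e \<iota> m \<otimes>\<^bsub>P\<^esub> e (\<iota> m) (\<iota> (Suc m))"

lemma edge_word_cong: "(\<And>k. k \<le> m \<Longrightarrow> \<iota> k = \<kappa> k) \<Longrightarrow> edge_word P e \<iota> m = edge_word P e \<kappa> m"
  by (induction m) auto

text \<open>The label \<open>\<iota> (Suc k)\<close> belongs to the segment \<open>[k/m, (k+1)/m]\<close>, the label \<open>\<iota> 0\<close> to the starting point.\<close>

definition path_labels :: "nat set \<Rightarrow> (nat \<Rightarrow> 'a set) \<Rightarrow> (real \<Rightarrow> 'a) \<Rightarrow> nat \<Rightarrow> (nat \<Rightarrow> nat) \<Rightarrow> bool" where
  "path_labels I U p m \<iota> \<longleftrightarrow> m > 0 \<and> p 0 \<in> U (\<iota> 0) \<and> (\<forall>k\<le>m. \<iota> k \<in> I) \<and>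
     (\<forall>k<m. \<forall>t. real k / real m \<le> t \<longrightarrow> t \<le> real (Suc k) / real m \<longrightarrow> p t \<in> U (\<iota> (Suc k)))"

lemma path_labelsD:
  assumes "path_labels I U p m \<iota>"
  shows "m > 0" "k \<le> m \<Longrightarrow> \<iota> k \<in> I" "p 0 \<in> U (\<iota> 0)"
    "k < m \<Longrightarrow> real k / real m \<le> t \<Longrightarrow> t \<le> real (Suc k) / real m \<Longrightarrow> p t \<in> U (\<iota> (Suc k))"
  using assms unfolding path_labels_def by blast+

lemma path_labels_start: 
  assumes "path_labels I U p m \<iota>" "k < m"
  shows "p (real k / real m) \<in> U (\<iota> (Suc k))"
  using assms by (intro path_labelsD(4)[OF assms]) (auto simp: divide_right_mono)

lemma path_labels_end: 
  assumes l: "path_labels I U p m \<iota>" and k: "k \<le> m"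
  shows "p (real k / real m) \<in> U (\<iota> k)"
proof (cases k)
  case 0
  then show ?thesis
    using path_labelsD(3)[OF l] by simp
next
  case (Suc j)
  then show ?thesis
    using k by (auto intro!: path_labelsD(4)[OF l, of j] simp: divide_right_mono)
qed

text \<open>Because label \<open>k > 0\<close> belongs to segment \<open>k - 1\<close>, it inherits
  the label of coarse segment \<open>(k - 1) div n\<close>, whose index is again shifted by
  one.\<close>

lemma path_labels_refine:
  assumes l: "path_labels I U p m \<iota>" and "n > 0"
  shows "path_labels I U p (m * n) (\<lambda>k. if k = 0 then \<iota> 0 else \<iota> (Suc ((k - 1) div n)))"
  unfolding path_labels_def
proof (intro conjI allI impI)
  have less: "k div n < m" if "k < m * n" for k
    using that by (simp add: less_mult_imp_div_less)
  show "(if k = 0 then \<iota> 0 else \<iota> (Suc ((k - 1) div n))) \<in> I" if "k \<le> m * n" for k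
  proof -
    have "Suc ((k - 1) div n) \<le> m" if "k \<noteq> 0"
    proof (rule Suc_leI, rule less)
      show "k - 1 < m * n"
        using that \<open>k \<le> m * n\<close> by linarith
    qed
    then show ?thesis
      using path_labelsD(2)[OF l, of 0] path_labelsD(2)[OF l, of "Suc ((k - 1) div n)"] by auto
  qed
  fix k t
  assume k: "k < m * n" and t: "real k / real (m * n) \<le> t" "t \<le> real (Suc k) / real (m * n)"
  define q where "q = k div n"
  have "q * n \<le> k"
    unfolding q_def by simp
  have "k = q * n + k mod n" "k mod n < n"
    unfolding q_def using \<open>n > 0\<close> by simp_all
  then have "Suc k \<le> Suc q * n"
    by simp
  have m: "m > 0"
    using path_labelsD(1)[OF l] .
  have "real q / real m \<le> real k / real (m * n)"
  proof -
    have "real q * real n \<le> real k"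
      using \<open>q * n \<le> k\<close> by (metis of_nat_le_iff of_nat_mult)
    then show ?thesis
      using m \<open>n > 0\<close> by (simp add: field_simps)
  qed
  moreover have "real (Suc k) / real (m * n) \<le> real (Suc q) / real m"
  proof -
    have "real (Suc k) \<le> real (Suc q) * real n"
      using \<open>Suc k \<le> Suc q * n\<close> by (metis of_nat_le_iff of_nat_mult)
    then have "real (Suc k) / real (m * n) \<le> real (Suc q) * real n / real (m * n)"
      by (rule divide_right_mono) simp
    also have "\<dots> = real (Suc q) / real m"
      using \<open>n > 0\<close> by simp
    finally show ?thesis .
  qed
  ultimately show "p t \<in> U (if Suc k = 0 then \<iota> 0 else \<iota> (Suc ((Suc k - 1) div n)))"
    using path_labelsD(4)[OF l, of q t] less[OF k] t by (simp add: q_def)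
qed (use assms path_labelsD[OF l] in auto)

text \<open>Joining gives each path half of the interval, so the numbers of segments must agree. The
  label \<open>\<kappa> 0\<close> of the junction is dropped.\<close>

lemma path_labels_join:
  assumes p: "path_labels I U p m \<iota>" and q: "path_labels I U q m \<kappa>" and "p 1 = q 0"
  shows "path_labels I U (p +++ q) (m + m) (\<lambda>k. if k \<le> m then \<iota> k else \<kappa> (k - m))"
  unfolding path_labels_def
proof (intro conjI allI impI)
  have m: "m > 0"
    using path_labelsD(1)[OF p] .
  show "0 < m + m"
    using m by simp
  show "(p +++ q) 0 \<in> U (if 0 \<le> m then \<iota> 0 else \<kappa> (0 - m))"
    using path_labelsD(3)[OF p] by (simp add: joinpaths_def)
  show "(if k \<le> m then \<iota> k else \<kappa> (k - m)) \<in> I" if "k \<le> m + m" for k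
    using that path_labelsD(2)[OF p, of k] path_labelsD(2)[OF q, of "k - m"] by auto
  fix k t
  assume k: "k < m + m" and t: "real k / real (m + m) \<le> t" "t \<le> real (Suc k) / real (m + m)"
  have t': "real k \<le> 2 * t * real m" "2 * t * real m \<le> real (Suc k)"
    using t m by (simp_all add: field_simps)
  show "(p +++ q) t \<in> U (if Suc k \<le> m then \<iota> (Suc k) else \<kappa> (Suc k - m))"
  proof (cases "k < m")
    case True
    have "2 * t * real m \<le> real m"
      using t'(2) True by linarith
    then have "t \<le> 1 / 2"
      using m by simp
    moreover have "p (2 * t) \<in> U (\<iota> (Suc k))"
      using t' m by (intro path_labelsD(4)[OF p True]) (simp_all add: field_simps)
    ultimately show ?thesis
      using True by (simp add: joinpaths_def)
  next
    case False
    define l where "l = k - m"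
    have l: "k = l + m" "l < m"
      using False k by (auto simp: l_def)
    have "real m \<le> real k"
      using l by simp
    then have "real m \<le> 2 * t * real m"
      using t'(1) by linarith
    then have "t \<ge> 1 / 2"
      using m by simp
    moreover have "q (2 * t - 1) \<in> U (\<kappa> (Suc l))"
      using t' m l by (intro path_labelsD(4)[OF q l(2)]) (simp_all add: field_simps)
    moreover have "(p +++ q) t = q (2 * t - 1)"
    proof (cases "t = 1 / 2")
      case True
      show ?thesis
        unfolding True joinpaths_def using \<open>p 1 = q 0\<close> by simp
    qed (use \<open>t \<ge> 1 / 2\<close> in \<open>simp add: joinpaths_def\<close>)
    ultimately show ?thesis
      using l by (simp add: Suc_diff_le)
  qed
qed

text \<open>A Lebesgue number \<epsilon> for the preimages of the cover in the square. With
  \<open>1 / m < \<epsilon> / 2\<close> in both directions, each cell lies in the \<epsilon>-ball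
  about its lower left corner.\<close>

lemma grid_labels:
  fixes H :: "real \<times> real \<Rightarrow> 'a::metric_space"
  assumes H: "continuous_on ({0..1} \<times> {0..1}) H" "H \<in> {0..1} \<times> {0..1} \<rightarrow> X"
    and op: "\<And>i. i \<in> I \<Longrightarrow> openin (top_of_set X) (U i)" and cover: "X \<subseteq> (\<Union>i\<in>I. U i)"
  obtains m \<kappa> where "m > 0" "\<And>l k. l < m \<Longrightarrow> k < m \<Longrightarrow> \<kappa> l k \<in> I"
    "\<And>l k s t. l < m \<Longrightarrow> k < m \<Longrightarrow> real l / real m \<le> s \<Longrightarrow> s \<le> real (Suc l) / real m \<Longrightarrow>
      real k / real m \<le> t \<Longrightarrow> t \<le> real (Suc k) / real m \<Longrightarrow> H (s, t) \<in> U (\<kappa> l k)"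
proof -
  let ?K = "{0..1::real} \<times> {0..1::real}"
  have "\<forall>i\<in>I. \<exists>W. open W \<and> ?K \<inter> H -` U i = ?K \<inter> W"
  proof
    fix i
    assume "i \<in> I"
    then have "openin (top_of_set ?K) (?K \<inter> H -` U i)"
      using H op by (intro continuous_openin_preimage) auto
    then show "\<exists>W. open W \<and> ?K \<inter> H -` U i = ?K \<inter> W"
      by (auto simp: openin_open)
  qed
  from bchoice[OF this] obtain W where W: "\<forall>i\<in>I. open (W i) \<and> ?K \<inter> H -` U i = ?K \<inter> W i" ..
  have "\<exists>i\<in>I. z \<in> W i" if z: "z \<in> ?K" for z
  proof -
    have "H z \<in> X"
      using H(2) z by blast
    then obtain i where "i \<in> I" "H z \<in> U i"
      using cover by blast
    then show ?thesis
      using W z by blast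
  qed
  then have "?K \<subseteq> \<Union>(W ` I)"
    by blast
  moreover have "compact ?K"
    by (intro compact_Times compact_Icc)
  ultimately obtain \<epsilon> where \<epsilon>: "\<epsilon> > 0" "\<forall>z\<in>?K. \<exists>G\<in>W ` I. ball z \<epsilon> \<subseteq> G"
    using W by (elim Heine_Borel_lemma) auto
  obtain n where n: "1 / real (Suc n) < \<epsilon> / 2"
    using \<epsilon>(1) reals_Archimedean[of "\<epsilon> / 2"] by (auto simp: inverse_eq_divide)
  define m where "m = Suc n"
  have m: "m > 0" "1 / real m < \<epsilon> / 2"
    using n by (simp_all add: m_def)
  have grid: "real k / real m \<in> {0..1}" "real (Suc k) / real m = real k / real m + 1 / real m"
    if "k < m" for k
    using that by (auto simp: add_divide_distrib)
  have grid_le: "real (Suc k) / real m \<le> 1" if "k < m" for k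
    using that by simp
  have "\<forall>lk\<in>{..<m} \<times> {..<m}. \<exists>i. i \<in> I \<and> ball (real (fst lk) / real m, real (snd lk) / real m) \<epsilon> \<subseteq> W i"
  proof
    fix lk
    assume "lk \<in> {..<m} \<times> {..<m}"
    then have "(real (fst lk) / real m, real (snd lk) / real m) \<in> ?K"
      using grid(1) by auto
    then show "\<exists>i. i \<in> I \<and> ball (real (fst lk) / real m, real (snd lk) / real m) \<epsilon> \<subseteq> W i"
      using \<epsilon>(2) by blast
  qed
  from bchoice[OF this] obtain \<kappa> where
    \<kappa>: "\<forall>lk\<in>{..<m} \<times> {..<m}. \<kappa> lk \<in> I \<and> ball (real (fst lk) / real m, real (snd lk) / real m) \<epsilon> \<subseteq> W (\<kappa> lk)" ..
  show thesis
  proof (rule that[of m "\<lambda>l k. \<kappa> (l, k)"])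
    show "m > 0"
      by fact
    fix l k
    assume lk: "l < m" "k < m"
    then have \<kappa>': "\<kappa> (l, k) \<in> I" "ball (real l / real m, real k / real m) \<epsilon> \<subseteq> W (\<kappa> (l, k))"
      using bspec[OF \<kappa>, of "(l, k)"] by auto
    then show "\<kappa> (l, k) \<in> I"
      by simp
    fix s t
    assume st: "real l / real m \<le> s" "s \<le> real (Suc l) / real m" "real k / real m \<le> t" "t \<le> real (Suc k) / real m"
    have "dist (real l / real m, real k / real m) (s, t) \<le> \<bar>real l / real m - s\<bar> + \<bar>real k / real m - t\<bar>"
      unfolding dist_Pair_Pair dist_real_def by (rule order_trans[OF sqrt_sum_squares_le_sum_abs]) simp
    also have "\<dots> < \<epsilon>"
      using st grid(2)[OF lk(1)] grid(2)[OF lk(2)] m(2) by linarith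
    finally have "(s, t) \<in> W (\<kappa> (l, k))"
      using \<kappa>'(2) by auto
    moreover have "(s, t) \<in> ?K"
      using st grid(1)[OF lk(1)] grid(1)[OF lk(2)] grid_le[OF lk(1)] grid_le[OF lk(2)]
      unfolding mem_Times_iff fst_conv snd_conv atLeastAtMost_iff by linarith
    ultimately show "H (s, t) \<in> U (\<kappa> (l, k))"
      using W \<kappa>'(1) by blast
  qed
qed

text \<open>A nonabelian Cech 1-cocycle on the cover; the value of a path will be its holonomy. The
  target group stays abstract because it is both the fundamental group and the presented
  group.\<close>

locale path_cocycle = group P for P (structure) +
  fixes X :: "'a::metric_space set" and I :: "nat set" and U :: "nat \<Rightarrow> 'a set" and e :: "nat \<Rightarrow> nat \<Rightarrow> 'p"
  assumes U_open: "\<And>i. i \<in> I \<Longrightarrow> openin (top_of_set X) (U i)"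
    and cover: "X \<subseteq> (\<Union>i\<in>I. U i)"
    and e_closed: "\<And>i j z. i \<in> I \<Longrightarrow> j \<in> I \<Longrightarrow> z \<in> U i \<Longrightarrow> z \<in> U j \<Longrightarrow> e i j \<in> carrier P"
    and cocycle: "\<And>i j k z. i \<in> I \<Longrightarrow> j \<in> I \<Longrightarrow> k \<in> I \<Longrightarrow> z \<in> U i \<Longrightarrow> z \<in> U j \<Longrightarrow> z \<in> U k \<Longrightarrow>
      e i j \<otimes> e j k = e i k"
begin

abbreviation labels where "labels \<equiv> path_labels I U"
abbreviation word where "word \<equiv> edge_word P e"

lemma e_refl: "i \<in> I \<Longrightarrow> z \<in> U i \<Longrightarrow> e i i = \<one>"
  using cocycle[of i i i z] e_closed[of i i z] by simp

lemma word_closed: "labels p m \<iota> \<Longrightarrow> k \<le> m \<Longrightarrow> word \<iota> k \<in> carrier P"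
proof (induction k)
  case (Suc k)
  then have "e (\<iota> k) (\<iota> (Suc k)) \<in> carrier P"
    by (intro e_closed[of _ _ "p (real k / real m)"])
      (auto intro: path_labelsD(2) path_labels_start path_labels_end)
  with Suc show ?case
    by simp
qed simp

text \<open>The two words differ by one transition between the current labels. Along a coarse
  segment, its label and two successive fine labels share a point; at a coarse breakpoint, two
  coarse labels and one fine label do. In each case the cocycle identity absorbs the change.\<close>

lemma word_refine:
  assumes \<iota>: "labels p m \<iota>" and \<kappa>: "labels p (m * n) \<kappa>" and "\<iota> 0 = \<kappa> 0" and "j \<le> m"
  shows "word \<iota> j \<otimes> e (\<iota> j) (\<kappa> (j * n)) = word \<kappa> (j * n)"
  using \<open>j \<le> m\<close>
proof (induction j)
  case 0
  then show ?case
    using e_refl[OF path_labelsD(2)[OF \<kappa>, of 0] path_labelsD(3)[OF \<kappa>]] \<open>\<iota> 0 = \<kappa> 0\<close> by simp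
next
  case (Suc j)
  have mn: "m > 0" "n > 0"
    using path_labelsD(1)[OF \<kappa>] by auto
  have "word \<iota> (Suc j) \<otimes> e (\<iota> (Suc j)) (\<kappa> (j * n + l)) = word \<kappa> (j * n + l)" if "l \<le> n" for l
    using that
  proof (induction l)
    case 0
    let ?z = "p (real j / real m)"
    have "j * n \<le> m * n"
      using Suc.prems by simp
    moreover have "real (j * n) / real (m * n) = real j / real m"
      using mn by simp
    ultimately have "?z \<in> U (\<kappa> (j * n))" "\<kappa> (j * n) \<in> I"
      using path_labels_end[OF \<kappa>, of "j * n"] path_labelsD(2)[OF \<kappa>] by auto
    moreover have "?z \<in> U (\<iota> j)" "?z \<in> U (\<iota> (Suc j))" "\<iota> j \<in> I" "\<iota> (Suc j) \<in> I"
      using Suc.prems by (auto intro: path_labelsD(2)[OF \<iota>] path_labels_start[OF \<iota>] path_labels_end[OF \<iota>])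
    moreover have "word \<iota> j \<in> carrier P"
      using word_closed[OF \<iota>] Suc.prems by simp
    ultimately have "word \<iota> (Suc j) \<otimes> e (\<iota> (Suc j)) (\<kappa> (j * n)) = word \<iota> j \<otimes> e (\<iota> j) (\<kappa> (j * n))"
      using cocycle[of "\<iota> j" "\<iota> (Suc j)" "\<kappa> (j * n)" ?z] e_closed[of _ _ ?z] by (simp add: m_assoc)
    then show ?case
      using Suc.IH Suc.prems by simp
  next
    case (Suc l)
    let ?z = "p (real (j * n + l) / real (m * n))"
    have "j * n + n \<le> m * n"
      using mult_le_mono1[OF \<open>Suc j \<le> m\<close>, of n] by simp
    then have less: "j * n + l < m * n"
      using Suc.prems by linarith
    have "?z \<in> U (\<iota> (Suc j))"
    proof (rule path_labelsD(4)[OF \<iota>])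
      show "j < m"
        using \<open>Suc j \<le> m\<close> by simp
      have "real j * real n \<le> real (j * n + l)" "real (j * n + l) \<le> real (Suc j) * real n"
        using Suc.prems by (simp_all add: algebra_simps)
      then have "real j * real n / real (m * n) \<le> real (j * n + l) / real (m * n)"
        "real (j * n + l) / real (m * n) \<le> real (Suc j) * real n / real (m * n)"
        by (intro divide_right_mono; simp)+
      then show "real j / real m \<le> real (j * n + l) / real (m * n)"
        "real (j * n + l) / real (m * n) \<le> real (Suc j) / real m"
        using mn by simp_all
    qed
    moreover have "?z \<in> U (\<kappa> (j * n + l))" "?z \<in> U (\<kappa> (Suc (j * n + l)))"
      using less by (auto intro: path_labels_start[OF \<kappa>] path_labels_end[OF \<kappa>] simp del: of_nat_add of_nat_mult)
    moreover have "\<iota> (Suc j) \<in> I" "\<kappa> (j * n + l) \<in> I" "\<kappa> (Suc (j * n + l)) \<in> I"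
      using less \<open>Suc j \<le> m\<close> by (auto intro: path_labelsD(2)[OF \<iota>] path_labelsD(2)[OF \<kappa>])
    moreover have "word \<iota> (Suc j) \<in> carrier P"
      using word_closed[OF \<iota> \<open>Suc j \<le> m\<close>] .
    ultimately have "word \<iota> (Suc j) \<otimes> e (\<iota> (Suc j)) (\<kappa> (Suc (j * n + l))) =
        word \<iota> (Suc j) \<otimes> e (\<iota> (Suc j)) (\<kappa> (j * n + l)) \<otimes> e (\<kappa> (j * n + l)) (\<kappa> (Suc (j * n + l)))"
      using cocycle[of "\<iota> (Suc j)" "\<kappa> (j * n + l)" "\<kappa> (Suc (j * n + l))" ?z] e_closed[of _ _ ?z]
      by (simp add: m_assoc del: edge_word.simps)
    also have "\<dots> = word \<kappa> (Suc (j * n + l))"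
      using Suc.IH Suc.prems by simp
    finally show ?case
      by simp
  qed
  from this[of n] show ?case
    by (simp add: add.commute)
qed

text \<open>A relation, since subdivision and labels are chosen; it proves to be single-valued. The
  final transition to \<open>b\<close> makes the value depend on the prescribed end label instead of
  the label of the last segment.\<close>

definition val :: "(real \<Rightarrow> 'a) \<Rightarrow> nat \<Rightarrow> nat \<Rightarrow> 'p \<Rightarrow> bool" where
  "val p a b g \<longleftrightarrow> (\<exists>m \<iota>. labels p m \<iota> \<and> \<iota> 0 = a \<and> b \<in> I \<and> p 1 \<in> U b \<and> g = word \<iota> m \<otimes> e (\<iota> m) b)"

lemma labels_end: "labels p m \<iota> \<Longrightarrow> p 1 \<in> U (\<iota> m) \<and> \<iota> m \<in> I"
  using path_labels_end[of I U p m \<iota> m] path_labelsD(1,2)[of I U p m \<iota>] by auto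

lemma val_refine:
  assumes \<iota>: "labels p m \<iota>" and \<kappa>: "labels p (m * n) \<kappa>" and "\<iota> 0 = \<kappa> 0" and b: "b \<in> I" "p 1 \<in> U b"
  shows "word \<iota> m \<otimes> e (\<iota> m) b = word \<kappa> (m * n) \<otimes> e (\<kappa> (m * n)) b"
proof -
  let ?z = "p 1" and ?k = "\<kappa> (m * n)"
  have mem: "\<iota> m \<in> I" "?z \<in> U (\<iota> m)" "?k \<in> I" "?z \<in> U ?k"
    using labels_end[OF \<iota>] labels_end[OF \<kappa>] by auto
  have "word \<iota> m \<otimes> e (\<iota> m) b = word \<iota> m \<otimes> (e (\<iota> m) ?k \<otimes> e ?k b)"
    using cocycle[OF mem(1,3) b(1) mem(2,4) b(2)] by simp
  also have "\<dots> = word \<iota> m \<otimes> e (\<iota> m) ?k \<otimes> e ?k b"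
    using word_closed[OF \<iota>, of m] e_closed[OF mem(1,3,2,4)] e_closed[OF mem(3) b(1) mem(4) b(2)]
    by (simp add: m_assoc)
  also have "word \<iota> m \<otimes> e (\<iota> m) ?k = word \<kappa> (m * n)"
    by (rule word_refine[OF assms(1-3)]) simp
  finally show ?thesis .
qed

lemma val_unique:
  assumes "val p a b g" "val p a b h"
  shows "g = h"
proof -
  obtain m \<iota> where \<iota>: "labels p m \<iota>" "\<iota> 0 = a" "b \<in> I" "p 1 \<in> U b" "g = word \<iota> m \<otimes> e (\<iota> m) b"
    using assms(1) unfolding val_def by blast
  obtain n \<kappa> where \<kappa>: "labels p n \<kappa>" "\<kappa> 0 = a" "h = word \<kappa> n \<otimes> e (\<kappa> n) b"
    using assms(2) unfolding val_def by blast
  \<comment> \<open>A common refinement: \<rho> labels \<open>m * n\<close> segments, a subdivision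
    finer than both, and each given labelling is compared with it.\<close>
  define \<rho> where "\<rho> = (\<lambda>k. if k = 0 then \<iota> 0 else \<iota> (Suc ((k - 1) div n)))"
  have \<rho>: "labels p (m * n) \<rho>" "\<rho> 0 = a"
    unfolding \<rho>_def using path_labels_refine[OF \<iota>(1) path_labelsD(1)[OF \<kappa>(1)]] \<iota>(2) by simp_all
  then have "labels p (n * m) \<rho>"
    by (simp add: mult.commute)
  then show ?thesis
    using val_refine[OF \<iota>(1) \<rho>(1)] val_refine[OF \<kappa>(1), of m \<rho>] \<rho>(2) \<iota> \<kappa> by (simp add: mult.commute)
qed

lemma val_closed: "val p a b g \<Longrightarrow> g \<in> carrier P"
  unfolding val_def using word_closed labels_end e_closed by blast

lemma val_cong:
  assumes "val p a b g" "\<And>t. t \<in> {0..1} \<Longrightarrow> p t = q t"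
  shows "val q a b g"
proof -
  obtain m \<iota> where \<iota>: "labels p m \<iota>" "\<iota> 0 = a" "b \<in> I" "p 1 \<in> U b" "g = word \<iota> m \<otimes> e (\<iota> m) b"
    using assms(1) unfolding val_def by blast
  have "labels q m \<iota>"
    unfolding path_labels_def
  proof (intro conjI allI impI)
    fix k t
    assume k: "k < m" and t: "real k / real m \<le> t" "t \<le> real (Suc k) / real m"
    have "0 \<le> real k / real m" "real (Suc k) / real m \<le> 1"
      using k by auto
    with t have "t \<in> {0..1}"
      unfolding atLeastAtMost_iff by linarith
    then show "q t \<in> U (\<iota> (Suc k))"
      using path_labelsD(4)[OF \<iota>(1) k t] assms(2) by simp
  qed (use path_labelsD[OF \<iota>(1)] assms(2)[of 0] in auto)
  then show ?thesis
    using \<iota> assms(2)[of 1] unfolding val_def by auto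
qed

lemma labels_exist:
  assumes "path p" "path_image p \<subseteq> X" "a \<in> I" "p 0 \<in> U a"
  shows "\<exists>m \<iota>. labels p m \<iota> \<and> \<iota> 0 = a"
proof -
  \<comment> \<open>The path is viewed as a homotopy constant in the first variable, and one row of
    the grid is read off.\<close>
  have "continuous_on ({0..1} \<times> {0..1}) (\<lambda>z::real \<times> real. p (snd z))"
    using assms(1) unfolding path_def
    by (rule continuous_on_compose2) (auto intro!: continuous_intros)
  moreover have "(\<lambda>z::real \<times> real. p (snd z)) \<in> {0..1} \<times> {0..1} \<rightarrow> X"
    using assms(2) by (auto simp: path_image_def)
  ultimately obtain m \<kappa> where \<kappa>: "m > 0" "\<And>l k. l < m \<Longrightarrow> k < m \<Longrightarrow> \<kappa> l k \<in> I"
    "\<And>l k s t. l < m \<Longrightarrow> k < m \<Longrightarrow> real l / real m \<le> s \<Longrightarrow> s \<le> real (Suc l) / real m \<Longrightarrow>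
      real k / real m \<le> t \<Longrightarrow> t \<le> real (Suc k) / real m \<Longrightarrow> p (snd (s, t)) \<in> U (\<kappa> l k)"
    by (rule grid_labels[of "\<lambda>z. p (snd z)" X I U]) (use U_open cover in auto)
  have "labels p m (\<lambda>k. if k = 0 then a else \<kappa> 0 (k - 1))"
    unfolding path_labels_def
  proof (intro conjI allI impI)
    fix k t
    assume "k < m" "real k / real m \<le> t" "t \<le> real (Suc k) / real m"
    then show "p t \<in> U (if Suc k = 0 then a else \<kappa> 0 (Suc k - 1))"
      using \<kappa>(3)[of 0 k 0 t] \<kappa>(1) by simp
  qed (use assms \<kappa>(1,2) in auto)
  then show ?thesis
    by (intro exI[of _ m] exI[of _ "\<lambda>k. if k = 0 then a else \<kappa> 0 (k - 1)"]) simp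
qed

lemma val_exists:
  assumes "path p" "path_image p \<subseteq> X" "a \<in> I" "b \<in> I" "p 0 \<in> U a" "p 1 \<in> U b"
  shows "\<exists>g. val p a b g"
  using labels_exist[OF assms(1,2,3,5)] assms(4,6) unfolding val_def by blast

text \<open>One row of the grid labels both paths bounding it by the same word. Each intermediate
  path bounds two rows, so uniqueness of its value carries \<open>g\<close> across the
  square.\<close>

lemma val_homotopic:
  assumes hom: "homotopic_paths X p q" and g: "val p a b g"
  shows "val q a b g"
proof -
  obtain H where H: "continuous_on ({0..1} \<times> {0..1}) H" "H \<in> {0..1} \<times> {0..1} \<rightarrow> X"
    "\<forall>t\<in>{0..1}. H (0, t) = p t" "\<forall>t\<in>{0..1}. H (1, t) = q t"
    "\<forall>t\<in>{0..1::real}. pathstart (H \<circ> Pair t) = pathstart p \<and> pathfinish (H \<circ> Pair t) = pathfinish p"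
    using hom unfolding homotopic_paths by blast
  have ab: "a \<in> I" "p 0 \<in> U a" "b \<in> I" "p 1 \<in> U b"
    using g path_labelsD(2)[of I U p _ _ 0] path_labelsD(3)[of I U p] unfolding val_def by auto
  obtain m \<kappa> where \<kappa>: "m > 0" "\<And>l k. l < m \<Longrightarrow> k < m \<Longrightarrow> \<kappa> l k \<in> I"
    "\<And>l k s t. l < m \<Longrightarrow> k < m \<Longrightarrow> real l / real m \<le> s \<Longrightarrow> s \<le> real (Suc l) / real m \<Longrightarrow>
      real k / real m \<le> t \<Longrightarrow> t \<le> real (Suc k) / real m \<Longrightarrow> H (s, t) \<in> U (\<kappa> l k)"
    using grid_labels[OF H(1,2) U_open cover] by metis
  \<comment> \<open>All intermediate paths start at \<open>p 0\<close>, so \<open>a\<close> can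
    serve as the start label in every row.\<close>
  define \<rho> where "\<rho> l = (\<lambda>k. if k = 0 then a else \<kappa> l (k - 1))" for l
  have row: "val (H \<circ> Pair s) a b (word (\<rho> l) m \<otimes> e (\<rho> l m) b)"
    if l: "l < m" and s: "real l / real m \<le> s" "s \<le> real (Suc l) / real m" for l s
  proof -
    have "0 \<le> real l / real m" "real (Suc l) / real m \<le> 1"
      using l by auto
    with s have "s \<in> {0..1}"
      unfolding atLeastAtMost_iff by linarith
    then have ends: "H (s, 0) = p 0" "H (s, 1) = p 1"
      using H(5) by (auto simp: pathstart_def pathfinish_def)
    have "labels (H \<circ> Pair s) m (\<rho> l)"
      unfolding path_labels_def
    proof (intro conjI allI impI)
      fix k t
      assume "k < m" "real k / real m \<le> t" "t \<le> real (Suc k) / real m"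
      then show "(H \<circ> Pair s) t \<in> U (\<rho> l (Suc k))"
        using \<kappa>(3)[of l k s t] l s by (simp add: \<rho>_def)
    qed (use ab \<kappa>(1,2) ends l in \<open>auto simp: \<rho>_def\<close>)
    then show ?thesis
      unfolding val_def using ends ab by (intro exI[of _ m] exI[of _ "\<rho> l"]) (simp add: \<rho>_def)
  qed
  have "val (H \<circ> Pair (real l / real m)) a b g" if "l \<le> m" for l
    using that
  proof (induction l)
    case 0
    show ?case
      by (rule val_cong[OF g]) (use H(3) in simp)
  next
    case (Suc l)
    have "val (H \<circ> Pair (real l / real m)) a b (word (\<rho> l) m \<otimes> e (\<rho> l m) b)"
      "val (H \<circ> Pair (real (Suc l) / real m)) a b (word (\<rho> l) m \<otimes> e (\<rho> l m) b)"
      using Suc.prems by (intro row; simp add: divide_right_mono)+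
    then show ?case
      using Suc val_unique by (metis Suc_leD)
  qed
  from this[of m] have "val (H \<circ> Pair 1) a b g"
    using \<kappa>(1) by simp
  then show ?thesis
    by (rule val_cong) (use H(4) in simp)
qed

text \<open>The joined labelling passes directly from \<open>\<iota> m\<close> to
  \<open>\<kappa> 1\<close>; the cocycle identity at the junction inserts \<open>\<kappa> 0\<close>.
  Hence the induction begins after one segment of \<open>q\<close>.\<close>

lemma word_append:
  assumes \<iota>: "labels p m \<iota>" and \<kappa>: "labels q n \<kappa>" and "p 1 = q 0" and "k < n"
  shows "word (\<lambda>i. if i \<le> m then \<iota> i else \<kappa> (i - m)) (m + Suc k) = word \<iota> m \<otimes> e (\<iota> m) (\<kappa> 0) \<otimes> word \<kappa> (Suc k)"
  using \<open>k < n\<close>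
proof (induction k)
  case 0
  have "word (\<lambda>i. if i \<le> m then \<iota> i else \<kappa> (i - m)) m = word \<iota> m"
    by (rule edge_word_cong) simp
  moreover have "q 0 \<in> U (\<kappa> 0)" "q 0 \<in> U (\<kappa> (Suc 0))" "q 0 \<in> U (\<iota> m)" "\<iota> m \<in> I" "\<kappa> 0 \<in> I" "\<kappa> (Suc 0) \<in> I"
    using labels_end[OF \<iota>] path_labels_start[OF \<kappa>, of 0] path_labelsD(2,3)[OF \<kappa>] 0 \<open>p 1 = q 0\<close> by auto
  moreover have "word \<iota> m \<in> carrier P"
    using word_closed[OF \<iota>, of m] by simp
  ultimately show ?case
    using cocycle[of "\<iota> m" "\<kappa> 0" "\<kappa> (Suc 0)" "q 0"] e_closed[of _ _ "q 0"] by (simp add: m_assoc)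
next
  case (Suc k)
  have "q (real (Suc k) / real n) \<in> U (\<kappa> (Suc k))" "q (real (Suc k) / real n) \<in> U (\<kappa> (Suc (Suc k)))"
    using Suc.prems by (auto intro: path_labels_start[OF \<kappa>] path_labels_end[OF \<kappa>] simp del: of_nat_Suc)
  then have "e (\<kappa> (Suc k)) (\<kappa> (Suc (Suc k))) \<in> carrier P"
    using path_labelsD(2)[OF \<kappa>] Suc.prems by (intro e_closed) auto
  moreover have "word \<iota> m \<in> carrier P" "word \<kappa> (Suc k) \<in> carrier P"
    using word_closed[OF \<iota>, of m] word_closed[OF \<kappa>, of "Suc k"] Suc.prems by auto
  moreover have "e (\<iota> m) (\<kappa> 0) \<in> carrier P"
    using labels_end[OF \<iota>] path_labelsD(2,3)[OF \<kappa>] \<open>p 1 = q 0\<close> by (intro e_closed[of _ _ "q 0"]) auto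
  moreover have "word (\<lambda>i. if i \<le> m then \<iota> i else \<kappa> (i - m)) (m + Suc (Suc k)) =
    word (\<lambda>i. if i \<le> m then \<iota> i else \<kappa> (i - m)) (m + Suc k) \<otimes> e (\<kappa> (Suc k)) (\<kappa> (Suc (Suc k)))"
    by simp
  moreover have "word \<kappa> (Suc (Suc k)) = word \<kappa> (Suc k) \<otimes> e (\<kappa> (Suc k)) (\<kappa> (Suc (Suc k)))"
    by simp
  ultimately show ?case
    using Suc by (simp add: m_assoc del: edge_word.simps)
qed

lemma val_join:
  assumes p: "val p a b g" and q: "val q b c h" and "p 1 = q 0"
  shows "val (p +++ q) a c (g \<otimes> h)"
proof -
  obtain m \<iota> where \<iota>: "labels p m \<iota>" "\<iota> 0 = a" "b \<in> I" "p 1 \<in> U b" "g = word \<iota> m \<otimes> e (\<iota> m) b"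
    using p unfolding val_def by blast
  obtain n \<kappa> where \<kappa>: "labels q n \<kappa>" "\<kappa> 0 = b" "c \<in> I" "q 1 \<in> U c" "h = word \<kappa> n \<otimes> e (\<kappa> n) c"
    using q unfolding val_def by blast
  \<comment> \<open>Both labellings are refined to the same number of segments, as joining
    requires.\<close>
  define M where "M = m * n"
  define \<iota>' where "\<iota>' = (\<lambda>k. if k = 0 then \<iota> 0 else \<iota> (Suc ((k - 1) div n)))"
  define \<kappa>' where "\<kappa>' = (\<lambda>k. if k = 0 then \<kappa> 0 else \<kappa> (Suc ((k - 1) div m)))"
  have \<iota>': "labels p M \<iota>'" "\<iota>' 0 = a"
    unfolding M_def \<iota>'_def using path_labels_refine[OF \<iota>(1) path_labelsD(1)[OF \<kappa>(1)]] \<iota>(2) by auto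
  have "labels q (n * m) \<kappa>'" "\<kappa>' 0 = b"
    unfolding \<kappa>'_def using path_labels_refine[OF \<kappa>(1) path_labelsD(1)[OF \<iota>(1)]] \<kappa>(2) by auto
  then have \<kappa>': "labels q M \<kappa>'" "\<kappa>' 0 = b" and h: "h = word \<kappa>' M \<otimes> e (\<kappa>' M) c"
    using val_refine[OF \<kappa>(1), of m \<kappa>' c] \<kappa> by (auto simp: M_def mult.commute)
  have g: "g = word \<iota>' M \<otimes> e (\<iota>' M) (\<kappa>' 0)"
    using val_refine[OF \<iota>(1), of n \<iota>' b] \<iota> \<iota>' \<kappa>' by (auto simp: M_def)
  have "M > 0"
    using path_labelsD(1)[OF \<iota>'(1)] .
  let ?\<rho> = "\<lambda>k. if k \<le> M then \<iota>' k else \<kappa>' (k - M)"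
  have "word ?\<rho> (M + M) = g \<otimes> word \<kappa>' M"
    using word_append[OF \<iota>'(1) \<kappa>'(1) \<open>p 1 = q 0\<close>, of "M - 1"] \<open>M > 0\<close> by (simp add: g del: edge_word.simps)
  moreover have "word \<kappa>' M \<in> carrier P" "e (\<kappa>' M) c \<in> carrier P"
    using word_closed[OF \<kappa>'(1), of M] labels_end[OF \<kappa>'(1)] \<kappa>(3,4) by (auto intro: e_closed)
  ultimately have "g \<otimes> h = word ?\<rho> (M + M) \<otimes> e (?\<rho> (M + M)) c"
    using val_closed[OF p] \<open>M > 0\<close> by (simp add: h m_assoc)
  moreover have "(p +++ q) 1 = q 1"
    by (simp add: joinpaths_def)
  ultimately show ?thesis
    unfolding val_def using path_labels_join[OF \<iota>'(1) \<kappa>'(1) \<open>p 1 = q 0\<close>] \<iota>'(2) \<kappa>(3,4)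
    by (intro exI[of _ "M + M"] exI[of _ ?\<rho>]) auto
qed

lemma val_inside:
  assumes "a \<in> I" "path_image p \<subseteq> U a"
  shows "val p a a \<one>"
proof -
  have p: "p t \<in> U a" if "0 \<le> t" "t \<le> 1" for t
    using assms(2) that by (auto simp: path_image_def)
  then have "labels p 1 (\<lambda>_. a)"
    using assms(1) by (auto simp: path_labels_def)
  moreover have "e a a = \<one>"
    using e_refl[OF assms(1) p[of 0]] by simp
  ultimately show ?thesis
    unfolding val_def using assms(1) p[of 1] by (intro exI[of _ 1] exI[of _ "\<lambda>_. a"]) simp
qed

lemma val_relabel_end:
  assumes "val p a b g" "c \<in> I" "p 1 \<in> U c"
  shows "val p a c (g \<otimes> e b c)"
proof -
  obtain m \<iota> where \<iota>: "labels p m \<iota>" "\<iota> 0 = a" "b \<in> I" "p 1 \<in> U b" "g = word \<iota> m \<otimes> e (\<iota> m) b"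
    using assms(1) unfolding val_def by blast
  have "g \<otimes> e b c = word \<iota> m \<otimes> e (\<iota> m) c"
    using cocycle[of "\<iota> m" b c "p 1"] labels_end[OF \<iota>(1)] \<iota> assms(2,3) e_closed[of _ _ "p 1"] word_closed[OF \<iota>(1), of m]
    by (simp add: m_assoc)
  then show ?thesis
    unfolding val_def using \<iota> assms(2,3) by blast
qed

end

section \<open>Presentations and generators from a cover\<close>

definition word_eval :: "('g, 'c) monoid_scheme \<Rightarrow> ('a \<Rightarrow> 'g) \<Rightarrow> 'a letter list \<Rightarrow> 'g" where
  "word_eval G f w =
     foldr (\<lambda>l y. (if snd l then f (fst l) else inv\<^bsub>G\<^esub> f (fst l)) \<otimes>\<^bsub>G\<^esub> y) w \<one>\<^bsub>G\<^esub>"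

lemma word_eval_simps:
  "word_eval G f [] = \<one>\<^bsub>G\<^esub>"
  "word_eval G f (l # w) = (if snd l then f (fst l) else inv\<^bsub>G\<^esub> f (fst l)) \<otimes>\<^bsub>G\<^esub> word_eval G f w"
  by (simp_all add: word_eval_def)

context
  fixes G (structure) and A :: "'a set" and f :: "'a \<Rightarrow> 'g"
  assumes group_G: "group G" and f_closed: "f \<in> A \<rightarrow> carrier G"
begin

interpretation group G
  by (rule group_G)

lemma word_eval_closed: "fst ` set w \<subseteq> A \<Longrightarrow> word_eval G f w \<in> carrier G"
  using f_closed by (induction w) (auto simp: word_eval_simps)

lemma word_eval_push_letter:
  assumes "fst k \<in> A" "fst ` set w \<subseteq> A"
  shows "word_eval G f (push_letter k w) = word_eval G f [k] \<otimes> word_eval G f w"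
proof (cases w)
  case Nil
  then show ?thesis
    using word_eval_closed[of "[k]"] assms by (simp add: word_eval_simps)
next
  case (Cons l v)
  have fk: "f (fst k) \<in> carrier G"
    using f_closed assms by blast
  have v: "word_eval G f v \<in> carrier G"
    using word_eval_closed assms Cons by simp
  show ?thesis
  proof (cases "l = inv_letter k")
    case True
    then show ?thesis
      using Cons fk v m_assoc[of "f (fst k)" "inv f (fst k)" "word_eval G f v"]
        m_assoc[of "inv f (fst k)" "f (fst k)" "word_eval G f v"]
      by (auto simp: word_eval_simps inv_letter_def)
  next
    case False
    have "f (fst l) \<in> carrier G"
      using f_closed assms Cons by auto
    with False show ?thesis
      using Cons fk v by (auto simp: word_eval_simps)
  qed
qed

lemma word_eval_foldr_push:
  assumes "fst ` set u \<subseteq> A" "fst ` set w \<subseteq> A"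
  shows "word_eval G f (foldr push_letter u w) = word_eval G f u \<otimes> word_eval G f w"
  using assms(1)
proof (induction u)
  case Nil
  then show ?case
    using word_eval_closed[OF assms(2)] by (simp add: word_eval_simps)
next
  case (Cons k u)
  have "fst ` set (foldr push_letter u w) \<subseteq> A"
    using Cons.prems assms(2) set_foldr_push[of u w] by fastforce
  then have "word_eval G f (foldr push_letter (k # u) w) = word_eval G f [k] \<otimes> (word_eval G f u \<otimes> word_eval G f w)"
    using Cons by (simp add: word_eval_push_letter)
  moreover have "word_eval G f (k # u) = word_eval G f [k] \<otimes> word_eval G f u"
    using Cons.prems funcset_mem[OF f_closed, of "fst k"] word_eval_closed[of u] by (simp add: word_eval_simps)
  ultimately show ?case
    using word_eval_closed[of "[k]"] word_eval_closed[of u] word_eval_closed[OF assms(2)] Cons.prems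
    by (simp add: m_assoc)
qed

lemma word_eval_hom: "word_eval G f \<in> hom (free_group A) G"
  by (auto simp: hom_def free_group_def word_eval_foldr_push word_eval_closed)

lemma word_eval_generator: "a \<in> A \<Longrightarrow> word_eval G f [(a, True)] = f a"
  using funcset_mem[OF f_closed] by (simp add: word_eval_simps)

end

lemma generator_closed: "a \<in> A \<Longrightarrow> [(a, True)] \<in> carrier (free_group A)"
  by (simp add: free_group_def)

text \<open>A reduced word is the product of its letters, as pushing a letter onto its remainder
  cancels nothing, and a negative letter is the inverse of a generator.\<close>

lemma free_group_hom_eqI:
  assumes "group H" and h: "h \<in> hom (free_group A) H" "k \<in> hom (free_group A) H"
    and gen: "\<And>a. a \<in> A \<Longrightarrow> h [(a, True)] = k [(a, True)]"
    and "w \<in> carrier (free_group A)"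
  shows "h w = k w"
proof -
  interpret F: group "free_group A"
    by (rule group_free_group)
  interpret H: group H
    by fact
  interpret h: group_hom "free_group A" H h
    by unfold_locales (rule h)
  interpret k: group_hom "free_group A" H k
    by unfold_locales (rule h)
  from assms(5) show ?thesis
  proof (induction w)
    case Nil
    show ?case
      using h.hom_one k.hom_one by (simp add: free_group_def)
  next
    case (Cons l w)
    have w: "w \<in> carrier (free_group A)" and l: "fst l \<in> A"
      using Cons.prems reduced_tl[of l w] by (auto simp: free_group_def)
    have lF: "[l] \<in> carrier (free_group A)"
      using l by (simp add: free_group_def)
    have eq: "l # w = [l] \<otimes>\<^bsub>free_group A\<^esub> w"
      using Cons.prems push_letter_reduced[of l w] by (simp add: free_group_def)
    have "h [l] = k [l]"
    proof (cases "snd l")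
      case True
      then show ?thesis
        using gen[OF l] by (metis prod.collapse)
    next
      case False
      have "[l] \<otimes>\<^bsub>free_group A\<^esub> [(fst l, True)] = \<one>\<^bsub>free_group A\<^esub>"
        using False by (simp add: free_group_def inv_letter_def)
      then have "[l] = inv\<^bsub>free_group A\<^esub> [(fst l, True)]"
        using F.inv_equality[OF _ generator_closed[OF l] lF] by simp
      then show ?thesis
        using gen[OF l] generator_closed[OF l] by simp
    qed
    then show ?case
      unfolding eq using w lF Cons.IH by simp
  qed
qed

text \<open>The kernel of \<phi> is not computed. Agreement on generators makes \<psi> after \<phi>
  the quotient map, so \<psi> is surjective; and if \<psi> kills \<open>\<phi> w\<close>, then
  \<open>w\<close> lies in the normal closure, which \<phi> kills.\<close>

lemma finitely_presentedI:
  fixes G :: "('g, 'c) monoid_scheme" and A :: "nat set"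
  assumes "group G" and A: "finite A" and R: "finite R" "R \<subseteq> carrier (free_group A)"
    and \<phi>: "\<phi> \<in> hom (free_group A) G" "carrier G \<subseteq> \<phi> ` carrier (free_group A)" "\<And>r. r \<in> R \<Longrightarrow> \<phi> r = \<one>\<^bsub>G\<^esub>"
    and \<psi>: "\<psi> \<in> hom G (presented_group A R)"
    and gen: "\<And>a. a \<in> A \<Longrightarrow>
      \<psi> (\<phi> [(a, True)]) = normal_closure (free_group A) R #>\<^bsub>free_group A\<^esub> [(a, True)]"
  shows "finitely_presented G"
proof -
  let ?F = "free_group A" and ?P = "presented_group A R"
  let ?N = "normal_closure ?F R"
  interpret F: group ?F
    by (rule group_free_group)
  interpret G: group G
    by fact
  interpret N: normal ?N ?F
    by (rule normal_normal_closure[OF group_free_group R(2)])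
  interpret P: group ?P
    by (rule group_presented_group[OF R(2)])
  interpret \<phi>: group_hom ?F G \<phi>
    by unfold_locales (rule \<phi>)
  interpret \<psi>: group_hom G ?P \<psi>
    by unfold_locales (rule \<psi>)
  have \<psi>\<phi>: "\<psi> (\<phi> w) = ?N #>\<^bsub>?F\<^esub> w" if "w \<in> carrier ?F" for w
  proof (rule free_group_hom_eqI[OF _ _ _ _ that])
    show "group ?P"
      by (rule P.is_group)
    show "(\<lambda>w. \<psi> (\<phi> w)) \<in> hom ?F ?P"
      using Group.hom_compose[OF \<phi>(1) \<psi>] by (simp add: comp_def)
    show "(\<lambda>w. ?N #>\<^bsub>?F\<^esub> w) \<in> hom ?F ?P"
      unfolding presented_group_def by (rule N.r_coset_hom_Mod)
  qed (rule gen)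
  have "?N \<subseteq> kernel ?F G \<phi>"
    unfolding normal_closure_def
    using \<phi>.normal_kernel \<phi>(3) R(2) by (intro Inter_lower) (auto simp: kernel_def)
  have "\<psi> \<in> iso G ?P"
    unfolding \<psi>.iso_iff
  proof (intro conjI ballI impI)
    show "carrier ?P \<subseteq> \<psi> ` carrier G"
    proof -
      have "carrier ?P = (\<lambda>w. \<psi> (\<phi> w)) ` carrier ?F"
        unfolding presented_group_def carrier_FactGroup using \<psi>\<phi> by (intro image_cong) auto
      then show ?thesis
        by auto
    qed
    fix x
    assume "x \<in> carrier G" "\<psi> x = \<one>\<^bsub>?P\<^esub>"
    then obtain w where w: "w \<in> carrier ?F" "x = \<phi> w"
      using \<phi>(2) by blast
    then have "?N #>\<^bsub>?F\<^esub> w = ?N"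
      using \<psi>\<phi> \<open>\<psi> x = \<one>\<^bsub>?P\<^esub>\<close> by (simp add: presented_group_def)
    then have "w \<in> ?N"
      using F.rcos_self[OF w(1) N.is_subgroup] by simp
    then show "x = \<one>\<^bsub>G\<^esub>"
      using \<open>?N \<subseteq> kernel ?F G \<phi>\<close> w(2) by (auto simp: kernel_def)
  qed
  then have "G \<cong> ?P"
    by (auto simp: is_iso_def)
  then show ?thesis
    unfolding finitely_presented_def using A R by blast
qed

lemma hom_edge_word:
  assumes "group F" "group P" and h: "h \<in> hom F P"
    and closed: "\<And>k. k < m \<Longrightarrow> e (\<iota> k) (\<iota> (Suc k)) \<in> carrier F"
  shows "edge_word F e \<iota> m \<in> carrier F" "h (edge_word F e \<iota> m) = edge_word P (\<lambda>i j. h (e i j)) \<iota> m"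
proof -
  interpret group_hom F P h
    using assms by (simp add: group_hom_def group_hom_axioms_def)
  have "edge_word F e \<iota> m \<in> carrier F \<and> h (edge_word F e \<iota> m) = edge_word P (\<lambda>i j. h (e i j)) \<iota> m"
    using closed by (induction m) auto
  then show "edge_word F e \<iota> m \<in> carrier F" "h (edge_word F e \<iota> m) = edge_word P (\<lambda>i j. h (e i j)) \<iota> m"
    by auto
qed

lemma edge_word_fun_cong:
  "(\<And>k. k < m \<Longrightarrow> e (\<iota> k) (\<iota> (Suc k)) = e' (\<iota> k) (\<iota> (Suc k))) \<Longrightarrow> edge_word P e \<iota> m = edge_word P e' \<iota> m"
  by (induction m) auto

text \<open>The cover \<open>U\<close> has base points \<open>pt i\<close>, with \<open>pt a\<close> the base point of the space, and \<open>\<beta> y\<close> is a path from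
  there to \<open>y\<close>.\<close>

locale good_cover =
  fixes X :: "'a::metric_space set" and x\<^sub>0 :: 'a and I :: "nat set" and U :: "nat \<Rightarrow> 'a set"
    and pt :: "nat \<Rightarrow> 'a" and a :: nat and \<beta> :: "'a \<Rightarrow> real \<Rightarrow> 'a"
  assumes finite_I: "finite I"
    and U_open: "\<And>i. i \<in> I \<Longrightarrow> openin (top_of_set X) (U i)"
    and cover: "X \<subseteq> (\<Union>i\<in>I. U i)"
    and U_path_connected: "\<And>i. i \<in> I \<Longrightarrow> path_connected (U i)"
    and pt: "\<And>i. i \<in> I \<Longrightarrow> pt i \<in> U i" "a \<in> I" "pt a = x\<^sub>0"
    and \<beta>: "\<And>y. y \<in> X \<Longrightarrow> path_from_to X x\<^sub>0 y (\<beta> y)" "\<beta> x\<^sub>0 = (\<lambda>_. x\<^sub>0)"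
    and null: "\<And>i j k x y z p q. i \<in> I \<Longrightarrow> j \<in> I \<Longrightarrow> k \<in> I \<Longrightarrow> z \<in> U i \<Longrightarrow> z \<in> U j \<Longrightarrow> z \<in> U k \<Longrightarrow>
      path_from_to (U i \<union> U j \<union> U k) x y p \<Longrightarrow> path_from_to (U i \<union> U j \<union> U k) x y q \<Longrightarrow> homotopic_paths X p q"
begin

lemma U_subset: "i \<in> I \<Longrightarrow> U i \<subseteq> X"
  using U_open openin_imp_subset by blast

lemma base_point: "x\<^sub>0 \<in> X" "x\<^sub>0 \<in> U a"
  using U_subset pt by auto

abbreviation G where "G \<equiv> fundamental_group X x\<^sub>0"

sublocale G: group G
  by (rule group_fundamental_group[OF base_point(1)])

text \<open>The retraction of the fundamental groupoid onto its vertex group at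
  \<open>x\<^sub>0\<close> given by the paths \<beta>.\<close>

definition pclass :: "(real \<Rightarrow> 'a) \<Rightarrow> (real \<Rightarrow> 'a) set" where
  "pclass p = path_class X ((\<beta> (pathstart p) +++ p) +++ reversepath (\<beta> (pathfinish p)))"

lemma conjugate_loops_at:
  assumes "path_from_to X y z p"
  shows "(\<beta> y +++ p) +++ reversepath (\<beta> z) \<in> loops_at X x\<^sub>0"
proof -
  have "y \<in> X" "z \<in> X"
    using assms pathstart_in_path_image[of p] pathfinish_in_path_image[of p] by auto
  then have "path_from_to X x\<^sub>0 x\<^sub>0 ((\<beta> y +++ p) +++ reversepath (\<beta> z))"
    using assms \<beta>(1) by (intro path_from_to_join[OF path_from_to_join path_from_to_reverse])
  then show ?thesis
    by (simp add: loops_at_def)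
qed

lemma pclass_closed:
  assumes "path_from_to X y z p"
  shows "pclass p \<in> carrier G"
  using conjugate_loops_at[OF assms] assms by (auto simp: pclass_def fundamental_group_def)

lemma pclass_homotopic:
  assumes "homotopic_paths X p q"
  shows "pclass p = pclass q"
proof -
  have p: "path_from_to X (pathstart p) (pathfinish p) p"
    using homotopic_paths_imp_path[OF assms] homotopic_paths_imp_subset[OF assms] by simp
  then have "pathstart p \<in> X" "pathfinish p \<in> X"
    using pathstart_in_path_image[of p] pathfinish_in_path_image[of p] by auto
  note \<beta>(1)[OF this(1)] \<beta>(1)[OF this(2)]
  then show ?thesis
    unfolding pclass_def homotopic_paths_imp_pathstart[OF assms, symmetric]
      homotopic_paths_imp_pathfinish[OF assms, symmetric]
    using p assms by (intro path_class_eq homotopic_paths_join) auto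
qed

lemma pclass_join:
  assumes p: "path_from_to X x y p" and q: "path_from_to X y z q"
  shows "pclass (p +++ q) = pclass p \<otimes>\<^bsub>G\<^esub> pclass q"
proof -
  have "x \<in> X" "y \<in> X" "z \<in> X"
    using p q pathstart_in_path_image[of p] pathfinish_in_path_image[of p] pathfinish_in_path_image[of q] by auto
  note b = \<beta>(1)[OF this(1)] \<beta>(1)[OF this(2)] \<beta>(1)[OF this(3)]
  note rb = path_from_to_reverse[OF b(2)] path_from_to_reverse[OF b(3)]
  let ?B = "\<beta> x +++ p" and ?R = "reversepath (\<beta> z)"
  note B = path_from_to_join[OF b(1) p]
  have "homotopic_paths X ((?B +++ reversepath (\<beta> y)) +++ ((\<beta> y +++ q) +++ ?R))
      (?B +++ (reversepath (\<beta> y) +++ ((\<beta> y +++ q) +++ ?R)))"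
    using B rb b q by (intro homotopic_paths_sym[OF homotopic_paths_assoc]) (auto simp: subset_path_image_join)
  also have "homotopic_paths X \<dots> (?B +++ ((reversepath (\<beta> y) +++ (\<beta> y +++ q)) +++ ?R))"
    by (rule homotopic_paths_join[OF _ homotopic_paths_assoc])
      (use B rb b q in \<open>auto simp: subset_path_image_join\<close>)
  also have "homotopic_paths X \<dots> (?B +++ (q +++ ?R))"
    by (rule homotopic_paths_join[OF _ homotopic_paths_join[OF homotopic_paths_cancel_left[OF b(2) q]]])
      (use B rb b q in \<open>auto simp: subset_path_image_join\<close>)
  also have "homotopic_paths X \<dots> ((?B +++ q) +++ ?R)"
    using B rb b q by (intro homotopic_paths_assoc) (auto simp: subset_path_image_join)
  also have "homotopic_paths X \<dots> ((\<beta> x +++ (p +++ q)) +++ ?R)"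
    by (rule homotopic_paths_join[OF homotopic_paths_sym[OF homotopic_paths_assoc]])
      (use B rb b p q in \<open>auto simp: subset_path_image_join\<close>)
  finally have "path_class X ((?B +++ reversepath (\<beta> y)) +++ ((\<beta> y +++ q) +++ ?R)) = pclass (p +++ q)"
    unfolding pclass_def using p q by (simp add: path_class_eq)
  then show ?thesis
    using mult_fundamental_group[OF conjugate_loops_at[OF p] conjugate_loops_at[OF q]] p q
    by (simp add: pclass_def)
qed

lemma pclass_loop:
  assumes "p \<in> loops_at X x\<^sub>0"
  shows "pclass p = path_class X p"
proof -
  have p: "path_from_to X x\<^sub>0 x\<^sub>0 p"
    using assms by (simp add: loops_at_def)
  have "reversepath (\<lambda>_. x\<^sub>0) = (\<lambda>_. x\<^sub>0)"
    by (simp add: reversepath_def)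
  moreover have "homotopic_paths X (((\<lambda>_. x\<^sub>0) +++ p) +++ (\<lambda>_. x\<^sub>0)) ((\<lambda>_. x\<^sub>0) +++ p)"
    using p base_point by (intro homotopic_paths_join_const) (auto simp: path_const subset_path_image_join)
  moreover have "homotopic_paths X ((\<lambda>_. x\<^sub>0) +++ p) p"
    using p by (intro homotopic_paths_const_join) auto
  ultimately show ?thesis
    using p \<beta>(2) homotopic_paths_trans unfolding pclass_def by (intro path_class_eq) auto
qed

lemma pclass_const:
  assumes "y \<in> X"
  shows "pclass (\<lambda>_. y) = \<one>\<^bsub>G\<^esub>"
proof -
  have y: "path_from_to X y y (\<lambda>_. y)"
    using assms by (simp add: path_const)
  have "pclass (\<lambda>_. y) = pclass ((\<lambda>_. y) +++ (\<lambda>_. y))"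
    using y by (intro pclass_homotopic homotopic_paths_sym[OF homotopic_paths_join_const]) auto
  also have "\<dots> = pclass (\<lambda>_. y) \<otimes>\<^bsub>G\<^esub> pclass (\<lambda>_. y)"
    by (rule pclass_join[OF y y])
  finally show ?thesis
    using pclass_closed[OF y] by (metis G.l_cancel_one')
qed

lemma pclass_base_path:
  assumes "y \<in> X"
  shows "pclass (\<beta> y) = \<one>\<^bsub>G\<^esub>"
proof -
  note b = \<beta>(1)[OF assms]
  have "homotopic_paths X (((\<lambda>_. x\<^sub>0) +++ \<beta> y) +++ reversepath (\<beta> y)) (\<beta> y +++ reversepath (\<beta> y))"
    using b by (intro homotopic_paths_join homotopic_paths_const_join) (auto simp: path_const)
  also have "homotopic_paths X \<dots> (\<lambda>_. x\<^sub>0)"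
    using b by (intro homotopic_paths_right_inverse) auto
  finally show ?thesis
    using b \<beta>(2) by (simp add: pclass_def path_class_eq fundamental_group_def)
qed

text \<open>The change of member happens at one point, a stretch in \<open>U i\<close> being
  followed by one in \<open>U j\<close>. This shape, and not only the image in the union, is what
  allows the value of an edge to be read off later.\<close>

definition link :: "nat \<Rightarrow> nat \<Rightarrow> (real \<Rightarrow> 'a) \<Rightarrow> bool" where
  "link i j c \<longleftrightarrow> (\<exists>z p q. path_from_to (U i) (pt i) z p \<and> path_from_to (U j) z (pt j) q \<and> c = p +++ q)"

definition edge :: "nat \<Rightarrow> nat \<Rightarrow> real \<Rightarrow> 'a" where
  "edge i j = (SOME c. link i j c)"

lemma link_edge:
  assumes "i \<in> I" "j \<in> I" "z \<in> U i" "z \<in> U j"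
  shows "link i j (edge i j)"
proof -
  obtain p where "path_from_to (U i) (pt i) z p"
    using U_path_connected[OF assms(1)] pt(1)[OF assms(1)] assms(3) unfolding path_connected_def by blast
  moreover obtain q where "path_from_to (U j) z (pt j) q"
    using U_path_connected[OF assms(2)] pt(1)[OF assms(2)] assms(4) unfolding path_connected_def by blast
  ultimately have "link i j (p +++ q)"
    unfolding link_def by blast
  then show ?thesis
    unfolding edge_def by (rule someI[of "link i j"])
qed

lemma path_edge:
  assumes "i \<in> I" "j \<in> I" "z \<in> U i" "z \<in> U j"
  shows "path_from_to (U i \<union> U j) (pt i) (pt j) (edge i j)"
proof -
  obtain w p q where "path_from_to (U i) (pt i) w p" "path_from_to (U j) w (pt j) q" "edge i j = p +++ q"
    using link_edge[OF assms] unfolding link_def by blast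
  then show ?thesis
    by (auto simp: path_image_join)
qed

lemma path_edge_X:
  assumes "i \<in> I" "j \<in> I" "z \<in> U i" "z \<in> U j"
  shows "path_from_to X (pt i) (pt j) (edge i j)"
  using path_edge[OF assms] U_subset assms(1,2) by blast

definition g :: "nat \<Rightarrow> nat \<Rightarrow> (real \<Rightarrow> 'a) set" where
  "g i j = pclass (edge i j)"

sublocale G: path_cocycle G X I U g
proof
  fix i j z
  assume "i \<in> I" "j \<in> I" "z \<in> U i" "z \<in> U j"
  then show "g i j \<in> carrier G"
    unfolding g_def by (rule pclass_closed[OF path_edge_X])
next
  fix i j k z
  assume ijk: "i \<in> I" "j \<in> I" "k \<in> I" and z: "z \<in> U i" "z \<in> U j" "z \<in> U k"
  have "path_from_to (U i \<union> U j \<union> U k) (pt i) (pt k) (edge i k)"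
    using path_edge[OF ijk(1,3) z(1,3)] by auto
  moreover have "path_from_to (U i \<union> U j \<union> U k) (pt i) (pt k) (edge i j +++ edge j k)"
    using path_edge[OF ijk(1,2) z(1,2)] path_edge[OF ijk(2,3) z(2,3)] by (auto simp: path_image_join)
  ultimately have "homotopic_paths X (edge i j +++ edge j k) (edge i k)"
    using null[OF ijk z] by blast
  then have "pclass (edge i j +++ edge j k) = g i k"
    unfolding g_def by (rule pclass_homotopic)
  then show "g i j \<otimes>\<^bsub>G\<^esub> g j k = g i k"
    unfolding g_def using pclass_join[OF path_edge_X[OF ijk(1,2) z(1,2)] path_edge_X[OF ijk(2,3) z(2,3)]] by simp
qed (use U_open cover in auto)

text \<open>The word lags behind the path by a detour \<open>d\<close> from the current point to the
  base point of the current member. Any detour inside that member will do, as they are all homotopic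
  in \<open>X\<close>.\<close>

lemma word_eq_pclass_segment:
  assumes l: "G.labels p m \<iota>" and p: "path p" "path_image p \<subseteq> X" "p 0 = pt (\<iota> 0)"
    and "k \<le> m" "path_from_to (U (\<iota> k)) (p (real k / real m)) (pt (\<iota> k)) d"
  shows "G.word \<iota> k = pclass (path_segment p 0 (real k / real m)) \<otimes>\<^bsub>G\<^esub> pclass d"
  using assms(5,6)
proof (induction k arbitrary: d)
  case 0
  have \<iota>: "\<iota> 0 \<in> I" "p 0 \<in> U (\<iota> 0)" "p 0 \<in> X"
    using path_labelsD(2)[OF l, of 0] path_labelsD(3)[OF l] U_subset by auto
  have "homotopic_paths X d (\<lambda>_. p 0)"
    using 0 \<iota> p(3) by (intro null[of "\<iota> 0" "\<iota> 0" "\<iota> 0" "p 0"]) (auto simp: path_const)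
  then have "pclass d = \<one>\<^bsub>G\<^esub>"
    using pclass_homotopic pclass_const[OF \<iota>(3)] by simp
  then show ?case
    using pclass_const[OF \<iota>(3)] by (simp add: path_segment_refl)
next
  case (Suc k)
  let ?s = "real k / real m" and ?t = "real (Suc k) / real m"
  have k: "k < m" "k \<le> m"
    using Suc.prems by auto
  have st: "0 \<le> ?s" "?s \<le> ?t" "?t \<le> 1"
    using k by (auto simp: divide_right_mono)
  have I: "\<iota> k \<in> I" "\<iota> (Suc k) \<in> I"
    using path_labelsD(2)[OF l] k by auto
  have s: "p ?s \<in> U (\<iota> k)" "p ?s \<in> U (\<iota> (Suc k))"
    using path_labels_end[OF l k(2)] path_labels_start[OF l k(1)] .
  obtain c where c: "path_from_to (U (\<iota> k)) (p ?s) (pt (\<iota> k)) c"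
    using U_path_connected[OF I(1)] pt(1)[OF I(1)] s(1) unfolding path_connected_def by blast
  have c': "path_from_to X (p ?s) (pt (\<iota> k)) c"
    using c U_subset[OF I(1)] by auto
  have d': "path_from_to X (p ?t) (pt (\<iota> (Suc k))) d"
    using Suc.prems(2) U_subset[OF I(2)] by auto
  note segs = path_from_to_path_segment[OF p(1,2) order_refl st(1) order_trans[OF st(2,3)]]
    path_from_to_path_segment[OF p(1,2) st]
  have seg: "path_from_to (U (\<iota> (Suc k))) (p ?s) (p ?t) (path_segment p ?s ?t)"
    using segs(2) st(2) path_labelsD(4)[OF l k(1)] by (auto simp: path_image_path_segment)
  note e = path_edge[OF I s] path_edge_X[OF I s]
  \<comment> \<open>The two ways around a quadrilateral, all within two members meeting at the
    breakpoint; the third index of \<open>null\<close> is a repetition.\<close>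
  have "homotopic_paths X (c +++ edge (\<iota> k) (\<iota> (Suc k))) (path_segment p ?s ?t +++ d)"
  proof (rule null[OF I(1) I(2) I(2) s(1) s(2) s(2)])
    show "path_from_to (U (\<iota> k) \<union> U (\<iota> (Suc k)) \<union> U (\<iota> (Suc k))) (p ?s) (pt (\<iota> (Suc k))) (c +++ edge (\<iota> k) (\<iota> (Suc k)))"
      using c e(1) by (auto simp: path_image_join)
    show "path_from_to (U (\<iota> k) \<union> U (\<iota> (Suc k)) \<union> U (\<iota> (Suc k))) (p ?s) (pt (\<iota> (Suc k))) (path_segment p ?s ?t +++ d)"
      using path_from_to_join[OF seg Suc.prems(2)] by auto
  qed
  from pclass_homotopic[OF this]
  have eq: "pclass c \<otimes>\<^bsub>G\<^esub> g (\<iota> k) (\<iota> (Suc k)) = pclass (path_segment p ?s ?t) \<otimes>\<^bsub>G\<^esub> pclass d"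
    using pclass_join[OF c' e(2)] pclass_join[OF segs(2) d'] by (simp add: g_def)
  have "G.word \<iota> (Suc k) = pclass (path_segment p 0 ?s) \<otimes>\<^bsub>G\<^esub> pclass c \<otimes>\<^bsub>G\<^esub> g (\<iota> k) (\<iota> (Suc k))"
    using Suc.IH[OF k(2) c] by simp
  also have "\<dots> = pclass (path_segment p 0 ?s) \<otimes>\<^bsub>G\<^esub> pclass (path_segment p ?s ?t) \<otimes>\<^bsub>G\<^esub> pclass d"
    using pclass_closed[OF segs(1)] pclass_closed[OF c'] pclass_closed[OF e(2)] pclass_closed[OF segs(2)] pclass_closed[OF d'] eq
    by (simp add: G.m_assoc g_def)
  also have "pclass (path_segment p 0 ?s) \<otimes>\<^bsub>G\<^esub> pclass (path_segment p ?s ?t) = pclass (path_segment p 0 ?t)"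
    using pclass_join[OF segs] pclass_homotopic[OF homotopic_paths_path_segments[OF p(1,2) order_refl st]] by simp
  finally show ?case .
qed

lemma val_eq_pclass:
  assumes l: "G.labels p m \<iota>" and p: "path p" "path_image p \<subseteq> X" "p 0 = pt (\<iota> 0)" "b \<in> I" "p 1 = pt b"
  shows "G.word \<iota> m \<otimes>\<^bsub>G\<^esub> g (\<iota> m) b = pclass p"
proof -
  have m: "real m / real m = 1"
    using path_labelsD(1)[OF l] by simp
  have I: "\<iota> m \<in> I" "p 1 \<in> U (\<iota> m)" "p 1 \<in> U b"
    using G.labels_end[OF l] pt(1)[OF p(4)] p(5) by auto
  obtain d where d: "path_from_to (U (\<iota> m)) (p 1) (pt (\<iota> m)) d"
    using U_path_connected[OF I(1)] pt(1)[OF I(1)] I(2) unfolding path_connected_def by blast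
  have d': "path_from_to X (p 1) (pt (\<iota> m)) d"
    using d U_subset[OF I(1)] by auto
  have p1: "p 1 \<in> X"
    using I U_subset by blast
  note e = path_edge[OF I(1) p(4) I(2,3)] path_edge_X[OF I(1) p(4) I(2,3)]
  have pp: "path_from_to X (p 0) (p 1) p"
    using p by (simp add: pathstart_def pathfinish_def)
  have "homotopic_paths X (d +++ edge (\<iota> m) b) (\<lambda>_. p 1)"
    using d e(1) p(5) I by (intro null[OF I(1) I(1) p(4) I(2) I(2) I(3)])
      (auto simp: path_const path_image_join)
  then have "pclass d \<otimes>\<^bsub>G\<^esub> g (\<iota> m) b = \<one>\<^bsub>G\<^esub>"
    using pclass_homotopic pclass_join[OF d' e(2)] pclass_const[OF p1] by (simp add: g_def)
  moreover have "G.word \<iota> m = pclass p \<otimes>\<^bsub>G\<^esub> pclass d"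
    using word_eq_pclass_segment[OF l p(1-3), of m d] m d by simp
  ultimately show ?thesis
    using pclass_closed[OF pp] pclass_closed[OF d'] pclass_closed[OF e(2)] by (simp add: g_def G.m_assoc)
qed

end

section \<open>The presentation of the fundamental group\<close>

context good_cover
begin

text \<open>Pairs are coded as numbers since \<open>finitely_presented\<close> takes its generators
  there. Diagonal pairs and both orientations are included; triangles with repeated indices make the
  former trivial and the latter mutually inverse in the quotient.\<close>

definition generators :: "nat set" where
  "generators = prod_encode ` {(i, j). i \<in> I \<and> j \<in> I \<and> U i \<inter> U j \<noteq> {}}"

abbreviation F where "F \<equiv> free_group generators"

sublocale F: group F
  by (rule group_free_group)

definition gen :: "nat \<Rightarrow> nat \<Rightarrow> nat letter list" where
  "gen i j = [(prod_encode (i, j), True)]"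

definition \<phi> :: "nat letter list \<Rightarrow> (real \<Rightarrow> 'a) set" where
  "\<phi> = word_eval G (\<lambda>n. g (fst (prod_decode n)) (snd (prod_decode n)))"

lemma gen_closed: "i \<in> I \<Longrightarrow> j \<in> I \<Longrightarrow> z \<in> U i \<Longrightarrow> z \<in> U j \<Longrightarrow> gen i j \<in> carrier F"
  unfolding gen_def by (rule generator_closed) (auto simp: generators_def)

lemma g_closed: "(\<lambda>n. g (fst (prod_decode n)) (snd (prod_decode n))) \<in> generators \<rightarrow> carrier G"
  by (auto simp: generators_def intro: G.e_closed)

sublocale \<phi>: group_hom F G \<phi>
  by unfold_locales (simp add: \<phi>_def word_eval_hom[OF G.is_group g_closed])

lemma \<phi>_gen:
  assumes "i \<in> I" "j \<in> I" "z \<in> U i" "z \<in> U j"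
  shows "\<phi> (gen i j) = g i j"
proof -
  have "prod_encode (i, j) \<in> generators"
    using assms by (auto simp: generators_def)
  from word_eval_generator[OF G.is_group g_closed this] show ?thesis
    by (simp add: \<phi>_def gen_def)
qed

lemma gen_labels_closed:
  assumes "G.labels p m \<iota>" "k < m"
  shows "gen (\<iota> k) (\<iota> (Suc k)) \<in> carrier F" "\<phi> (gen (\<iota> k) (\<iota> (Suc k))) = g (\<iota> k) (\<iota> (Suc k))"
proof -
  have "\<iota> k \<in> I" "\<iota> (Suc k) \<in> I" "p (real k / real m) \<in> U (\<iota> k)" "p (real k / real m) \<in> U (\<iota> (Suc k))"
    using assms path_labelsD(2)[OF assms(1)] path_labels_end[OF assms(1)] path_labels_start[OF assms] by auto
  then show "gen (\<iota> k) (\<iota> (Suc k)) \<in> carrier F" "\<phi> (gen (\<iota> k) (\<iota> (Suc k))) = g (\<iota> k) (\<iota> (Suc k))"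
    by (rule gen_closed, rule \<phi>_gen)
qed

text \<open>The holonomy lifted to the free group. There is no cocycle identity at this level, so it
  depends on the labels.\<close>

definition free_word :: "(nat \<Rightarrow> nat) \<Rightarrow> nat \<Rightarrow> nat \<Rightarrow> nat letter list" where
  "free_word \<iota> m b = edge_word F gen \<iota> m \<otimes>\<^bsub>F\<^esub> gen (\<iota> m) b"

lemma free_word:
  assumes l: "G.labels p m \<iota>" and b: "b \<in> I" "p 1 \<in> U b"
  shows "edge_word F gen \<iota> m \<in> carrier F" "gen (\<iota> m) b \<in> carrier F" "free_word \<iota> m b \<in> carrier F"
    "\<phi> (free_word \<iota> m b) = G.word \<iota> m \<otimes>\<^bsub>G\<^esub> g (\<iota> m) b"
proof -
  note gl = gen_labels_closed[OF l]
  have w: "edge_word F gen \<iota> m \<in> carrier F" "\<phi> (edge_word F gen \<iota> m) = edge_word G (\<lambda>i j. \<phi> (gen i j)) \<iota> m"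
    using hom_edge_word[OF F.is_group G.is_group \<phi>.homh, of m gen \<iota>] gl(1) by auto
  have "edge_word G (\<lambda>i j. \<phi> (gen i j)) \<iota> m = G.word \<iota> m"
    using gl(2) by (rule edge_word_fun_cong)
  moreover have e: "gen (\<iota> m) b \<in> carrier F" "\<phi> (gen (\<iota> m) b) = g (\<iota> m) b"
    using G.labels_end[OF l] b gen_closed[of _ _ "p 1"] \<phi>_gen[of _ _ "p 1"] by simp_all
  ultimately show "edge_word F gen \<iota> m \<in> carrier F" "gen (\<iota> m) b \<in> carrier F" "free_word \<iota> m b \<in> carrier F"
    "\<phi> (free_word \<iota> m b) = G.word \<iota> m \<otimes>\<^bsub>G\<^esub> g (\<iota> m) b"
    using w by (simp_all add: free_word_def)
qed

definition triangle :: "nat \<times> nat \<times> nat \<Rightarrow> nat letter list" where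
  "triangle = (\<lambda>(i, j, k). gen i j \<otimes>\<^bsub>F\<^esub> gen j k \<otimes>\<^bsub>F\<^esub> inv\<^bsub>F\<^esub> gen i k)"

definition base_labels :: "nat \<Rightarrow> nat \<times> (nat \<Rightarrow> nat)" where
  "base_labels i = (SOME x. G.labels (\<beta> (pt i)) (fst x) (snd x) \<and> snd x 0 = a)"

text \<open>The relators \<open>tree i\<close> spell out the paths \<open>\<beta> (pt i)\<close>; they play the role of a maximal tree.\<close>

definition tree :: "nat \<Rightarrow> nat letter list" where
  "tree i = free_word (snd (base_labels i)) (fst (base_labels i)) i"

definition R :: "nat letter list set" where
  "R = triangle ` {(i, j, k). i \<in> I \<and> j \<in> I \<and> k \<in> I \<and> (\<exists>z. z \<in> U i \<and> z \<in> U j \<and> z \<in> U k)} \<union> tree ` I"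

lemma base_path:
  assumes "i \<in> I"
  shows "path_from_to X x\<^sub>0 (pt i) (\<beta> (pt i))" "\<beta> (pt i) 0 = x\<^sub>0" "\<beta> (pt i) 1 = pt i"
proof -
  show b: "path_from_to X x\<^sub>0 (pt i) (\<beta> (pt i))"
    using \<beta>(1) U_subset pt(1) assms by blast
  then show "\<beta> (pt i) 0 = x\<^sub>0" "\<beta> (pt i) 1 = pt i"
    by (auto simp: pathstart_def pathfinish_def)
qed

lemma base_labels:
  assumes "i \<in> I"
  shows "G.labels (\<beta> (pt i)) (fst (base_labels i)) (snd (base_labels i))" "snd (base_labels i) 0 = a"
proof -
  have "\<exists>m \<iota>. G.labels (\<beta> (pt i)) m \<iota> \<and> \<iota> 0 = a"
    using base_path[OF assms] base_point pt(2) by (intro G.labels_exist) auto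
  then have "\<exists>x. G.labels (\<beta> (pt i)) (fst x) (snd x) \<and> snd x 0 = a"
    by simp
  then have "G.labels (\<beta> (pt i)) (fst (base_labels i)) (snd (base_labels i)) \<and> snd (base_labels i) 0 = a"
    unfolding base_labels_def by (rule someI_ex)
  then show "G.labels (\<beta> (pt i)) (fst (base_labels i)) (snd (base_labels i))" "snd (base_labels i) 0 = a"
    by auto
qed

lemma tree:
  assumes "i \<in> I"
  shows "tree i \<in> carrier F" "\<phi> (tree i) = \<one>\<^bsub>G\<^esub>"
proof -
  note b = base_path[OF assms] and l = base_labels[OF assms]
  have fin: "\<beta> (pt i) 1 \<in> U i"
    using b pt(1)[OF assms] by simp
  show "tree i \<in> carrier F"
    unfolding tree_def by (rule free_word(3)[OF l(1) assms fin])
  have "pt i \<in> X"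
    using U_subset[OF assms] pt(1)[OF assms] by blast
  have "\<phi> (tree i) = pclass (\<beta> (pt i))"
    unfolding tree_def free_word(4)[OF l(1) assms fin]
    using b l(2) pt(3) assms by (intro val_eq_pclass[OF l(1)]) auto
  then show "\<phi> (tree i) = \<one>\<^bsub>G\<^esub>"
    using pclass_base_path[OF \<open>pt i \<in> X\<close>] by simp
qed

lemma triangle:
  assumes "i \<in> I" "j \<in> I" "k \<in> I" "z \<in> U i" "z \<in> U j" "z \<in> U k"
  shows "triangle (i, j, k) \<in> carrier F" "\<phi> (triangle (i, j, k)) = \<one>\<^bsub>G\<^esub>"
proof -
  have c: "gen i j \<in> carrier F" "gen j k \<in> carrier F" "gen i k \<in> carrier F"
    using assms by (auto intro: gen_closed)
  then show "triangle (i, j, k) \<in> carrier F"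
    by (simp add: triangle_def)
  have "\<phi> (gen i j) = g i j" "\<phi> (gen j k) = g j k" "\<phi> (gen i k) = g i k"
    using assms \<phi>_gen[of _ _ z] by simp_all
  moreover have "g i k \<in> carrier G"
    using assms by (auto intro: G.e_closed)
  ultimately show "\<phi> (triangle (i, j, k)) = \<one>\<^bsub>G\<^esub>"
    using c G.cocycle[OF assms] by (simp add: triangle_def)
qed

lemma R: "R \<subseteq> carrier F" "finite R" "r \<in> R \<Longrightarrow> \<phi> r = \<one>\<^bsub>G\<^esub>"
proof -
  show "R \<subseteq> carrier F" "r \<in> R \<Longrightarrow> \<phi> r = \<one>\<^bsub>G\<^esub>"
    using tree triangle unfolding R_def by blast+
  have "finite {(i, j, k). i \<in> I \<and> j \<in> I \<and> k \<in> I \<and> (\<exists>z. z \<in> U i \<and> z \<in> U j \<and> z \<in> U k)}"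
    by (rule finite_subset[of _ "I \<times> I \<times> I"]) (use finite_I in auto)
  then show "finite R"
    unfolding R_def using finite_I by simp
qed

section \<open>Values of paths in the presented group\<close>

abbreviation N where "N \<equiv> normal_closure F R"
abbreviation P where "P \<equiv> presented_group generators R"
abbreviation coset where "coset w \<equiv> N #>\<^bsub>F\<^esub> w"

sublocale N: normal N F
  by (rule normal_normal_closure[OF group_free_group R(1)])

sublocale P: group P
  by (rule group_presented_group[OF R(1)])

lemma coset_hom: "coset \<in> hom F P"
  unfolding presented_group_def by (rule N.r_coset_hom_Mod)

sublocale coset: group_hom F P coset
  by unfold_locales (rule coset_hom)

lemma coset_relator: "r \<in> R \<Longrightarrow> coset r = \<one>\<^bsub>P\<^esub>"
proof -
  assume "r \<in> R"
  then have "r \<in> N"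
    unfolding normal_closure_def by blast
  then show ?thesis
    using N.rcos_const[OF F.is_group] by (simp add: presented_group_def)
qed

text \<open>The triangle relators are precisely the cocycle identities; homotopy invariance of
  values in the presented group follows from them alone.\<close>

sublocale P: path_cocycle P X I U "\<lambda>i j. coset (gen i j)"
proof
  fix i j z
  assume "i \<in> I" "j \<in> I" "z \<in> U i" "z \<in> U j"
  then show "coset (gen i j) \<in> carrier P"
    using gen_closed coset.hom_closed by blast
next
  fix i j k z
  assume ijk: "i \<in> I" "j \<in> I" "k \<in> I" "z \<in> U i" "z \<in> U j" "z \<in> U k"
  then have c: "gen i j \<in> carrier F" "gen j k \<in> carrier F" "gen i k \<in> carrier F"
    by (auto intro: gen_closed)
  have "triangle (i, j, k) \<in> R"
    unfolding R_def using ijk by blast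
  then have "coset (triangle (i, j, k)) = \<one>\<^bsub>P\<^esub>"
    by (rule coset_relator)
  moreover have "triangle (i, j, k) \<otimes>\<^bsub>F\<^esub> gen i k = gen i j \<otimes>\<^bsub>F\<^esub> gen j k"
    using c by (simp add: triangle_def F.m_assoc)
  ultimately show "coset (gen i j) \<otimes>\<^bsub>P\<^esub> coset (gen j k) = coset (gen i k)"
    using c triangle(1)[OF ijk] by (metis coset.hom_mult coset.hom_closed P.l_one)
qed (use U_open cover in auto)

text \<open>The relator \<open>tree i\<close> was read off a labelling of this very path.\<close>

lemma val_base_path:
  assumes "i \<in> I"
  shows "P.val (\<beta> (pt i)) a i \<one>\<^bsub>P\<^esub>"
proof -
  let ?m = "fst (base_labels i)" and ?\<iota> = "snd (base_labels i)"
  note b = base_path[OF assms] and l = base_labels[OF assms]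
  have fin: "\<beta> (pt i) 1 \<in> U i"
    using b pt(1)[OF assms] by simp
  note w = free_word[OF l(1) assms fin]
  have "coset (edge_word F gen ?\<iota> ?m) = P.word ?\<iota> ?m"
    using gen_labels_closed(1)[OF l(1)] by (rule hom_edge_word(2)[OF F.is_group P.is_group coset_hom])
  then have "coset (tree i) = P.word ?\<iota> ?m \<otimes>\<^bsub>P\<^esub> coset (gen (?\<iota> ?m) i)"
    using w(1,2) by (simp add: tree_def free_word_def)
  moreover have "coset (tree i) = \<one>\<^bsub>P\<^esub>"
    using assms by (intro coset_relator) (simp add: R_def)
  ultimately show ?thesis
    unfolding P.val_def using l assms fin by (intro exI[of _ ?m] exI[of _ ?\<iota>]) simp
qed

text \<open>Neither stretch of the link contributes; the relabelling from \<open>i\<close> to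
  \<open>j\<close> at their common point contributes the generator.\<close>

lemma val_edge:
  assumes ij: "i \<in> I" "j \<in> I" "z \<in> U i" "z \<in> U j"
  shows "P.val (edge i j) i j (coset (gen i j))"
proof -
  obtain w p q where pq: "path_from_to (U i) (pt i) w p" "path_from_to (U j) w (pt j) q" "edge i j = p +++ q"
    using link_edge[OF assms] unfolding link_def by blast
  then have w: "p 1 = w" "q 0 = w" "w \<in> U j"
    using pathstart_in_path_image[of q] by (auto simp: pathstart_def pathfinish_def)
  have "P.val p i j (\<one>\<^bsub>P\<^esub> \<otimes>\<^bsub>P\<^esub> coset (gen i j))"
    using pq(1) ij(1,2) w by (intro P.val_relabel_end P.val_inside) auto
  moreover have "P.val q j j \<one>\<^bsub>P\<^esub>"
    using pq(2) ij(2) by (intro P.val_inside) auto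
  ultimately have "P.val (p +++ q) i j (\<one>\<^bsub>P\<^esub> \<otimes>\<^bsub>P\<^esub> coset (gen i j) \<otimes>\<^bsub>P\<^esub> \<one>\<^bsub>P\<^esub>)"
    using w by (intro P.val_join) auto
  then show ?thesis
    using pq(3) P.e_closed[OF ij] by simp
qed

lemma val_const: "P.val (\<lambda>_. x\<^sub>0) a a \<one>\<^bsub>P\<^esub>"
  using pt(2) base_point by (intro P.val_inside) (auto simp: path_const)

text \<open>Reversed labellings are avoided: going out and back is homotopic to a constant path,
  which forces the value.\<close>

lemma val_reverse_base_path:
  assumes "i \<in> I"
  shows "P.val (reversepath (\<beta> (pt i))) i a \<one>\<^bsub>P\<^esub>"
proof -
  note b = base_path[OF assms]
  let ?r = "reversepath (\<beta> (pt i))"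
  have "?r 0 = pt i" "?r 1 = x\<^sub>0"
    using b by (auto simp: reversepath_def)
  then obtain h where h: "P.val ?r i a h"
    using P.val_exists[of ?r i a] b(1) assms pt base_point by auto
  have "P.val (\<beta> (pt i) +++ ?r) a a (\<one>\<^bsub>P\<^esub> \<otimes>\<^bsub>P\<^esub> h)"
    using \<open>?r 0 = pt i\<close> b(3) by (intro P.val_join[OF val_base_path[OF assms] h]) simp
  moreover have "homotopic_paths X (\<beta> (pt i) +++ ?r) (\<lambda>_. x\<^sub>0)"
    using b(1) by (intro homotopic_paths_right_inverse) auto
  ultimately have "P.val (\<lambda>_. x\<^sub>0) a a (\<one>\<^bsub>P\<^esub> \<otimes>\<^bsub>P\<^esub> h)"
    by (rule P.val_homotopic[rotated])
  then have "\<one>\<^bsub>P\<^esub> \<otimes>\<^bsub>P\<^esub> h = \<one>\<^bsub>P\<^esub>"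
    using val_const by (rule P.val_unique)
  then show ?thesis
    using h P.val_closed[OF h] by simp
qed

definition \<psi> :: "(real \<Rightarrow> 'a) set \<Rightarrow> nat letter list set" where
  "\<psi> C = (SOME h. \<exists>p\<in>C. P.val p a a h)"

lemma \<psi>_eq:
  assumes "p \<in> loops_at X x\<^sub>0" "P.val p a a h"
  shows "\<psi> (path_class X p) = h"
proof -
  have "p \<in> path_class X p"
    using assms(1) by (simp add: loops_at_def)
  then have "\<exists>h. \<exists>p\<in>path_class X p. P.val p a a h"
    using assms(2) by blast
  then have "\<exists>q\<in>path_class X p. P.val q a a (\<psi> (path_class X p))"
    unfolding \<psi>_def by (rule someI_ex)
  then obtain q where "homotopic_paths X p q" "P.val q a a (\<psi> (path_class X p))"
    by auto
  then show ?thesis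
    using P.val_homotopic[OF _ assms(2)] P.val_unique by blast
qed

lemma loop_val:
  assumes "p \<in> loops_at X x\<^sub>0"
  shows "p 0 = x\<^sub>0" "p 1 = x\<^sub>0" "\<exists>h. P.val p a a h"
proof -
  show p: "p 0 = x\<^sub>0" "p 1 = x\<^sub>0"
    using assms by (auto simp: loops_at_def pathstart_def pathfinish_def)
  show "\<exists>h. P.val p a a h"
    using assms p pt(2) base_point by (intro P.val_exists) (auto simp: loops_at_def)
qed

lemma \<psi>_hom: "\<psi> \<in> hom G P"
proof (rule homI)
  fix C
  assume "C \<in> carrier G"
  then obtain p where p: "p \<in> loops_at X x\<^sub>0" "C = path_class X p"
    by (auto simp: fundamental_group_def)
  obtain h where h: "P.val p a a h"
    using loop_val[OF p(1)] by blast
  then show "\<psi> C \<in> carrier P"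
    using \<psi>_eq[OF p(1) h] p(2) P.val_closed by simp
  fix D
  assume "D \<in> carrier G"
  then obtain q where q: "q \<in> loops_at X x\<^sub>0" "D = path_class X q"
    by (auto simp: fundamental_group_def)
  obtain k where k: "P.val q a a k"
    using loop_val[OF q(1)] by blast
  have "P.val (p +++ q) a a (h \<otimes>\<^bsub>P\<^esub> k)"
    using P.val_join[OF h k] loop_val(2)[OF p(1)] loop_val(1)[OF q(1)] by simp
  from \<psi>_eq[OF loops_at_join[OF p(1) q(1)] this]
  show "\<psi> (C \<otimes>\<^bsub>G\<^esub> D) = \<psi> C \<otimes>\<^bsub>P\<^esub> \<psi> D"
    using \<psi>_eq[OF p(1) h] \<psi>_eq[OF q(1) k] p q by (simp add: mult_fundamental_group)
qed

text \<open>Here the tree relators are spent: they make the conjugating paths in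
  \<open>pclass\<close> contribute nothing.\<close>

lemma \<psi>_g:
  assumes ij: "i \<in> I" "j \<in> I" "z \<in> U i" "z \<in> U j"
  shows "\<psi> (g i j) = coset (gen i j)"
proof -
  note e = path_edge_X[OF ij]
  have ends: "edge i j 0 = pt i" "edge i j 1 = pt j"
    using e by (auto simp: pathstart_def pathfinish_def)
  have "P.val (\<beta> (pt i) +++ edge i j) a j (\<one>\<^bsub>P\<^esub> \<otimes>\<^bsub>P\<^esub> coset (gen i j))"
    using ends base_path(3)[OF ij(1)] by (intro P.val_join[OF val_base_path[OF ij(1)] val_edge[OF ij]]) simp
  moreover have "(\<beta> (pt i) +++ edge i j) 1 = reversepath (\<beta> (pt j)) 0"
    using ends base_path(3)[OF ij(2)] by (simp add: joinpaths_def reversepath_def)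
  ultimately have "P.val ((\<beta> (pt i) +++ edge i j) +++ reversepath (\<beta> (pt j))) a a
      (\<one>\<^bsub>P\<^esub> \<otimes>\<^bsub>P\<^esub> coset (gen i j) \<otimes>\<^bsub>P\<^esub> \<one>\<^bsub>P\<^esub>)"
    by (rule P.val_join[OF _ val_reverse_base_path[OF ij(2)]])
  from \<psi>_eq[OF conjugate_loops_at[OF e] this] show ?thesis
    using P.e_closed[OF ij] e by (simp add: g_def pclass_def)
qed

lemma \<phi>_surj: "carrier G \<subseteq> \<phi> ` carrier F"
proof
  fix C
  assume "C \<in> carrier G"
  then obtain p where p: "p \<in> loops_at X x\<^sub>0" "C = path_class X p"
    by (auto simp: fundamental_group_def)
  note ends = loop_val(1,2)[OF p(1)]
  obtain m \<iota> where \<iota>: "G.labels p m \<iota>" "\<iota> 0 = a"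
    using G.labels_exist[of p a] p(1) ends base_point pt(2) by (auto simp: loops_at_def)
  have "p 1 \<in> U a"
    using ends base_point by simp
  note w = free_word[OF \<iota>(1) pt(2) this]
  have "\<phi> (free_word \<iota> m a) = pclass p"
    unfolding w(4) using \<iota> ends pt p(1) by (intro val_eq_pclass) (auto simp: loops_at_def)
  also have "\<dots> = C"
    using pclass_loop p by simp
  finally show "C \<in> \<phi> ` carrier F"
    using w(3) by blast
qed

lemma finitely_presented_fundamental_group: "finitely_presented G"
proof (rule finitely_presentedI[OF G.is_group _ R(2,1) \<phi>.homh \<phi>_surj R(3) \<psi>_hom])
  have "finite {(i, j). i \<in> I \<and> j \<in> I \<and> U i \<inter> U j \<noteq> {}}"
    by (rule finite_subset[of _ "I \<times> I"]) (use finite_I in auto)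
  then show "finite generators"
    by (simp add: generators_def)
  fix n
  assume "n \<in> generators"
  then obtain i j z where "n = prod_encode (i, j)" and ij: "i \<in> I" "j \<in> I" "z \<in> U i" "z \<in> U j"
    by (auto simp: generators_def)
  then show "\<psi> (\<phi> [(n, True)]) = coset [(n, True)]"
    using \<psi>_g[OF ij] \<phi>_gen[OF ij] by (simp add: gen_def)
qed

end

lemma good_cover_exists:
  fixes X :: "'a::metric_space set"
  assumes X: "compact X" "connected X" "locally connected X" "x\<^sub>0 \<in> X"
    and \<delta>: "\<delta> > 0" "\<forall>y\<in>X. \<forall>z. \<forall>p\<in>loops_at (X \<inter> ball y \<delta>) z. homotopic_paths X p (\<lambda>_. z)"
  shows "\<exists>I U pt a \<beta>. good_cover X x\<^sub>0 I U pt a \<beta>"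
proof -
  have lpc: "locally path_connected X"
    using X(1,3) by (rule compact_locally_connected_imp_locally_path_connected)
  \<comment> \<open>The radius is half of \<delta> so that all members through a point
    \<open>z\<close> lie in \<open>ball z \<delta>\<close>; path components make the members path
    connected, and local path connectedness makes them open.\<close>
  define V where "V y = path_component_set (X \<inter> ball y (\<delta> / 2)) y" for y
  have y: "y \<in> X \<inter> ball y (\<delta> / 2)" if "y \<in> X" for y
    using that \<delta>(1) by simp
  have V: "openin (top_of_set X) (V y)" "path_connected (V y)" "y \<in> V y" "V y \<subseteq> X \<inter> ball y (\<delta> / 2)"
    if "y \<in> X" for y
  proof -
    show "openin (top_of_set X) (V y)"
      unfolding V_def using y[OF that] by (intro locally_path_connected_2[OF lpc]) auto
    show "path_connected (V y)"
      unfolding V_def by (rule path_connected_path_component)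
    show "y \<in> V y"
      unfolding V_def using y[OF that] by (simp add: path_component_refl)
    show "V y \<subseteq> X \<inter> ball y (\<delta> / 2)"
      unfolding V_def by (rule path_component_subset)
  qed
  have "\<forall>y\<in>X. \<exists>W. open W \<and> V y = X \<inter> W"
    using V(1) by (simp add: openin_open)
  from bchoice[OF this] obtain W where W: "\<forall>y\<in>X. open (W y) \<and> V y = X \<inter> W y" ..
  obtain C where C: "C \<subseteq> X" "finite C" "X \<subseteq> (\<Union>y\<in>C. W y)"
  proof (rule compactE_image[OF X(1), of X W])
    show "X \<subseteq> (\<Union>y\<in>X. W y)"
      using W V(3) by blast
  qed (use W in auto)
  obtain n :: nat and h where h: "bij_betw h {0..<n} C"
    using ex_bij_betw_nat_finite[OF C(2)] by blast
  define I where "I = {0..<n}"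
  define U where "U i = V (h i)" for i
  have hC: "h i \<in> X" if "i \<in> I" for i
    using that h C(1) bij_betwE unfolding I_def by blast
  have cover: "X \<subseteq> (\<Union>i\<in>I. U i)"
  proof
    fix x
    assume "x \<in> X"
    then obtain y where y: "y \<in> C" "x \<in> W y"
      using C(3) by blast
    then obtain i where "i \<in> I" "h i = y"
      using h unfolding I_def bij_betw_def by blast
    moreover have "x \<in> V y"
      using W y C(1) \<open>x \<in> X\<close> by blast
    ultimately show "x \<in> (\<Union>i\<in>I. U i)"
      unfolding U_def by blast
  qed
  obtain a where a: "a \<in> I" "x\<^sub>0 \<in> U a"
    using cover X(4) by blast
  have "path_connected X"
    using X(2) path_component_eq_connected_component[OF lpc]
    unfolding path_connected_component connected_iff_connected_component by simp
  then have "\<forall>y\<in>X. \<exists>b. path_from_to X x\<^sub>0 y b"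
    using X(4) unfolding path_connected_def by simp
  from bchoice[OF this] obtain b where b: "\<forall>y\<in>X. path_from_to X x\<^sub>0 y (b y)" ..
  have near: "U i \<subseteq> X \<inter> ball z \<delta>" if "i \<in> I" "z \<in> U i" for i z
  proof
    fix w
    assume "w \<in> U i"
    then have "dist (h i) z < \<delta> / 2" "dist (h i) w < \<delta> / 2" "w \<in> X"
      using V(4)[OF hC[OF that(1)]] that unfolding U_def by auto
    then show "w \<in> X \<inter> ball z \<delta>"
      using dist_triangle[of z w "h i"] by (simp add: dist_commute)
  qed
  \<comment> \<open>One member containing \<open>x\<^sub>0\<close> takes it as its base point, and
    the path to \<open>x\<^sub>0\<close> is made constant, so that a loop at
    \<open>x\<^sub>0\<close> can be read with start and end label \<open>a\<close> and no
    conjugation.\<close>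
  have "good_cover X x\<^sub>0 I U (\<lambda>i. if i = a then x\<^sub>0 else h i) a (\<lambda>y. if y = x\<^sub>0 then (\<lambda>_. x\<^sub>0) else b y)"
  proof
    fix i j k x y z and p q :: "real \<Rightarrow> 'a"
    assume ijk: "i \<in> I" "j \<in> I" "k \<in> I" "z \<in> U i" "z \<in> U j" "z \<in> U k"
      and pq: "path_from_to (U i \<union> U j \<union> U k) x y p" "path_from_to (U i \<union> U j \<union> U k) x y q"
    have sub: "U i \<union> U j \<union> U k \<subseteq> X \<inter> ball z \<delta>" and z: "z \<in> X"
      using near ijk V(4)[OF hC[OF ijk(1)]] unfolding U_def by blast+
    have p: "path_from_to (X \<inter> ball z \<delta>) x y p" and q: "path_from_to (X \<inter> ball z \<delta>) x y q"
      using pq sub by auto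
    have "p +++ reversepath q \<in> loops_at (X \<inter> ball z \<delta>) x"
      using path_from_to_join[OF p path_from_to_reverse[OF q]] by (simp add: loops_at_def)
    then have "homotopic_paths X (p +++ reversepath q) (\<lambda>_. x)"
      using \<delta>(2) z by blast
    then show "homotopic_paths X p q"
      by (rule homotopic_paths_if_loop_null[where y = y, rotated 2]) (use p q in auto)
  qed (use V hC cover a b X(4) in \<open>auto simp: U_def I_def path_const\<close>)
  then show ?thesis
    by blast
qed

theorem theorem3p5:
  fixes X :: "'a::metric_space set" and x\<^sub>0 :: 'a
  assumes "peano_continuum X"
    and "x\<^sub>0 \<in> X"
    and "countable (carrier (fundamental_group X x\<^sub>0))"
  shows "finitely_presented (fundamental_group X x\<^sub>0)"
proof -
  have X: "compact X" "connected X" "locally connected X"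
    using assms(1) by (simp_all add: peano_continuum_def)
  obtain \<delta> where "\<delta> > 0" "\<forall>y\<in>X. \<forall>z. \<forall>p\<in>loops_at (X \<inter> ball y \<delta>) z. homotopic_paths X p (\<lambda>_. z)"
    by (rule countable_imp_small_loops_null[OF X assms(2,3)])
  then obtain I U pt a \<beta> where "good_cover X x\<^sub>0 I U pt a \<beta>"
    using good_cover_exists[OF X assms(2)] by blast
  then show ?thesis
    by (rule good_cover.finitely_presented_fundamental_group)
qed

end
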